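(* Let $\Omega\subset\mathbb{R}^d$ ($d\ge1$) be a bounded open domain. Let $a\in L^\infty(\Omega)$ satisfy $a\ge\underline{a}$ almost everywhere in $\Omega$ for some constant $\underline{a}>0$, and assume that there exist $q\ge2$, $\alpha\in(0,1]$ with $\alpha q\in(d/2,d]$, and $g\in L^q(\Omega)$ such that $|a(x)-a(y)|\le g(x)|x-y|^\alpha$ for a.e. $(x,y)\in\Omega^2$. Let $u\in H^1(\Omega)$ be a weak solution of $-\operatorname{div}(a\nabla u)=\operatorname{div}F$ in $\Omega$, where $F\in W^{\alpha,q}(\Omega)$. Let $\Omega'\Subset\Omega$ be a $\theta$-smooth subdomain (for some $\theta>0$). Then $$\nabla u\in W^{\beta',\frac{2\alpha q}{d+2\beta}}(\Omega'),\qquad\forall\beta\in(0,\alpha)\cap[\beta_{\min},\beta_{\max}],\quad\forall\,0\le\beta'<\beta,$$ where $$\beta_{\min}:=\frac{3\alpha-d}{2}\qquad\text{and}\qquad\beta_{\max}:=\alpha q-\frac d2.$$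
   Context: $\Omega'\Subset\Omega$ means that $\Omega'\subset\Omega$ is an open subdomain with $\operatorname{dist}(\Omega',\partial\Omega)>0$. A bounded open set $D\subset\mathbb{R}^d$ is $\theta$-smooth if $|B(x,r)\cap D|\ge\theta v_d r^d$ for all $x\in D$ and all $r\in(0,\operatorname{diam}D)$, where $v_d$ is the volume of the unit ball of $\mathbb{R}^d$. Weak solution: $F$ is a square-integrable vector field on $\Omega$ and $\int_\Omega a\nabla u\cdot\nabla\varphi=-\int_\Omega F\cdot\nabla\varphi$ for all $\varphi\in C_c^\infty(\Omega)$. For $s\in(0,1)$ and $1\le t<\infty$, $W^{s,t}(D)$ is the fractional Sobolev (Sobolev–Slobodeckij) space of $v\in L^t(D)$ with $(x,y)\mapsto |v(x)-v(y)|/|x-y|^{s+d/t}$ in $L^t(D^2)$; $W^{0,t}=L^t$ and $W^{1,t}$ is the usual Sobolev space. *)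

theory Defs
  imports "HOL-Analysis.Analysis"
begin

text \<open>Throughout, the ambient space $\mathbb{R}^d$ is a type of class \<open>euclidean_space\<close>
  with \<open>d = DIM('a)\<close> (which is at least 1), and functions on an open set \<open>D\<close> are total functions
  of which only the values on \<open>D\<close> matter.\<close>

subsection \<open>Lebesgue spaces\<close>

definition Lp_on :: "real \<Rightarrow> 'a::euclidean_space set \<Rightarrow> ('a \<Rightarrow> 'b::euclidean_space) set" where
  "Lp_on t D = {v. v \<in> borel_measurable (lebesgue_on D) \<and>
                   integrable (lebesgue_on D) (\<lambda>x. norm (v x) powr t)}"

definition Linf_on :: "'a::euclidean_space set \<Rightarrow> ('a \<Rightarrow> 'b::euclidean_space) set" where
  "Linf_on D = {v. v \<in> borel_measurable (lebesgue_on D) \<and>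
                   (\<exists>C. AE x in lebesgue_on D. norm (v x) \<le> C)}"

definition L1_loc :: "'a::euclidean_space set \<Rightarrow> ('a \<Rightarrow> 'b::euclidean_space) set" where
  "L1_loc D = {v. \<forall>K. compact K \<and> K \<subseteq> D \<longrightarrow> v absolutely_integrable_on K}"

subsection \<open>Test functions\<close>

primrec Ck :: "nat \<Rightarrow> ('a::euclidean_space \<Rightarrow> real) \<Rightarrow> bool" where
  "Ck 0 f \<longleftrightarrow> continuous_on UNIV f"
| "Ck (Suc k) f \<longleftrightarrow> (\<forall>x. f differentiable (at x)) \<and>
     (\<forall>i\<in>Basis. Ck k (\<lambda>x. frechet_derivative f (at x) i))"

text \<open>$C_c^\infty(D)$, each function being extended by zero to the whole space.\<close>

definition test_functions :: "'a::euclidean_space set \<Rightarrow> ('a \<Rightarrow> real) set" where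
  "test_functions D = {\<phi>. (\<forall>k. Ck k \<phi>) \<and>
     compact (closure {x. \<phi> x \<noteq> 0}) \<and> closure {x. \<phi> x \<noteq> 0} \<subseteq> D}"

definition grad :: "('a::euclidean_space \<Rightarrow> real) \<Rightarrow> 'a \<Rightarrow> 'a" where
  "grad \<phi> x = (\<Sum>i\<in>Basis. frechet_derivative \<phi> (at x) i *\<^sub>R i)"

subsection \<open>Weak derivatives and Sobolev spaces\<close>

text \<open>Local integrability has to be required: the integral of a non-integrable function is 0 by
  convention, so the integral identity alone would not determine \<open>w\<close> almost everywhere.\<close>

definition weak_partial ::
  "'a::euclidean_space set \<Rightarrow> 'a \<Rightarrow> ('a \<Rightarrow> 'b::euclidean_space) \<Rightarrow> ('a \<Rightarrow> 'b) \<Rightarrow> bool" where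
  "weak_partial D i v w \<longleftrightarrow> v \<in> L1_loc D \<and> w \<in> L1_loc D \<and>
     (\<forall>\<phi>\<in>test_functions D.
        (LINT x|lebesgue_on D. frechet_derivative \<phi> (at x) i *\<^sub>R v x) =
        - (LINT x|lebesgue_on D. \<phi> x *\<^sub>R w x))"

text \<open>\<open>G\<close> is a representative of the weak gradient of \<open>u\<close>, which is unique up to null sets.\<close>

definition weak_gradient ::
  "'a::euclidean_space set \<Rightarrow> ('a \<Rightarrow> real) \<Rightarrow> ('a \<Rightarrow> 'a) \<Rightarrow> bool" where
  "weak_gradient D u G \<longleftrightarrow> (\<forall>i\<in>Basis. weak_partial D i u (\<lambda>x. G x \<bullet> i))"

text \<open>The space $W^{s,t}(D)$, intended for $0 \le s \le 1$ and $1 \le t < \infty$. In the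
  difference quotient the diagonal \<open>x = y\<close> is a null set (and contributes \<open>0 / 0 = 0\<close>).\<close>

definition Sobolev :: "real \<Rightarrow> real \<Rightarrow> 'a::euclidean_space set \<Rightarrow> ('a \<Rightarrow> 'b::euclidean_space) set"
  where
  "Sobolev s t D =
     (if s = 0 then Lp_on t D
      else if s = 1 then
        {v \<in> Lp_on t D. \<forall>i\<in>Basis. \<exists>w\<in>Lp_on t D. weak_partial D i v w}
      else
        {v \<in> Lp_on t D.
           (\<lambda>(x, y). norm (v x - v y) / norm (x - y) powr (s + real DIM('a) / t))
             \<in> Lp_on t (D \<times> D)})"

subsection \<open>Weak solutions of $-\mathrm{div}(a \nabla u) = \mathrm{div} F$\<close>

definition weak_solution ::
  "'a::euclidean_space set \<Rightarrow> ('a \<Rightarrow> real) \<Rightarrow> ('a \<Rightarrow> 'a) \<Rightarrow> ('a \<Rightarrow> real) \<Rightarrow> bool" where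
  "weak_solution D a F u \<longleftrightarrow> F \<in> Lp_on 2 D \<and> u \<in> Sobolev 1 2 D \<and>
     (\<exists>G. weak_gradient D u G \<and>
       (\<forall>\<phi>\<in>test_functions D.
          (LINT x|lebesgue_on D. a x * (G x \<bullet> grad \<phi> x)) =
          - (LINT x|lebesgue_on D. F x \<bullet> grad \<phi> x)))"

subsection \<open>Geometric notions\<close>

text \<open>Note that \<open>setdist\<close> is 0 if one of the sets is empty; the boundary of a nonempty bounded
  open set is never empty.\<close>

definition compactly_inside :: "'a::euclidean_space set \<Rightarrow> 'a set \<Rightarrow> bool" where
  "compactly_inside D' D \<longleftrightarrow> open D' \<and> D' \<subseteq> D \<and> setdist D' (frontier D) > 0"

definition theta_smooth :: "real \<Rightarrow> 'a::euclidean_space set \<Rightarrow> bool" where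
  "theta_smooth \<theta> D \<longleftrightarrow> bounded D \<and> open D \<and>
     (\<forall>x\<in>D. \<forall>r\<in>{0<..<diameter D}.
        measure lebesgue (ball x r \<inter> D) \<ge> \<theta> * measure lebesgue (ball (0::'a) 1) * r ^ DIM('a))"

end

theory Submission
  imports Defs
begin

text \<open>Write $G = \nabla u$, let $d$ be the dimension and $p = 2\alpha q/(d+2\beta)$. The bounds on
  \<open>\<beta>\<close> and the hypothesis $\alpha q \le d$ give $1 \le p < 2$. The theorem follows from a pointwise
  estimate $|G(x) - G(y)| \le C |x-y|^\gamma (A(x) + A(y) + 1)$ with $\beta' < \gamma < \beta$ and a
  weight $A$ in $L^p$, valid for almost all nearby points of \<open>\<Omega>'\<close>: integrating its $p$-th power
  against $|x-y|^{-d-\beta' p}$ leaves the integrable kernel $|x-y|^{(\gamma-\beta')p-d}$.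

  To get the estimate, freeze the coefficient at a point $x$. For all test functions,
  $a(x) \int G \cdot \nabla\varphi = - \int f_x \cdot \nabla\varphi$ with
  $f_x = F - F(x) + (a - a(x)) G$. There is a pair of bumps with $\nabla\psi(z) = - z \rho(z)$, so the
  kernels $\rho_t(y - x) = t^{-d} \rho((y-x)/t)$ satisfy
  $\partial_t \rho_t(y-x) = t^{-d-1} (\Delta\psi)((y-x)/t)$. Let $V_t(x)$ be the integral of a component
  of $G$ against $\rho_t(\cdot - x)$. Since $G$ is a gradient and solves the frozen equation,
  $\partial_t V_t(x)$ is an integral of $f_x$ against second derivatives of $\psi((\cdot - x)/t)$; it is
  therefore at most a constant times $t^{-d-1} \int_{B_t(x)} |f_x|$. If
  $A(x) = \int_{B_{2R}(x)} |f_x(y)|\,|x-y|^{-d-\gamma}\,dy$ is finite, this is $O(t^{\gamma-1} A(x))$, and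
  $\partial_t (V_t(x) - V_t(y)) = O(|x-y|\,t^{\gamma-2} A(x))$ for $|x-y| \le t$, still with the equation
  frozen at $x$. Integrating the first bound from $0$ to $|x-y|$ and the second one from $|x-y|$ to
  $R$ yields the pointwise estimate (\<open>pointwise_holder_of_scale_bounds\<close>,
  \<open>weak_gradient_pointwise_holder\<close>).

  It remains to see that $A$ is in $L^p$ (\<open>holder_weight_Lp\<close>). Interpolating between the bound on
  $a$ and the hypothesis on $a(x) - a(y)$ gives
  $|a(x) - a(y)| \le C |g(x)|^{\beta/\alpha} |x-y|^\beta$. So the coefficient contributes
  $|g|^{\beta/\alpha}$ times the Riesz potential of order $\beta - \gamma$ of $|G|$, that is, a function in
  $L^{\alpha q/\beta}$ times one in $L^2$, and $1/2 + \beta/(\alpha q) \le 1/p$ because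
  $\alpha q \le d$. The datum contributes the oscillation integral
  $\int_{B_{2R}(x)} |F(y) - F(x)|\,|x-y|^{-d-\gamma}\,dy$, which is in $L^2$
  (\<open>oscillation_L2_of_Sobolev\<close>): for $\alpha < 1$ by the Cauchy--Schwarz inequality and the
  Gagliardo seminorm of $F$, and for $\alpha = 1$ because the scale argument above, applied to $F$
  itself, bounds $|F(x) - F(y)|$ by Riesz potentials of $|\nabla F|$.\<close>

section \<open>Smooth bumps supported in the unit ball\<close>

text \<open>The functions $s^{-n} e^{-1/s}$, extended by zero to $s \le 0$. Unlike the single function
  $e^{-1/s}$, the family is closed under differentiation up to linear combinations, which reduces
  smoothness to one computation.\<close>

definition flat_exp :: "nat \<Rightarrow> real \<Rightarrow> real" where
  "flat_exp n s = (if s > 0 then (1 / s) ^ n * exp (- (1 / s)) else 0)"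

lemma flat_exp_right_limit: "((\<lambda>s. (1 / s) ^ n * exp (- (1 / s))) \<longlongrightarrow> 0) (at_right (0::real))"
proof -
  have "((\<lambda>x::real. x ^ n / exp x) \<longlongrightarrow> 0) at_top"
    by (rule tendsto_power_div_exp_0)
  from filterlim_compose[OF this filterlim_inverse_at_top_right]
  show ?thesis
    by (simp add: exp_minus field_simps inverse_eq_divide)
qed

lemma flat_exp_has_derivative:
  "(flat_exp n has_real_derivative flat_exp (n + 2) s - real n * flat_exp (n + 1) s) (at s)"
proof -
  consider "s > 0" | "s < 0" | "s = 0" by linarith
  then show ?thesis
  proof cases
    case 1
    have "((\<lambda>s. (1 / s) ^ n * exp (- (1 / s))) has_real_derivative
            flat_exp (n + 2) s - real n * flat_exp (n + 1) s) (at s)"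
    proof -
      have eq: "real n * (1 / s) ^ (n - 1) * (- (1 / s\<^sup>2)) = - (real n * (1 / s) ^ (n + 1))"
        by (cases n) (auto simp: power2_eq_square)
      have "((\<lambda>s. (1 / s) ^ n * exp (- (1 / s))) has_real_derivative
         (real n * (1 / s) ^ (n - 1) * (- (1 / s\<^sup>2))) * exp (- (1 / s))
          + (1 / s) ^ n * (exp (- (1 / s)) * (1 / s\<^sup>2))) (at s)"
        using 1 by (intro DERIV_cong[OF DERIV_mult[where f = "\<lambda>s. (1 / s) ^ n"
            and Da = "real n * (1 / s) ^ (n - 1) * (- (1 / s\<^sup>2))"]])
          (auto intro!: derivative_eq_intros simp: power2_eq_square)
      then show ?thesis
        unfolding eq using 1 by (simp add: flat_exp_def power2_eq_square algebra_simps)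
    qed
    then show ?thesis
      by (rule has_field_derivative_transform_within_open[where S = "{0<..}"])
         (use 1 in \<open>auto simp: flat_exp_def\<close>)
  next
    case 2
    have "((\<lambda>s::real. 0::real) has_real_derivative 0) (at s)" by simp
    then have "(flat_exp n has_real_derivative 0) (at s)"
      by (rule has_field_derivative_transform_within_open[where S = "{..<0}"])
         (use 2 in \<open>auto simp: flat_exp_def\<close>)
    then show ?thesis using 2 by (simp add: flat_exp_def)
  next
    case 3
    have "((\<lambda>h. flat_exp n h / h) \<longlongrightarrow> 0) (at_right 0)"
    proof (rule Lim_transform_eventually[OF flat_exp_right_limit[of "n + 1"]])
      show "\<forall>\<^sub>F h in at_right 0. (1 / h) ^ (n + 1) * exp (- (1 / h)) = flat_exp n h / h"
        using eventually_at_right_less[of 0] by eventually_elim (auto simp: flat_exp_def)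
    qed
    moreover have "((\<lambda>h. flat_exp n h / h) \<longlongrightarrow> 0) (at_left 0)"
    proof (rule Lim_transform_eventually[OF tendsto_const])
      show "\<forall>\<^sub>F h in at_left 0. 0 = flat_exp n h / h"
        unfolding eventually_at_left_field using lt_ex by (auto simp: flat_exp_def)
    qed
    ultimately have "((\<lambda>h. flat_exp n h / h) \<longlongrightarrow> 0) (at 0)"
      by (simp add: filterlim_split_at)
    then show ?thesis
      using 3 by (simp add: DERIV_def flat_exp_def)
  qed
qed

lemma flat_exp_nonneg: "flat_exp n s \<ge> 0"
  by (simp add: flat_exp_def)

text \<open>The partial derivative in the form that occurs in \<^const>\<open>weak_partial\<close>; the first argument is an
  arbitrary direction.\<close>

definition pd :: "'a::euclidean_space \<Rightarrow> ('a \<Rightarrow> real) \<Rightarrow> 'a \<Rightarrow> real" where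
  "pd i f = (\<lambda>x. frechet_derivative f (at x) i)"

text \<open>A supply of smooth functions supported in the unit ball, chosen so that closure under partial
  derivatives follows by rule induction from the product rule.\<close>

inductive_set bumps :: "('a::euclidean_space \<Rightarrow> real) set" where
  radial: "(\<lambda>z. flat_exp n (1 - z \<bullet> z)) \<in> bumps"
| add: "f \<in> bumps \<Longrightarrow> g \<in> bumps \<Longrightarrow> (\<lambda>z. f z + g z) \<in> bumps"
| scale: "f \<in> bumps \<Longrightarrow> (\<lambda>z. c * f z) \<in> bumps"
| coord: "f \<in> bumps \<Longrightarrow> (\<lambda>z. (z \<bullet> i) * f z) \<in> bumps"

lemma bumps_sum:
  assumes "finite A" "\<And>j. j \<in> A \<Longrightarrow> f j \<in> bumps"
  shows "(\<lambda>z. \<Sum>j\<in>A. f j z) \<in> bumps"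
  using assms
proof (induction rule: finite_induct)
  case empty
  show ?case using bumps.scale[OF bumps.radial, of 0] by simp
next
  case (insert x A)
  then show ?case using bumps.add[of "f x" "\<lambda>z. \<Sum>j\<in>A. f j z"] by simp
qed

lemma pd_I: "(f has_derivative f') (at z) \<Longrightarrow> pd i f z = f' i"
  unfolding pd_def by (metis frechet_derivative_at)

lemma has_derivative_pd: "f differentiable (at z) \<Longrightarrow> (f has_derivative (\<lambda>i. pd i f z)) (at z)"
  by (simp add: pd_def frechet_derivative_works)

text \<open>The chain rule: $\nabla (1 - |z|^2) = - 2 z$, which is the source of the factor $-2 (z \cdot i)$.\<close>

lemma radial_derivative:
  "((\<lambda>z. flat_exp n (1 - z \<bullet> z)) has_derivative
     (\<lambda>i. - 2 * ((z \<bullet> i) * (flat_exp (n + 2) (1 - z \<bullet> z) - real n * flat_exp (n + 1) (1 - z \<bullet> z)))))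
     (at z)"
proof -
  have "((\<lambda>z. 1 - z \<bullet> z) has_derivative (\<lambda>i. - 2 * (z \<bullet> i))) (at z)"
    by (auto intro!: derivative_eq_intros simp: inner_commute)
  from has_derivative_compose[OF this flat_exp_has_derivative[unfolded has_field_derivative_def]]
  show ?thesis by (rule has_derivative_eq_rhs) (simp add: fun_eq_iff algebra_simps)
qed

lemma bumps_deriv:
  assumes "f \<in> bumps"
  shows "f differentiable (at z)" and "pd i f \<in> bumps"
proof -
  have "(\<forall>z. f differentiable (at z)) \<and> (\<forall>i. pd i f \<in> bumps)"
    using assms
  proof induction
    case (radial n)
    have "pd i (\<lambda>z. flat_exp n (1 - z \<bullet> z)) =
       (\<lambda>z. (-2) * ((z \<bullet> i) * (flat_exp (n + 2) (1 - z \<bullet> z) + (- real n) * flat_exp (n + 1) (1 - z \<bullet> z))))" for i :: 'a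
      using pd_I[OF radial_derivative] by (auto simp: fun_eq_iff)
    moreover have "\<dots> i \<in> bumps" for i :: 'a
      by (intro bumps.intros)
    ultimately have "\<forall>i::'a. pd i (\<lambda>z. flat_exp n (1 - z \<bullet> z)) \<in> bumps" by simp
    then show ?case using radial_derivative[of n] unfolding differentiable_def by blast
  next
    case (add f g)
    then have "((\<lambda>z. f z + g z) has_derivative (\<lambda>i. pd i f z + pd i g z)) (at z)" for z
      by (intro has_derivative_add has_derivative_pd) auto
    note d = this
    have "pd i (\<lambda>z. f z + g z) = (\<lambda>z. pd i f z + pd i g z)" for i
      using pd_I[OF d] by auto
    moreover have "(\<lambda>z. pd i f z + pd i g z) \<in> bumps" for i
      using add by (intro bumps.intros) auto
    ultimately have "\<forall>i. pd i (\<lambda>z. f z + g z) \<in> bumps" by simp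
    then show ?case using d unfolding differentiable_def by blast
  next
    case (scale f c)
    then have "((\<lambda>z. c * f z) has_derivative (\<lambda>i. c * pd i f z)) (at z)" for z
      by (intro has_derivative_mult_right has_derivative_pd) auto
    note d = this
    have "pd i (\<lambda>z. c * f z) = (\<lambda>z. c * pd i f z)" for i
      using pd_I[OF d] by auto
    moreover have "(\<lambda>z. c * pd i f z) \<in> bumps" for i
      using scale by (intro bumps.intros) auto
    ultimately have "\<forall>i. pd i (\<lambda>z. c * f z) \<in> bumps" by simp
    then show ?case using d unfolding differentiable_def by blast
  next
    case (coord f j)
    have "((\<lambda>z. (z \<bullet> j) * f z) has_derivative (\<lambda>i. (z \<bullet> j) * pd i f z + (i \<bullet> j) * f z)) (at z)" for z
      by (rule has_derivative_mult[of "\<lambda>z. z \<bullet> j" "\<lambda>i. i \<bullet> j"])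
        (use coord in \<open>auto intro!: has_derivative_pd derivative_eq_intros\<close>)
    note d = this
    have "pd i (\<lambda>z. (z \<bullet> j) * f z) = (\<lambda>z. (z \<bullet> j) * pd i f z + (i \<bullet> j) * f z)" for i
      using pd_I[OF d] by auto
    moreover have "(\<lambda>z. (z \<bullet> j) * pd i f z + (i \<bullet> j) * f z) \<in> bumps" for i
      using coord by (intro bumps.intros) auto
    ultimately have "\<forall>i. pd i (\<lambda>z. (z \<bullet> j) * f z) \<in> bumps" by simp
    then show ?case using d unfolding differentiable_def by blast
  qed
  then show "f differentiable (at z)" and "pd i f \<in> bumps" by auto
qed

lemma bumps_has_derivative: "f \<in> bumps \<Longrightarrow> (f has_derivative (\<lambda>i. pd i f z)) (at z)"
  by (rule has_derivative_pd[OF bumps_deriv(1)])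

lemma pd_linear: "f \<in> bumps \<Longrightarrow> linear (\<lambda>i. pd i f z)"
  using has_derivative_linear[OF bumps_has_derivative[of f z]] by simp

lemma pd_add: "f \<in> bumps \<Longrightarrow> g \<in> bumps \<Longrightarrow> pd i (\<lambda>z. f z + g z) = (\<lambda>z. pd i f z + pd i g z)"
  using pd_I[OF has_derivative_add[OF bumps_has_derivative bumps_has_derivative]] by (auto simp: fun_eq_iff)

lemma pd_scale: "f \<in> bumps \<Longrightarrow> pd i (\<lambda>z. c * f z) = (\<lambda>z. c * pd i f z)"
  using pd_I[OF has_derivative_mult_right[OF bumps_has_derivative]] by (auto simp: fun_eq_iff)

lemma pd_coord:
  assumes "f \<in> bumps"
  shows "pd i (\<lambda>z. (z \<bullet> j) * f z) = (\<lambda>z. (i \<bullet> j) * f z + (z \<bullet> j) * pd i f z)"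
proof
  fix z
  have "((\<lambda>z. (z \<bullet> j) * f z) has_derivative (\<lambda>i. (z \<bullet> j) * pd i f z + (i \<bullet> j) * f z)) (at z)"
    by (rule has_derivative_mult[of "\<lambda>z. z \<bullet> j" "\<lambda>i. i \<bullet> j"])
      (use assms in \<open>auto intro!: bumps_has_derivative derivative_eq_intros\<close>)
  from pd_I[OF this, of i] show "pd i (\<lambda>z. (z \<bullet> j) * f z) z = (i \<bullet> j) * f z + (z \<bullet> j) * pd i f z"
    by simp
qed

lemma pd_radial:
  "pd i (\<lambda>z. flat_exp n (1 - z \<bullet> z)) =
     (\<lambda>z. (-2) * ((z \<bullet> i) * (flat_exp (n + 2) (1 - z \<bullet> z) + (- real n) * flat_exp (n + 1) (1 - z \<bullet> z))))"
  using pd_I[OF radial_derivative] by (auto simp: fun_eq_iff)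

text \<open>For a radial function $h(|z|^2)$ the mixed derivative is
  $2 (i \cdot j) h' + 4 (z \cdot i)(z \cdot j) h''$, visibly symmetric; the other generators of the
  class preserve symmetry by the product rule.\<close>

lemma pd_commute:
  assumes "f \<in> bumps"
  shows "pd i (pd j f) = pd j (pd i f)"
  using assms
proof induction
  case (radial n)
  define h :: "'a \<Rightarrow> real" where
    "h = (\<lambda>z. flat_exp (n + 2) (1 - z \<bullet> z) + (- real n) * flat_exp (n + 1) (1 - z \<bullet> z))"
  have hb: "h \<in> bumps" unfolding h_def by (intro bumps.intros)
  have ex: "\<exists>k. \<forall>i z. pd i h z = (z \<bullet> i) * k z"
  proof -
    have 1: "pd i h = (\<lambda>z. pd i (\<lambda>z. flat_exp (n + 2) (1 - z \<bullet> z)) z + pd i (\<lambda>z. (- real n) * flat_exp (n + 1) (1 - z \<bullet> z)) z)" for i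
      unfolding h_def by (rule pd_add[OF bumps.radial bumps.scale[OF bumps.radial]])
    have 2: "pd i (\<lambda>z. (- real n) * flat_exp (n + 1) (1 - z \<bullet> z)) = (\<lambda>z. (- real n) * pd i (\<lambda>z. flat_exp (n + 1) (1 - z \<bullet> z)) z)" for i :: 'a
      by (rule pd_scale[OF bumps.radial])
    have "pd i h z = (z \<bullet> i) * ((-2) * ((flat_exp (n + 2 + 2) (1 - z \<bullet> z) + (- real (n+2)) * flat_exp (n + 2 + 1) (1 - z \<bullet> z))
      - real n * (flat_exp (n + 1 + 2) (1 - z \<bullet> z) + (- real (n+1)) * flat_exp (n + 1 + 1) (1 - z \<bullet> z))))" for i z
      unfolding 1 2 pd_radial by (simp only: algebra_simps)
    then show ?thesis
      by (intro exI[of _ "\<lambda>z. (-2) * ((flat_exp (n + 2 + 2) (1 - z \<bullet> z) + (- real (n+2)) * flat_exp (n + 2 + 1) (1 - z \<bullet> z))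
      - real n * (flat_exp (n + 1 + 2) (1 - z \<bullet> z) + (- real (n+1)) * flat_exp (n + 1 + 1) (1 - z \<bullet> z)))"]) blast
  qed
  then obtain k where k: "\<And>i z. pd i h z = (z \<bullet> i) * k z" by metis
  have e: "pd i (\<lambda>z. flat_exp n (1 - z \<bullet> z)) = (\<lambda>z. (-2) * ((z \<bullet> i) * h z))" for i :: 'a
    unfolding h_def by (rule pd_radial)
  show ?case
    unfolding e pd_scale[OF bumps.coord[OF hb]] pd_coord[OF hb] k
    by (simp add: inner_commute algebra_simps)
next
  case (add f g)
  then show ?case by (simp add: pd_add bumps_deriv)
next
  case (scale f c)
  then show ?case by (simp add: pd_scale bumps_deriv)
next
  case (coord f l)
  then have *: "pd i (pd j (\<lambda>z. (z \<bullet> l) * f z)) = (\<lambda>z. (j \<bullet> l) * pd i f z + ((i \<bullet> l) * pd j f z + (z \<bullet> l) * pd i (pd j f) z))" for i j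
    by (simp add: pd_add pd_coord pd_scale bumps_deriv bumps.coord bumps.scale)
  show ?case unfolding * using coord.IH by (simp add: fun_eq_iff)
qed

lemma bumps_outside: "f \<in> bumps \<Longrightarrow> norm z \<ge> 1 \<Longrightarrow> f z = 0"
proof (induction rule: bumps.induct)
  case (radial n)
  then have "1 \<le> z \<bullet> z" by (simp add: norm_le_square norm_eq_sqrt_inner)
  then show ?case by (simp add: flat_exp_def)
qed auto

lemma bumps_continuous: "f \<in> bumps \<Longrightarrow> continuous_on S f"
  using bumps_deriv(1) by (meson continuous_at_imp_continuous_on differentiable_imp_continuous_within)

lemma bumps_measurable: "f \<in> bumps \<Longrightarrow> f \<in> borel_measurable borel"
  by (intro borel_measurable_continuous_onI bumps_continuous)

lemma bumps_bounded:
  assumes "f \<in> bumps"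
  obtains M where "M \<ge> 0" "\<And>z. \<bar>f z\<bar> \<le> M"
proof -
  have "compact (f ` cball 0 1)"
    by (intro compact_continuous_image bumps_continuous assms) auto
  then obtain M where M: "\<And>z. z \<in> cball 0 1 \<Longrightarrow> \<bar>f z\<bar> \<le> M"
    by (metis bounded_iff compact_imp_bounded imageI real_norm_def)
  have "\<bar>f z\<bar> \<le> max M 0" for z
    using M[of z] bumps_outside[OF assms, of z] by (cases "norm z \<le> 1") auto
  then show ?thesis using that[of "max M 0"] by auto
qed

lemma bumps_lipschitz:
  fixes f :: "'a::euclidean_space \<Rightarrow> real"
  assumes f: "f \<in> bumps"
  obtains L where "L \<ge> 0" "\<And>z w. \<bar>f z - f w\<bar> \<le> L * norm (z - w)"
proof -
  have "\<forall>i. \<exists>M. M \<ge> 0 \<and> (\<forall>z. \<bar>pd i f z\<bar> \<le> M)"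
    using bumps_bounded[OF bumps_deriv(2)[OF f]] by metis
  then obtain M where M: "\<And>i. M i \<ge> 0" "\<And>i z. \<bar>pd i f z\<bar> \<le> M i" by metis
  define L where "L = (\<Sum>i\<in>Basis. M (i::'a))"
  have "onorm (\<lambda>i. pd i f z) \<le> L" for z
  proof (rule onorm_bound)
    show "0 \<le> L" unfolding L_def by (intro sum_nonneg M)
    fix v :: 'a
    have lin: "linear (\<lambda>i. pd i f z)"
      by (rule pd_linear[OF f])
    have "pd v f z = pd (\<Sum>i\<in>Basis. (v \<bullet> i) *\<^sub>R i) f z" by (simp add: euclidean_representation)
    also have "\<dots> = (\<Sum>i\<in>Basis. (v \<bullet> i) * pd i f z)"
      by (simp add: linear_sum[OF lin] linear_cmul[OF lin])
    also have "norm \<dots> \<le> (\<Sum>i\<in>Basis. norm v * M i)"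
      by (intro sum_norm_le) (auto simp: abs_mult intro!: mult_mono M Basis_le_norm)
    finally show "norm (pd v f z) \<le> L * norm v"
      by (simp add: L_def sum_distrib_left mult.commute)
  qed
  then have "\<bar>f z - f w\<bar> \<le> L * norm (z - w)" for z w
    using differentiable_bound[of UNIV f "\<lambda>z i. pd i f z" L w z] bumps_has_derivative[OF f]
    by (simp add: abs_minus_commute norm_minus_commute)
  moreover have "L \<ge> 0" unfolding L_def by (intro sum_nonneg M)
  ultimately show ?thesis using that by blast
qed

definition dilate :: "'a::euclidean_space \<Rightarrow> real \<Rightarrow> ('a \<Rightarrow> real) \<Rightarrow> 'a \<Rightarrow> real" where
  "dilate x t f = (\<lambda>y. f ((1 / t) *\<^sub>R (y - x)))"

lemma dilate_has_derivative:
  assumes "f \<in> bumps"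
  shows "(dilate x t f has_derivative (\<lambda>i. (1 / t) * dilate x t (pd i f) y)) (at y)"
proof -
  have "((\<lambda>y. (1 / t) *\<^sub>R (y - x)) has_derivative (\<lambda>i. (1 / t) *\<^sub>R i)) (at y)"
    by (auto intro!: derivative_eq_intros)
  from has_derivative_compose[OF this bumps_has_derivative[OF assms]]
  have "(dilate x t f has_derivative (\<lambda>i. pd ((1 / t) *\<^sub>R i) f ((1 / t) *\<^sub>R (y - x)))) (at y)"
    by (simp add: dilate_def)
  moreover have "pd ((1 / t) *\<^sub>R i) f z = (1 / t) * pd i f z" for i z
    using has_derivative_linear[OF bumps_has_derivative[OF assms, of z]] linear_cmul by fastforce
  ultimately show ?thesis by (simp add: dilate_def)
qed

lemma pd_dilate: "f \<in> bumps \<Longrightarrow> pd i (dilate x t f) = (\<lambda>y. (1 / t) * dilate x t (pd i f) y)"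
  using pd_I[OF dilate_has_derivative] by (auto simp: fun_eq_iff)

text \<open>Differentiation only changes the bump and the scalar factor, so the induction has to run over all
  bumps and all factors at once.\<close>

lemma dilate_bump_Ck: "f \<in> bumps \<Longrightarrow> Ck k (\<lambda>y. c * dilate x t f y)"
proof (induction k arbitrary: f c)
  case 0
  then show ?case
    unfolding Ck.simps dilate_def
    by (intro continuous_intros continuous_on_compose2[OF bumps_continuous[of f UNIV]]) auto
next
  case (Suc k)
  have d: "((\<lambda>y. c * dilate x t f y) has_derivative (\<lambda>i. c * ((1 / t) * dilate x t (pd i f) y))) (at y)" for y
    by (intro has_derivative_mult_right dilate_has_derivative Suc)
  have "pd i (\<lambda>y. c * dilate x t f y) = (\<lambda>y. (c * (1 / t)) * dilate x t (pd i f) y)" for i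
    using pd_I[OF d] by (auto simp: fun_eq_iff)
  moreover have "Ck k (\<lambda>y. (c * (1 / t)) * dilate x t (pd i f) y)" for i
    by (rule Suc.IH[OF bumps_deriv(2)[OF Suc.prems]])
  ultimately have "Ck k (pd i (\<lambda>y. c * dilate x t f y))" for i by simp
  then show ?case
    using d unfolding Ck.simps differentiable_def pd_def by blast
qed

lemma dilate_outside:
  assumes "f \<in> bumps" "t > 0" "y \<notin> ball x t"
  shows "dilate x t f y = 0"
  unfolding dilate_def using assms
  by (intro bumps_outside) (auto simp: dist_norm norm_minus_commute)

text \<open>These are the only test functions that the proof uses: bumps rescaled to a ball inside the domain.\<close>

lemma dilate_test_function:
  assumes f: "f \<in> bumps" and t: "t > 0" and sub: "cball x t \<subseteq> D"
  shows "dilate x t f \<in> test_functions D"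
proof -
  have "{y. dilate x t f y \<noteq> 0} \<subseteq> ball x t"
    using dilate_outside[OF f t] by blast
  then have cl: "closure {y. dilate x t f y \<noteq> 0} \<subseteq> cball x t"
    by (metis ball_subset_cball closed_cball closure_minimal subset_trans)
  then have "compact (closure {y. dilate x t f y \<noteq> 0})"
    by (metis bounded_cball bounded_subset closed_closure compact_eq_bounded_closed)
  moreover have "Ck k (dilate x t f)" for k
    using dilate_bump_Ck[OF f, of k 1] by simp
  ultimately show ?thesis using cl sub by (auto simp: test_functions_def)
qed

text \<open>The bumps \<open>psi\<close> and \<open>rho\<close> are matched so that $\nabla\psi(z) = - z \rho(z)$; this makes the scale
  derivative of the kernel $t^{-d} \rho(\cdot/t)$ a Laplacian.\<close>

definition psi :: "'a::euclidean_space \<Rightarrow> real" where "psi = (\<lambda>z. flat_exp 0 (1 - z \<bullet> z))"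
definition rho :: "'a::euclidean_space \<Rightarrow> real" where "rho = (\<lambda>z. 2 * flat_exp 2 (1 - z \<bullet> z))"
definition lap_psi :: "'a::euclidean_space \<Rightarrow> real" where
  "lap_psi = (\<lambda>z. \<Sum>j\<in>Basis. pd j (pd j psi) z)"

lemma psi_bump: "psi \<in> bumps" unfolding psi_def by (rule bumps.radial)
lemma rho_bump: "rho \<in> bumps" unfolding rho_def by (intro bumps.intros)
lemma lap_psi_bump: "lap_psi \<in> bumps"
  unfolding lap_psi_def by (intro bumps_sum bumps_deriv psi_bump) auto

lemma pd_psi: "pd i psi = (\<lambda>z. (- 1) * ((z \<bullet> i) * rho z))"
  unfolding psi_def rho_def pd_radial by (simp add: fun_eq_iff numeral_2_eq_2)

text \<open>Taking the divergence of $\nabla\psi = - z \rho$ gives $- d\,\rho - z \cdot \nabla\rho$, which is also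
  what differentiating $t^{-d} \rho(z/t)$ in $t$ produces at $t = 1$.\<close>

lemma lap_psi_eq:
  "lap_psi (z::'a::euclidean_space) = - (real DIM('a) * rho z + pd z rho z)"
proof -
  have lin: "linear (\<lambda>i. pd i rho z)"
    by (rule pd_linear[OF rho_bump])
  have "pd z rho z = pd (\<Sum>i\<in>Basis. (z \<bullet> i) *\<^sub>R i) rho z" by (simp add: euclidean_representation)
  also have "\<dots> = (\<Sum>i\<in>Basis. (z \<bullet> i) * pd i rho z)"
    by (simp add: linear_sum[OF lin] linear_cmul[OF lin])
  finally have *: "pd z rho z = (\<Sum>i\<in>Basis. (z \<bullet> i) * pd i rho z)" .
  have "pd j (pd j psi) z = - (rho z + (z \<bullet> j) * pd j rho z)" if "j \<in> Basis" for j :: 'a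
    unfolding pd_psi pd_scale[OF bumps.coord[OF rho_bump]] pd_coord[OF rho_bump]
    using that by simp
  then show ?thesis unfolding lap_psi_def * by (simp add: sum_negf sum.distrib sum_subtractf)
qed

text \<open>The identity on which the whole argument rests: changing the scale of the averaging kernel changes
  it by the Laplacian of a compactly supported bump, which can be moved onto a weak equation.\<close>

lemma dilated_rho_scale_derivative:
  fixes x y :: "'a::euclidean_space"
  assumes t: "t > 0"
  shows "((\<lambda>t. dilate x t rho y / t ^ DIM('a)) has_real_derivative
            dilate x t lap_psi y / t ^ (DIM('a) + 1)) (at t)"
proof -
  define w where "w = (1 / t) *\<^sub>R (y - x)"
  have lin: "linear (\<lambda>i. pd i rho w)"
    by (rule pd_linear[OF rho_bump])
  have "((\<lambda>t. (1 / t) *\<^sub>R (y - x)) has_derivative (\<lambda>h. (- h / t\<^sup>2) *\<^sub>R (y - x))) (at t)"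
    using t by (auto intro!: derivative_eq_intros simp: power2_eq_square field_simps)
  from has_derivative_compose[OF this bumps_has_derivative[OF rho_bump]]
  have "((\<lambda>t. dilate x t rho y) has_derivative (\<lambda>h. pd ((- h / t\<^sup>2) *\<^sub>R (y - x)) rho w)) (at t)"
    by (simp add: dilate_def w_def)
  moreover have "pd ((- h / t\<^sup>2) *\<^sub>R (y - x)) rho w = (- pd w rho w / t) * h" for h
  proof -
    have "(- h / t\<^sup>2) *\<^sub>R (y - x) = (- h / t) *\<^sub>R w" by (simp add: w_def power2_eq_square)
    then show ?thesis using linear_cmul[OF lin, of "- h / t" w] by simp
  qed
  ultimately have 1: "((\<lambda>t. dilate x t rho y) has_real_derivative (- pd w rho w / t)) (at t)"
    by (simp only: has_field_derivative_def)
  have 2: "((\<lambda>t. dilate x t rho y / t ^ DIM('a)) has_real_derivative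
     ((- pd w rho w / t) * t ^ DIM('a) - dilate x t rho y * (real DIM('a) * t ^ (DIM('a) - 1))) / (t ^ DIM('a) * t ^ DIM('a))) (at t)"
    using t by (intro DERIV_divide[OF 1]) (auto intro!: derivative_eq_intros)
  have pw: "t ^ (DIM('a) - 1) = t ^ DIM('a) / t"
    using t by (simp add: power_diff Suc_leI)
  have r: "dilate x t rho y = rho w" "dilate x t lap_psi y = lap_psi w" by (simp_all add: dilate_def w_def)
  have "((- pd w rho w / t) * t ^ DIM('a) - dilate x t rho y * (real DIM('a) * t ^ (DIM('a) - 1))) / (t ^ DIM('a) * t ^ DIM('a))
    = dilate x t lap_psi y / t ^ (DIM('a) + 1)"
    unfolding r lap_psi_eq pw using t by (simp add: field_simps)
  with 2 show ?thesis by simp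
qed

section \<open>Averages against the dilated bump and their dependence on the scale\<close>

text \<open>Differentiation under the integral sign, by dominated convergence of the difference quotients: the
  mean value theorem bounds them by $B |v|$.\<close>

lemma has_real_derivative_integral:
  fixes k k' :: "real \<Rightarrow> 'a \<Rightarrow> real" and v :: "'a \<Rightarrow> real"
  assumes v: "integrable M v" and t0: "a < t0" "t0 < b"
    and deriv: "\<And>t y. a < t \<Longrightarrow> t < b \<Longrightarrow> ((\<lambda>t. k t y) has_real_derivative k' t y) (at t)"
    and bound: "\<And>t y. a < t \<Longrightarrow> t < b \<Longrightarrow> \<bar>k' t y\<bar> \<le> B"
    and [measurable]: "\<And>t. k t \<in> borel_measurable M" "k' t0 \<in> borel_measurable M"
    and int: "\<And>t. a < t \<Longrightarrow> t < b \<Longrightarrow> integrable M (\<lambda>y. v y * k t y)"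
  shows "((\<lambda>t. LINT y|M. v y * k t y) has_real_derivative (LINT y|M. v y * k' t0 y)) (at t0)"
  unfolding has_field_derivative_iff tendsto_at_iff_sequentially
proof (intro allI impI)
  fix X :: "nat \<Rightarrow> real"
  assume X: "\<forall>i. X i \<in> UNIV - {t0}" and lim: "X \<longlonglongrightarrow> t0"
  have [measurable]: "v \<in> borel_measurable M" using v by simp
  define q where "q n y = (if a < X n \<and> X n < b then v y * ((k (X n) y - k t0 y) / (X n - t0)) else 0)" for n y
  have ev: "\<forall>\<^sub>F n in sequentially. a < X n \<and> X n < b"
    using lim t0 by (intro eventually_conj order_tendstoD)
  have "(\<lambda>n. LINT y|M. q n y) \<longlonglongrightarrow> (LINT y|M. v y * k' t0 y)"
  proof (rule integral_dominated_convergence[where w = "\<lambda>y. \<bar>v y\<bar> * B"])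
    show "q n \<in> borel_measurable M" for n unfolding q_def by measurable
    show "integrable M (\<lambda>y. \<bar>v y\<bar> * B)" using v by simp
    show "AE y in M. (\<lambda>n. q n y) \<longlonglongrightarrow> v y * k' t0 y"
    proof (rule AE_I2)
      fix y
      have "((\<lambda>x. (k x y - k t0 y) / (x - t0)) \<longlongrightarrow> k' t0 y) (at t0)"
        using deriv[OF t0] by (simp add: has_field_derivative_iff)
      then have "(\<lambda>n. (k (X n) y - k t0 y) / (X n - t0)) \<longlonglongrightarrow> k' t0 y"
        using X lim by (auto simp: tendsto_at_iff_sequentially o_def)
      then have "(\<lambda>n. v y * ((k (X n) y - k t0 y) / (X n - t0))) \<longlonglongrightarrow> v y * k' t0 y"
        by (intro tendsto_intros)
      moreover have "\<forall>\<^sub>F n in sequentially. v y * ((k (X n) y - k t0 y) / (X n - t0)) = q n y"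
        using ev by eventually_elim (auto simp: q_def)
      ultimately show "(\<lambda>n. q n y) \<longlonglongrightarrow> v y * k' t0 y"
        by (rule Lim_transform_eventually)
    qed
    show "AE y in M. norm (q n y) \<le> \<bar>v y\<bar> * B" for n
    proof (rule AE_I2)
      fix y
      show "norm (q n y) \<le> \<bar>v y\<bar> * B"
      proof (cases "a < X n \<and> X n < b")
        case True
        have "norm (k (X n) y - k t0 y) \<le> B * norm (X n - t0)"
        proof (rule field_differentiable_bound[of "{a<..<b}" "\<lambda>t. k t y" "\<lambda>t. k' t y"])
          fix t assume "t \<in> {a<..<b}"
          then show "((\<lambda>t. k t y) has_field_derivative k' t y) (at t within {a<..<b})"
            using deriv[of t y] by (auto intro: has_field_derivative_at_within)
          show "norm (k' t y) \<le> B" using \<open>t \<in> {a<..<b}\<close> bound by simp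
        qed (use True t0 in auto)
        moreover have "norm (X n - t0) > 0" using X by simp
        ultimately have "\<bar>(k (X n) y - k t0 y) / (X n - t0)\<bar> \<le> B"
          by (simp add: abs_divide pos_divide_le_eq)
        then have "\<bar>v y\<bar> * \<bar>(k (X n) y - k t0 y) / (X n - t0)\<bar> \<le> \<bar>v y\<bar> * B"
          by (intro mult_left_mono) auto
        then show ?thesis using True by (simp add: q_def abs_mult)
      next
        case False
        have "0 \<le> B" using bound[OF t0, of y] by linarith
        then show ?thesis using False by (auto simp: q_def)
      qed
    qed
  qed (auto)
  moreover have "\<forall>\<^sub>F n in sequentially. (LINT y|M. q n y) =
      ((\<lambda>x. ((LINT y|M. v y * k x y) - (LINT y|M. v y * k t0 y)) / (x - t0)) \<circ> X) n"
    using ev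
  proof eventually_elim
    case (elim n)
    have "(LINT y|M. q n y) = (LINT y|M. (v y * k (X n) y - v y * k t0 y) / (X n - t0))"
      using elim by (intro Bochner_Integration.integral_cong) (auto simp: q_def right_diff_distrib)
    also have "\<dots> = ((LINT y|M. v y * k (X n) y) - (LINT y|M. v y * k t0 y)) / (X n - t0)"
      using int[of "X n"] int[of t0] elim t0 by (simp add: Bochner_Integration.integral_diff)
    finally show ?case by (simp add: o_def)
  qed
  ultimately show "((\<lambda>x. ((LINT y|M. v y * k x y) - (LINT y|M. v y * k t0 y)) / (x - t0)) \<circ> X)
      \<longlonglongrightarrow> (LINT y|M. v y * k' t0 y)"
    by (rule Lim_transform_eventually)
qed

lemma emeasure_ball_finite: "emeasure lborel (ball (x::'a::euclidean_space) r) < top"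
  using emeasure_lborel_ball_finite[of x r] by simp

lemma rho_measurable [measurable]: "rho \<in> borel_measurable borel"
  by (rule bumps_measurable[OF rho_bump])

lemma lap_psi_measurable [measurable]: "lap_psi \<in> borel_measurable borel"
  by (rule bumps_measurable[OF lap_psi_bump])

lemma dilate_measurable' [measurable (raw)]:
  assumes [measurable]: "f \<in> borel_measurable borel" "g \<in> borel_measurable M"
  shows "(\<lambda>z. dilate x t f (g z)) \<in> borel_measurable M"
  unfolding dilate_def by measurable

lemma integrable_mult_dilate:
  assumes v: "integrable lborel v" and f: "f \<in> bumps"
  shows "integrable lborel (\<lambda>y. v y * dilate x t f y)"
proof -
  obtain M where M: "M \<ge> 0" "\<And>z. \<bar>f z\<bar> \<le> M" using bumps_bounded[OF f] by blast
  have [measurable]: "f \<in> borel_measurable borel" "v \<in> borel_measurable borel"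
    using bumps_measurable[OF f] v by auto
  show ?thesis
  proof (rule Bochner_Integration.integrable_bound)
    show "integrable lborel (\<lambda>y. M * v y)" using v by simp
    show "AE y in lborel. norm (v y * dilate x t f y) \<le> norm (M * v y)"
    proof (rule AE_I2)
      fix y
      have "\<bar>v y\<bar> * \<bar>dilate x t f y\<bar> \<le> \<bar>v y\<bar> * M" using M by (intro mult_left_mono) (auto simp: dilate_def)
      then show "norm (v y * dilate x t f y) \<le> norm (M * v y)" using M(1) by (simp add: abs_mult mult.commute)
    qed
  qed measurable
qed

lemma integrable_dilate:
  fixes f :: "'a::euclidean_space \<Rightarrow> real"
  assumes f: "f \<in> bumps" and t: "t > 0"
  shows "integrable lborel (dilate x t f)"
proof -
  have "integrable lborel (\<lambda>y. indicator (ball x t) y * dilate x t f y)"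
    by (intro integrable_mult_dilate f integrable_real_indicator) (auto simp: emeasure_ball_finite)
  moreover have "(\<lambda>y. indicator (ball x t) y * dilate x t f y) = dilate x t f"
    using dilate_outside[OF f t] by (auto simp: indicator_def fun_eq_iff)
  ultimately show ?thesis by simp
qed

text \<open>The average is not normalised: as $t \to 0$ it tends to \<open>rho_mass\<close> times \<open>v x\<close>. This avoids dividing
  every kernel by the mass.\<close>

definition mollified :: "('a::euclidean_space \<Rightarrow> real) \<Rightarrow> 'a \<Rightarrow> real \<Rightarrow> real" where
  "mollified v x t = (LINT y|lborel. v y * (dilate x t rho y / t ^ DIM('a)))"

lemma mollified_scale_derivative:
  fixes v :: "'a::euclidean_space \<Rightarrow> real"
  assumes v: "integrable lborel v" and t: "t > 0"
  shows "((\<lambda>t. mollified v x t) has_real_derivative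
           (LINT y|lborel. v y * dilate x t lap_psi y) / t ^ (DIM('a) + 1)) (at t)"
proof -
  obtain M where M: "M \<ge> 0" "\<And>z::'a. \<bar>lap_psi z\<bar> \<le> M" using bumps_bounded[OF lap_psi_bump] by blast
  have "((\<lambda>t. LINT y|lborel. v y * (dilate x t rho y / t ^ DIM('a))) has_real_derivative
     (LINT y|lborel. v y * (dilate x t lap_psi y / t ^ (DIM('a) + 1)))) (at t)"
  proof (rule has_real_derivative_integral[where a = "t / 2" and b = "t + 1" and B = "M / (t / 2) ^ (DIM('a) + 1)"])
    fix s y assume s: "t / 2 < s"
    show "((\<lambda>t. dilate x t rho y / t ^ DIM('a)) has_real_derivative dilate x s lap_psi y / s ^ (DIM('a) + 1)) (at s)"
      by (rule dilated_rho_scale_derivative) (use s t in auto)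
    have "\<bar>dilate x s lap_psi y\<bar> / s ^ (DIM('a) + 1) \<le> M / (t / 2) ^ (DIM('a) + 1)"
      using s t M by (intro frac_le power_mono) (auto simp: dilate_def)
    then show "\<bar>dilate x s lap_psi y / s ^ (DIM('a) + 1)\<bar> \<le> M / (t / 2) ^ (DIM('a) + 1)"
      using s t by (simp add: abs_divide power_abs)
  next
    fix s
    have "integrable lborel (\<lambda>y. v y * dilate x s rho y / s ^ DIM('a))"
      by (intro integrable_divide integrable_mult_dilate v rho_bump)
    then show "integrable lborel (\<lambda>y. v y * (dilate x s rho y / s ^ DIM('a)))" by simp
  qed (use v t in auto)
  then show ?thesis unfolding mollified_def by simp
qed

definition rho_mass :: "'a::euclidean_space itself \<Rightarrow> real" where
  "rho_mass _ = (LINT z|(lborel::'a measure). rho z)"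

lemma rho_nonneg: "rho z \<ge> 0"
  by (simp add: rho_def flat_exp_nonneg)

lemma dilate_id: "dilate 0 1 f = f" by (simp add: dilate_def)

lemma rho_mass_pos: "rho_mass TYPE('a::euclidean_space) > 0"
proof -
  have i: "integrable lborel (rho :: 'a \<Rightarrow> real)"
    using integrable_dilate[OF rho_bump, of 1 0] by (simp add: dilate_id)
  have "\<not> (AE z in lborel. rho (z::'a) = 0)"
  proof
    assume "AE z in lborel. rho (z::'a) = 0"
    then have "AE z in lborel. (z::'a) \<notin> ball 0 1"
    proof eventually_elim
      case (elim z)
      show ?case
      proof
        assume "z \<in> ball 0 1"
        then have "z \<bullet> z < 1" by (simp add: norm_eq_sqrt_inner)
        with elim show False by (simp add: rho_def flat_exp_def)
      qed
    qed
    then have "ball (0::'a) 1 \<in> null_sets lborel" by (subst AE_iff_null_sets) auto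
    then have "emeasure lborel (ball (0::'a) 1) = 0" by auto
    moreover have "emeasure lborel (ball (0::'a) 1) > 0"
      by (simp add: emeasure_ball unit_ball_vol_pos)
    ultimately show False by simp
  qed
  then show ?thesis
    using integral_nonneg_eq_0_iff_AE[OF i] rho_nonneg Bochner_Integration.integral_nonneg[of lborel rho] 
    unfolding rho_mass_def by (metis (mono_tags, lifting) AE_I2 less_eq_real_def)
qed

lemma nn_integral_lborel_affine:
  fixes f :: "'a::euclidean_space \<Rightarrow> ennreal"
  assumes [measurable]: "f \<in> borel_measurable borel" and "c \<noteq> 0"
  shows "(\<integral>\<^sup>+y. f y \<partial>lborel) = ennreal (\<bar>c\<bar> ^ DIM('a)) * (\<integral>\<^sup>+y. f (x + c *\<^sub>R y) \<partial>lborel)"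
  by (subst lborel_affine[OF assms(2), of x])
     (simp add: nn_integral_density nn_integral_distr nn_integral_cmult)

lemma dilated_rho_mass:
  fixes x :: "'a::euclidean_space"
  assumes t: "t > 0"
  shows "(\<integral>\<^sup>+y. ennreal (dilate x t rho y / t ^ DIM('a)) \<partial>lborel) = ennreal (rho_mass TYPE('a))"
    and "(LINT y|lborel. dilate x t rho y / t ^ DIM('a)) = rho_mass TYPE('a)"
proof -
  have i: "integrable lborel (rho :: 'a \<Rightarrow> real)"
    using integrable_dilate[OF rho_bump, of 1 0] by (simp add: dilate_id)
  have "(\<integral>\<^sup>+y. ennreal (dilate x t rho y / t ^ DIM('a)) \<partial>lborel) =
      ennreal (t ^ DIM('a)) * (\<integral>\<^sup>+y. ennreal (rho y / t ^ DIM('a)) \<partial>(lborel::'a measure))"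
    using t by (subst nn_integral_lborel_affine[where c = t and x = x]) (auto simp: dilate_def)
  also have "\<dots> = (\<integral>\<^sup>+y. ennreal (rho y) \<partial>(lborel::'a measure))"
    using t by (subst nn_integral_cmult[symmetric]) (auto simp: ennreal_mult'[symmetric])
  also have "\<dots> = ennreal (rho_mass TYPE('a))"
    unfolding rho_mass_def by (rule nn_integral_eq_integral[OF i]) (simp add: rho_nonneg)
  finally show *: "(\<integral>\<^sup>+y. ennreal (dilate x t rho y / t ^ DIM('a)) \<partial>lborel) = ennreal (rho_mass TYPE('a))" .
  show "(LINT y|lborel. dilate x t rho y / t ^ DIM('a)) = rho_mass TYPE('a)"
    by (subst integral_eq_nn_integral)
       (use * t rho_mass_pos[where 'a='a] in \<open>auto simp: dilate_def rho_nonneg\<close>)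
qed

lemma mollified_diff:
  fixes v w :: "'a::euclidean_space \<Rightarrow> real"
  assumes "integrable lborel v" "integrable lborel w"
  shows "mollified (\<lambda>y. v y - w y) x t = mollified v x t - mollified w x t"
proof -
  have "integrable lborel (\<lambda>y. v y * (dilate x t rho y / t ^ DIM('a)))"
    "integrable lborel (\<lambda>y. w y * (dilate x t rho y / t ^ DIM('a)))"
    using integrable_mult_dilate[OF assms(1) rho_bump, of x t] integrable_mult_dilate[OF assms(2) rho_bump, of x t] by auto
  then show ?thesis unfolding mollified_def left_diff_distrib by (rule Bochner_Integration.integral_diff)
qed

lemma mollified_measurable:
  assumes [measurable]: "v \<in> borel_measurable borel"
  shows "(\<lambda>x. mollified v x t) \<in> borel_measurable borel"
proof -
  have "(\<lambda>x. mollified v x t) \<in> borel_measurable lborel"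
    unfolding mollified_def dilate_def by (rule lborel.borel_measurable_lebesgue_integral) measurable
  then show ?thesis by simp
qed

text \<open>Exchange the two integrations; the kernel is even, so its integral over either variable is the mass
  of \<open>rho\<close>.\<close>

lemma mollified_L1_bound:
  fixes w :: "'a::euclidean_space \<Rightarrow> real"
  assumes w: "integrable lborel w" and t: "t > 0"
  shows "(\<integral>\<^sup>+x. ennreal \<bar>mollified w x t\<bar> \<partial>lborel) \<le> ennreal (rho_mass TYPE('a)) * (\<integral>\<^sup>+y. ennreal \<bar>w y\<bar> \<partial>lborel)"
proof -
  have [measurable]: "w \<in> borel_measurable borel" using w by auto
  have sym: "dilate x t rho y = dilate y t rho x" for x y :: 'a
    by (simp add: dilate_def rho_def inner_diff inner_commute algebra_simps)
  have "(\<integral>\<^sup>+x. ennreal \<bar>mollified w x t\<bar> \<partial>lborel) \<le>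
     (\<integral>\<^sup>+x. (\<integral>\<^sup>+y. ennreal \<bar>w y\<bar> * ennreal (dilate x t rho y / t ^ DIM('a)) \<partial>lborel) \<partial>lborel)"
  proof (rule nn_integral_mono)
    fix x
    have "integrable lborel (\<lambda>y. w y * (dilate x t rho y / t ^ DIM('a)))"
      using integrable_mult_dilate[OF w rho_bump, of x t] by auto
    from integral_norm_bound_ennreal[OF this]
    show "ennreal \<bar>mollified w x t\<bar> \<le> (\<integral>\<^sup>+y. ennreal \<bar>w y\<bar> * ennreal (dilate x t rho y / t ^ DIM('a)) \<partial>lborel)"
      using t by (simp add: mollified_def abs_mult ennreal_mult'[symmetric] dilate_def rho_nonneg)
  qed
  also have "\<dots> = (\<integral>\<^sup>+y. (\<integral>\<^sup>+x. ennreal \<bar>w y\<bar> * ennreal (dilate x t rho y / t ^ DIM('a)) \<partial>lborel) \<partial>lborel)"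
    by (rule lborel_pair.Fubini') (unfold dilate_def, measurable)
  also have "\<dots> = (\<integral>\<^sup>+y. ennreal \<bar>w y\<bar> * ennreal (rho_mass TYPE('a)) \<partial>lborel)"
  proof (rule nn_integral_cong)
    fix y :: 'a
    show "(\<integral>\<^sup>+x. ennreal \<bar>w y\<bar> * ennreal (dilate x t rho y / t ^ DIM('a)) \<partial>lborel) = ennreal \<bar>w y\<bar> * ennreal (rho_mass TYPE('a))"
      unfolding sym[of _ y] by (subst nn_integral_cmult) (auto simp: dilated_rho_mass[OF t])
  qed
  also have "\<dots> = ennreal (rho_mass TYPE('a)) * (\<integral>\<^sup>+y. ennreal \<bar>w y\<bar> \<partial>lborel)"
    by (subst nn_integral_cmult[symmetric]) (auto simp: mult.commute)
  finally show ?thesis .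
qed

lemma negligible_AE_lborel: "negligible N \<Longrightarrow> AE x in lborel. x \<notin> N"
  using AE_not_in[of N lebesgue] by (simp add: negligible_iff_null_sets AE_completion_iff)

text \<open>Truncate the values of $v$ first. A bounded measurable function is an almost everywhere limit of
  continuous functions; clipping these and multiplying them by a cutoff makes the convergence
  dominated.\<close>

lemma continuous_L1_approximation:
  fixes v :: "'a::euclidean_space \<Rightarrow> real"
  assumes v: "integrable lborel v" and out: "\<And>x. x \<notin> ball 0 N \<Longrightarrow> v x = 0" and e: "e > 0"
  obtains g where "continuous_on UNIV g" "\<And>x. x \<notin> ball 0 (N + 1) \<Longrightarrow> g x = 0"
    "integrable lborel g" "(LINT x|lborel. \<bar>v x - g x\<bar>) < e"
proof -
  have [measurable]: "v \<in> borel_measurable borel" using v by auto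
  define tr where "tr k y = max (- real k) (min (real k) (y::real))" for k y
  have tr_le: "\<bar>tr k y\<bar> \<le> real k" "\<bar>y - tr k y\<bar> \<le> \<bar>y\<bar>" "\<bar>tr k y\<bar> \<le> \<bar>y\<bar>" for k y
    unfolding tr_def by (auto simp: max_def min_def)
  have [measurable]: "tr k \<in> borel_measurable borel" for k unfolding tr_def by measurable
  have "(\<lambda>k. LINT x|lborel. \<bar>v x - tr k (v x)\<bar>) \<longlonglongrightarrow> (LINT x|(lborel::'a measure). 0)"
  proof (rule integral_dominated_convergence[where w = "\<lambda>x. \<bar>v x\<bar>"])
    show "AE x in lborel. (\<lambda>k. \<bar>v x - tr k (v x)\<bar>) \<longlonglongrightarrow> 0"
    proof (rule AE_I2)
      fix x
      obtain K where K: "\<bar>v x\<bar> \<le> real K" using real_arch_simple by blast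
      have "\<forall>\<^sub>F k in sequentially. 0 = \<bar>v x - tr k (v x)\<bar>"
        using eventually_ge_at_top[of K]
      proof eventually_elim
        case (elim k)
        then have "\<bar>v x\<bar> \<le> real k" using K by linarith
        then show ?case by (auto simp: tr_def)
      qed
      then show "(\<lambda>k. \<bar>v x - tr k (v x)\<bar>) \<longlonglongrightarrow> 0"
        by (rule Lim_transform_eventually[OF tendsto_const])
    qed
  qed (use v tr_le in auto)
  then have "\<forall>\<^sub>F k in sequentially. (LINT x|lborel. \<bar>v x - tr k (v x)\<bar>) < e / 2"
    using e by (intro order_tendstoD) auto
  then obtain k where k: "(LINT x|lborel. \<bar>v x - tr k (v x)\<bar>) < e / 2"
    unfolding eventually_sequentially by blast
  define w where "w x = tr k (v x)" for x
  have [measurable]: "w \<in> borel_measurable borel" unfolding w_def by measurable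
  have w: "integrable lborel w"
    by (rule Bochner_Integration.integrable_bound[OF v]) (use tr_le in \<open>auto simp: w_def\<close>)
  have "w measurable_on UNIV"
    by (rule lebesgue_measurable_imp_measurable_on) (auto intro: measurable_completion)
  then obtain S h where S: "negligible S" and h: "\<And>n. continuous_on UNIV (h n)"
    and lim: "\<And>x. x \<notin> S \<Longrightarrow> (\<lambda>n. h n x) \<longlonglongrightarrow> w x"
    unfolding measurable_on_def by auto
  define g where "g n x = max 0 (min 1 (N + 1 - norm x)) * tr k (h n x)" for n x
  have trc: "continuous_on UNIV (\<lambda>x. tr k (h n x))" for n
    unfolding tr_def by (intro continuous_intros h)
  have gc: "continuous_on UNIV (g n)" for n
    unfolding g_def by (intro continuous_intros trc)
  have [measurable]: "g n \<in> borel_measurable borel" for n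
    by (rule borel_measurable_continuous_onI[OF gc])
  have gb: "\<bar>g n x\<bar> \<le> real k * indicator (ball 0 (N + 1)) x" for n x
  proof (cases "x \<in> ball 0 (N + 1)")
    case True
    have "\<bar>max 0 (min 1 (N + 1 - norm x))\<bar> * \<bar>tr k (h n x)\<bar> \<le> 1 * real k"
      by (intro mult_mono tr_le) auto
    then show ?thesis using True by (simp add: g_def abs_mult)
  qed (auto simp: g_def)
  have gout: "x \<notin> ball 0 (N + 1) \<Longrightarrow> g n x = 0" for n x by (simp add: g_def)
  have ball_int: "integrable lborel (\<lambda>x. real k * indicator (ball (0::'a) (N + 1)) x)"
    by (intro integrable_mult_right integrable_real_indicator) (auto simp: emeasure_ball_finite)
  have gi: "integrable lborel (g n)" for n
    by (rule Bochner_Integration.integrable_bound[OF ball_int]) (use gb in auto)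
  have "(\<lambda>n. LINT x|lborel. \<bar>w x - g n x\<bar>) \<longlonglongrightarrow> (LINT x|(lborel::'a measure). 0)"
  proof (rule integral_dominated_convergence[where w = "\<lambda>x. \<bar>w x\<bar> + real k * indicator (ball 0 (N + 1)) x"])
    show "integrable lborel (\<lambda>x. \<bar>w x\<bar> + real k * indicator (ball 0 (N + 1)) x)"
      using w ball_int by auto
    show "AE x in lborel. norm \<bar>w x - g n x\<bar> \<le> \<bar>w x\<bar> + real k * indicator (ball 0 (N + 1)) x" for n
    proof (rule AE_I2)
      fix x
      have "\<bar>w x - g n x\<bar> \<le> \<bar>w x\<bar> + \<bar>g n x\<bar>" by simp
      with gb[of n x] show "norm \<bar>w x - g n x\<bar> \<le> \<bar>w x\<bar> + real k * indicator (ball 0 (N + 1)) x" by simp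
    qed
    show "AE x in lborel. (\<lambda>n. \<bar>w x - g n x\<bar>) \<longlonglongrightarrow> 0"
      using negligible_AE_lborel[OF S]
    proof eventually_elim
      case (elim x)
      have "isCont (tr k) (w x)"
        unfolding tr_def by (intro continuous_intros)
      from isCont_tendsto_compose[OF this lim[OF elim]]
      have "(\<lambda>n. g n x) \<longlonglongrightarrow> max 0 (min 1 (N + 1 - norm x)) * tr k (w x)"
        unfolding g_def by (intro tendsto_intros)
      moreover have "tr k (w x) = w x" by (auto simp: w_def tr_def max_def min_def)
      moreover have "max 0 (min 1 (N + 1 - norm x)) * w x = w x"
        using out[of x] by (cases "x \<in> ball 0 N") (auto simp: w_def tr_def)
      ultimately have "(\<lambda>n. g n x) \<longlonglongrightarrow> w x" by simp
      then have "(\<lambda>n. \<bar>w x - g n x\<bar>) \<longlonglongrightarrow> \<bar>w x - w x\<bar>" by (intro tendsto_intros)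
      then show ?case by simp
    qed
  qed auto
  then have "\<forall>\<^sub>F n in sequentially. (LINT x|lborel. \<bar>w x - g n x\<bar>) < e / 2"
    using e by (intro order_tendstoD) auto
  then obtain n where n: "(LINT x|lborel. \<bar>w x - g n x\<bar>) < e / 2"
    unfolding eventually_sequentially by blast
  have "(LINT x|lborel. \<bar>v x - g n x\<bar>) \<le> (LINT x|lborel. \<bar>v x - w x\<bar> + \<bar>w x - g n x\<bar>)"
    by (rule integral_mono) (use v w gi in auto)
  also have "\<dots> = (LINT x|lborel. \<bar>v x - w x\<bar>) + (LINT x|lborel. \<bar>w x - g n x\<bar>)"
    by (rule Bochner_Integration.integral_add) (use v w gi in auto)
  also have "\<dots> < e" using k n by (simp add: w_def)
  finally show ?thesis using that gc gi gout by blast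
qed

text \<open>Uniform continuity on a ball makes $g(y) - g(x)$ uniformly small where the kernel lives. The support
  grows by at most the scale, hence the indicator of the larger ball.\<close>

lemma mollified_continuous_approximation:
  fixes g :: "'a::euclidean_space \<Rightarrow> real"
  assumes g: "continuous_on UNIV g" and out: "\<And>x. x \<notin> ball 0 N \<Longrightarrow> g x = 0"
    and gi: "integrable lborel g" and e: "e > 0"
  obtains t0 where "t0 > 0" "t0 \<le> 1"
    "\<And>t x. 0 < t \<Longrightarrow> t < t0 \<Longrightarrow> \<bar>mollified g x t - rho_mass TYPE('a) * g x\<bar> \<le> e * rho_mass TYPE('a) * indicator (ball 0 (N + 1)) x"
proof -
  have "uniformly_continuous_on (cball 0 (N + 2)) g"
    by (intro compact_uniformly_continuous continuous_on_subset[OF g]) auto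
  then obtain d where d: "d > 0" "\<And>x y. x \<in> cball 0 (N + 2) \<Longrightarrow> y \<in> cball 0 (N + 2) \<Longrightarrow> dist y x < d \<Longrightarrow> dist (g y) (g x) < e"
    using e unfolding uniformly_continuous_on_def by metis
  have "\<bar>mollified g x t - rho_mass TYPE('a) * g x\<bar> \<le> e * rho_mass TYPE('a) * indicator (ball 0 (N + 1)) x"
    if t: "0 < t" "t < min d 1" for t x
  proof -
    have 1: "integrable lborel (\<lambda>y. g y * (dilate x t rho y / t ^ DIM('a)))"
      using integrable_mult_dilate[OF gi rho_bump, of x t] by auto
    have 2: "integrable lborel (\<lambda>y. dilate x t rho y / t ^ DIM('a))"
      using integrable_dilate[OF rho_bump t(1)] by auto
    have b: "\<bar>(g y - g x) * (dilate x t rho y / t ^ DIM('a))\<bar>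
        \<le> (e * indicator (ball 0 (N + 1)) x) * (dilate x t rho y / t ^ DIM('a))" for y
    proof (cases "y \<in> ball x t")
      case y: True
      have "\<bar>g y - g x\<bar> \<le> e * indicator (ball 0 (N + 1)) x"
      proof (cases "x \<in> ball 0 (N + 1)")
        case True
        have "norm y \<le> norm x + dist x y" by norm
        then have "y \<in> cball 0 (N + 2)" using True y t by (auto simp: dist_norm)
        then have "dist (g y) (g x) < e" using True y t by (intro d) (auto simp: dist_commute)
        then show ?thesis using True by (simp add: dist_real_def)
      next
        case False
        have "norm x \<le> norm y + dist x y" by norm
        then have "y \<notin> ball 0 N" using False y t by auto
        then show ?thesis using False out[of x] out[of y] by auto
      qed
      then show ?thesis using t
        by (simp add: abs_mult dilate_def rho_nonneg divide_right_mono mult_right_mono)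
    next
      case False
      then have "dilate x t rho y = 0" by (rule dilate_outside[OF rho_bump t(1)])
      then show ?thesis by simp
    qed
    have "mollified g x t - rho_mass TYPE('a) * g x
        = (LINT y|lborel. g y * (dilate x t rho y / t ^ DIM('a))) - (LINT y|lborel. g x * (dilate x t rho y / t ^ DIM('a)))"
      unfolding mollified_def using dilated_rho_mass(2)[OF t(1), of x]
      by (simp only: integral_mult_right_zero mult.commute)
    also have "\<dots> = (LINT y|lborel. (g y - g x) * (dilate x t rho y / t ^ DIM('a)))"
      unfolding left_diff_distrib by (rule Bochner_Integration.integral_diff[OF 1 integrable_mult_right[OF 2], symmetric])
    also have "\<bar>\<dots>\<bar> \<le> (LINT y|lborel. \<bar>(g y - g x) * (dilate x t rho y / t ^ DIM('a))\<bar>)"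
      by (rule integral_abs_bound)
    also have "\<dots> \<le> (LINT y|lborel. (e * indicator (ball 0 (N + 1)) x) * (dilate x t rho y / t ^ DIM('a)))"
    proof (rule integral_mono)
      show "integrable lborel (\<lambda>y. \<bar>(g y - g x) * (dilate x t rho y / t ^ DIM('a))\<bar>)"
        unfolding left_diff_distrib by (intro integrable_abs Bochner_Integration.integrable_diff 1 integrable_mult_right 2)
      show "integrable lborel (\<lambda>y. (e * indicator (ball 0 (N + 1)) x) * (dilate x t rho y / t ^ DIM('a)))"
        by (rule integrable_mult_right[OF 2])
    qed (rule b)
    also have "\<dots> = e * rho_mass TYPE('a) * indicator (ball 0 (N + 1)) x"
      unfolding integral_mult_right_zero dilated_rho_mass(2)[OF t(1), of x] by simp
    finally show ?thesis .
  qed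
  then show ?thesis using d by (intro that[of "min d 1"]) auto
qed

text \<open>Approximate by a continuous function $g$; averaging is bounded on $L^1$, so the error $v - g$ costs
  at most its norm times twice the mass, uniformly in the scale.\<close>

lemma mollified_L1_convergence:
  fixes v :: "'a::euclidean_space \<Rightarrow> real"
  assumes v: "integrable lborel v" and out: "\<And>x. x \<notin> ball 0 N \<Longrightarrow> v x = 0" and e: "e > 0"
  shows "\<exists>t0>0. \<forall>t. 0 < t \<and> t < t0 \<longrightarrow>
     (\<integral>\<^sup>+x. ennreal \<bar>mollified v x t - rho_mass TYPE('a) * v x\<bar> \<partial>lborel) \<le> ennreal e"
proof -
  define c where "c = rho_mass TYPE('a)"
  have c: "c > 0" unfolding c_def by (rule rho_mass_pos)
  obtain g where g: "continuous_on UNIV g" "\<And>x. x \<notin> ball 0 (N + 1) \<Longrightarrow> g x = 0"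
    "integrable lborel g" "(LINT x|lborel. \<bar>v x - g x\<bar>) < e / (4 * c)"
    by (rule continuous_L1_approximation[where v = v and N = N and e = "e / (4 * c)"]) (use v out c e in auto)
  define b where "b = measure lborel (ball (0::'a) (N + 2))"
  define e' where "e' = e / (2 * c * (b + 1))"
  have b: "b \<ge> 0" unfolding b_def by simp
  have e': "e' > 0" unfolding e'_def using e c b by (intro divide_pos_pos mult_pos_pos) auto
  have g2: "\<And>x. x \<notin> ball 0 (N + 1) \<Longrightarrow> g x = 0" by (rule g(2))
  obtain t0 where t0: "t0 > 0"
    "\<And>t x. 0 < t \<Longrightarrow> t < t0 \<Longrightarrow> \<bar>mollified g x t - c * g x\<bar> \<le> e' * c * indicator (ball 0 (N + 2)) x"
  proof (rule mollified_continuous_approximation[OF g(1) g2 g(3) e'])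
    fix t0 assume t0: "t0 > 0" "\<And>t x. 0 < t \<Longrightarrow> t < t0 \<Longrightarrow> \<bar>mollified g x t - rho_mass TYPE('a) * g x\<bar> \<le> e' * rho_mass TYPE('a) * indicator (ball 0 (N + 1 + 1)) x"
    show thesis by (rule that[of t0]) (use t0 in \<open>auto simp: c_def add.assoc\<close>)
  qed
  have [measurable]: "v \<in> borel_measurable borel" "g \<in> borel_measurable borel" using v g(3) by auto
  have vg: "(\<integral>\<^sup>+x. ennreal \<bar>v x - g x\<bar> \<partial>lborel) \<le> ennreal (e / (4 * c))"
    using v g(3,4) by (subst nn_integral_eq_integral) (auto intro!: ennreal_leI)
  have "(\<integral>\<^sup>+x. ennreal \<bar>mollified v x t - c * v x\<bar> \<partial>lborel) \<le> ennreal e" if t: "0 < t" "t < t0" for t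
  proof -
    define w where "w x = v x - g x" for x
    have wi: "integrable lborel w" unfolding w_def using v g by auto
    have [measurable]: "w \<in> borel_measurable borel" unfolding w_def by measurable
    have [measurable]: "ball (0::'a) (N + 2) \<in> sets borel" by auto
    have [measurable]: "(\<lambda>x. mollified w x t) \<in> borel_measurable borel" by (rule mollified_measurable) measurable
    have "(\<integral>\<^sup>+x. ennreal \<bar>mollified v x t - c * v x\<bar> \<partial>lborel) \<le>
      (\<integral>\<^sup>+x. ennreal \<bar>mollified w x t\<bar> + (ennreal c * ennreal \<bar>w x\<bar> + ennreal (e' * c) * indicator (ball 0 (N + 2)) x) \<partial>lborel)"
    proof (rule nn_integral_mono)
      fix x
      have "mollified v x t - c * v x = mollified w x t - c * w x + (mollified g x t - c * g x)"
        unfolding w_def mollified_diff[OF v g(3)] by (simp add: algebra_simps)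
      then have "\<bar>mollified v x t - c * v x\<bar> \<le> \<bar>mollified w x t\<bar> + (c * \<bar>w x\<bar> + (e' * c) * indicator (ball 0 (N + 2)) x)"
        using t0(2)[OF t, of x] abs_mult[of c "w x"] c by linarith
      then have "ennreal \<bar>mollified v x t - c * v x\<bar> \<le> ennreal (\<bar>mollified w x t\<bar> + (c * \<bar>w x\<bar> + (e' * c) * indicator (ball 0 (N + 2)) x))"
        by (rule ennreal_leI)
      also have "\<dots> = ennreal \<bar>mollified w x t\<bar> + (ennreal c * ennreal \<bar>w x\<bar> + ennreal (e' * c) * indicator (ball 0 (N + 2)) x)"
        using c e' by (auto simp: ennreal_plus ennreal_mult' indicator_def)
      finally show "ennreal \<bar>mollified v x t - c * v x\<bar> \<le> \<dots>" .
    qed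
    also have "\<dots> = (\<integral>\<^sup>+x. ennreal \<bar>mollified w x t\<bar> \<partial>lborel) + (ennreal c * (\<integral>\<^sup>+x. ennreal \<bar>w x\<bar> \<partial>lborel) + ennreal (e' * c) * emeasure lborel (ball (0::'a) (N + 2)))"
      by (subst nn_integral_add, measurable)+ (simp add: nn_integral_cmult nn_integral_cmult_indicator)
    also have "\<dots> \<le> ennreal c * ennreal (e / (4 * c)) + (ennreal c * ennreal (e / (4 * c)) + ennreal (e' * c) * ennreal b)"
    proof (intro add_mono mult_left_mono)
      have "(\<integral>\<^sup>+x. ennreal \<bar>mollified w x t\<bar> \<partial>lborel) \<le> ennreal c * (\<integral>\<^sup>+x. ennreal \<bar>w x\<bar> \<partial>lborel)"
        unfolding c_def by (rule mollified_L1_bound[OF wi t(1)])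
      also have "\<dots> \<le> ennreal c * ennreal (e / (4 * c))"
        unfolding w_def by (intro mult_left_mono vg) auto
      finally show "(\<integral>\<^sup>+x. ennreal \<bar>mollified w x t\<bar> \<partial>lborel) \<le> ennreal c * ennreal (e / (4 * c))" .
      show "emeasure lborel (ball (0::'a) (N + 2)) \<le> ennreal b"
        unfolding b_def using emeasure_ball_finite[of "0::'a" "N + 2"]
        by (subst emeasure_eq_ennreal_measure) auto
    qed (auto simp: w_def vg)
    also have "\<dots> = ennreal (c * (e / (4 * c)) + (c * (e / (4 * c)) + (e' * c) * b))"
    proof -
      have "ennreal c * ennreal A + (ennreal c * ennreal A + ennreal (e' * c) * ennreal b)
          = ennreal (c * A + (c * A + (e' * c) * b))" if "A \<ge> 0" for A
        using c e' b that by (simp add: ennreal_mult[symmetric] ennreal_plus[symmetric] del: ennreal_plus)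
      then show ?thesis using c e by simp
    qed
    also have "\<dots> \<le> ennreal e"
    proof (rule ennreal_leI)
      have "(e' * c) * b \<le> (e' * c) * (b + 1)" using e' c by (intro mult_left_mono) auto
      also have "\<dots> = e / 2"
      proof -
        have "e / (2 * K) * K = e / 2" if "K \<noteq> 0" for K :: real using that by simp
        note this[of "c * (b + 1)"]
        moreover have "c * (b + 1) \<noteq> 0" using c b by auto
        ultimately show ?thesis unfolding e'_def by (simp only: mult.assoc) simp
      qed
      finally show "c * (e / (4 * c)) + (c * (e / (4 * c)) + (e' * c) * b) \<le> e" using c by simp
    qed
    finally show ?thesis .
  qed
  then show ?thesis using t0(1) unfolding c_def by blast
qed

text \<open>Convergence along one sequence of scales suffices below, because bounds on the scale derivative
  turn it into convergence with a rate.\<close>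

proposition mollified_AE_subsequence:
  fixes v :: "'a::euclidean_space \<Rightarrow> real"
  assumes v: "integrable lborel v" and out: "\<And>x. x \<notin> ball 0 N \<Longrightarrow> v x = 0"
  obtains s where "\<And>n::nat. s n > (0::real)" "s \<longlonglongrightarrow> 0"
    "AE x in lborel. (\<lambda>n. mollified v x (s n)) \<longlonglongrightarrow> rho_mass TYPE('a) * v x"
proof -
  define c where "c = rho_mass TYPE('a)"
  have [measurable]: "v \<in> borel_measurable borel" using v by auto
  have mm [measurable]: "(\<lambda>x. mollified v x t) \<in> borel_measurable borel" for t by (rule mollified_measurable) measurable
  define u where "u n x = mollified v x (1 / real (Suc n)) - c * v x" for n x
  have [measurable]: "u n \<in> borel_measurable borel" for n unfolding u_def by measurable
  have moll_int: "integrable lborel (\<lambda>x. mollified v x t)" if "t > 0" for t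
  proof (rule integrableI_bounded)
    have "(\<integral>\<^sup>+x. ennreal (norm (mollified v x t)) \<partial>lborel) \<le> ennreal c * (\<integral>\<^sup>+y. ennreal \<bar>v y\<bar> \<partial>lborel)"
      unfolding c_def using mollified_L1_bound[OF v that] by simp
    also have "\<dots> < \<infinity>" using v
      by (simp add: ennreal_mult_less_top integrable_iff_bounded)
    finally show "(\<integral>\<^sup>+x. ennreal (norm (mollified v x t)) \<partial>lborel) < \<infinity>" .
  qed measurable
  have ui: "integrable lborel (u n)" for n
    unfolding u_def using v moll_int by auto
  have "(\<lambda>n. LINT x|lborel. norm (u n x)) \<longlonglongrightarrow> 0"
  proof (rule LIMSEQ_I)
    fix r :: real assume r: "0 < r"
    obtain t0 where t0: "t0 > 0" "\<And>t. 0 < t \<Longrightarrow> t < t0 \<Longrightarrow>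
       (\<integral>\<^sup>+x. ennreal \<bar>mollified v x t - c * v x\<bar> \<partial>lborel) \<le> ennreal (r / 2)"
      using mollified_L1_convergence[where v = v and N = N and e = "r / 2", OF v out] half_gt_zero[OF r] unfolding c_def
      by blast
    obtain n0 where n0: "1 / real (Suc n0) < t0"
      using t0(1) nat_approx_posE by metis
    have "norm ((LINT x|lborel. norm (u n x)) - 0) < r" if "n \<ge> n0" for n
    proof -
      have "1 / real (Suc n) \<le> 1 / real (Suc n0)" using that by (intro frac_le) auto
      then have "(\<integral>\<^sup>+x. ennreal (norm (u n x)) \<partial>lborel) \<le> ennreal (r / 2)"
        using t0(2)[of "1 / real (Suc n)"] n0 by (simp add: u_def)
      then have "ennreal (LINT x|lborel. norm (u n x)) \<le> ennreal (r / 2)"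
        using ui by (subst (asm) nn_integral_eq_integral) auto
      then show ?thesis using r by (simp add: ennreal_le_iff)
    qed
    then show "\<exists>no. \<forall>n\<ge>no. norm ((LINT x|lborel. norm (u n x)) - 0) < r" by blast
  qed
  from tendsto_L1_AE_subseq[OF ui this] obtain r where r: "strict_mono r"
    and ae: "AE x in lborel. (\<lambda>n. u (r n) x) \<longlonglongrightarrow> 0" by blast
  show ?thesis
  proof (rule that[of "\<lambda>n. 1 / real (Suc (r n))"])
    have "(\<lambda>n. 1 / real (Suc n)) \<longlonglongrightarrow> 0" by (rule lim_1_over_n[THEN LIMSEQ_Suc])
    from LIMSEQ_subseq_LIMSEQ[OF this r] show "(\<lambda>n. 1 / real (Suc (r n))) \<longlonglongrightarrow> 0" by (simp add: o_def)
    show "AE x in lborel. (\<lambda>n. mollified v x (1 / real (Suc (r n)))) \<longlonglongrightarrow> rho_mass TYPE('a) * v x"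
      using ae
    proof eventually_elim
      case (elim x)
      then have "(\<lambda>n. u (r n) x + c * v x) \<longlonglongrightarrow> 0 + c * v x" by (intro tendsto_intros)
      then show ?case by (simp add: u_def c_def)
    qed
  qed auto
qed

section \<open>Pointwise Hoelder bounds from bounds on scale derivatives\<close>

text \<open>Integrate the scale derivative, which is at most $A t^{\gamma-1}$, from $0$ to \<open>\<delta>\<close>.\<close>

lemma mollified_convergence_rate:
  fixes v :: "'a::euclidean_space \<Rightarrow> real"
  assumes v: "integrable lborel v" and g: "0 < \<gamma>" and dR: "0 < \<delta>" "\<delta> \<le> R" and A: "A \<ge> 0"
    and s: "\<And>n::nat. s n > (0::real)" "s \<longlonglongrightarrow> 0"
    and conv: "(\<lambda>n. mollified v x (s n)) \<longlonglongrightarrow> l"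
    and h: "\<And>t. 0 < t \<Longrightarrow> t \<le> R \<Longrightarrow> \<bar>LINT y|lborel. v y * dilate x t lap_psi y\<bar> \<le> t powr (real DIM('a) + \<gamma>) * A"
  shows "\<bar>mollified v x \<delta> - l\<bar> \<le> A / \<gamma> * \<delta> powr \<gamma>"
proof -
  let ?V' = "\<lambda>t. (LINT y|lborel. v y * dilate x t lap_psi y) / t ^ (DIM('a) + 1)"
  have V: "((\<lambda>t. mollified v x t) has_real_derivative ?V' t) (at t)" if "t > 0" for t
    by (rule mollified_scale_derivative[OF v that])
  have bnd: "\<bar>mollified v x \<delta> - mollified v x t\<bar> \<le> A / \<gamma> * \<delta> powr \<gamma>" if t: "0 < t" "t < \<delta>" for t
  proof -
    have "norm (mollified v x \<delta> - mollified v x t) \<le> A / \<gamma> * \<delta> powr \<gamma> - A / \<gamma> * t powr \<gamma>"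
    proof (rule differentiable_bound_general[OF t(2), where f = "mollified v x" and f' = ?V'
        and \<phi> = "\<lambda>t. A / \<gamma> * t powr \<gamma>" and \<phi>' = "\<lambda>t. A * t powr (\<gamma> - 1)"])
      show "continuous_on {t..\<delta>} (mollified v x)"
        by (rule DERIV_continuous_on[of _ _ ?V'], rule has_field_derivative_at_within, rule V) (use t in auto)
      show "continuous_on {t..\<delta>} (\<lambda>t. A / \<gamma> * t powr \<gamma>)"
        using t by (intro continuous_intros) auto
      fix r assume r: "t < r" "r < \<delta>"
      show "(mollified v x has_vector_derivative ?V' r) (at r)"
        using V[of r] r t by (simp add: has_real_derivative_iff_has_vector_derivative)
      have "((\<lambda>t. A / \<gamma> * t powr \<gamma>) has_real_derivative A / \<gamma> * (\<gamma> * r powr (\<gamma> - 1))) (at r)"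
        using r t by (intro DERIV_cmult has_real_derivative_powr) auto
      then show "((\<lambda>t. A / \<gamma> * t powr \<gamma>) has_vector_derivative A * r powr (\<gamma> - 1)) (at r)"
        using g by (simp add: has_real_derivative_iff_has_vector_derivative)
      have r0: "r > 0" using r t by simp
      have "\<bar>LINT y|lborel. v y * dilate x r lap_psi y\<bar> \<le> r powr (real DIM('a) + \<gamma>) * A"
        using r t dR by (intro h) auto
      then have "norm (?V' r) \<le> (r powr (real DIM('a) + \<gamma>) * A) / r ^ (DIM('a) + 1)"
        using r0 by (simp add: abs_divide divide_right_mono del: power_Suc)
      also have "\<dots> = A * (r powr (real DIM('a) + \<gamma>) / r powr (real DIM('a) + 1))"
        using r0 by (simp add: powr_add powr_realpow)
      also have "\<dots> = A * r powr (\<gamma> - 1)"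
        by (simp add: powr_diff[symmetric])
      finally show "norm (?V' r) \<le> A * r powr (\<gamma> - 1)" .
    qed
    moreover have "A / \<gamma> * t powr \<gamma> \<ge> 0" using A g by simp
    ultimately show ?thesis by simp
  qed
  have lim: "(\<lambda>n. \<bar>mollified v x \<delta> - mollified v x (s n)\<bar>) \<longlonglongrightarrow> \<bar>mollified v x \<delta> - l\<bar>"
    by (intro tendsto_intros conv)
  have "\<forall>\<^sub>F n in sequentially. s n < \<delta>" using s(2) dR(1) by (rule order_tendstoD)
  then have "\<forall>\<^sub>F n in sequentially. \<bar>mollified v x \<delta> - mollified v x (s n)\<bar> \<le> A / \<gamma> * \<delta> powr \<gamma>"
    by eventually_elim (use bnd s in auto)
  then show ?thesis by (intro tendsto_upperbound[OF lim]) auto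
qed

text \<open>Integrate the scale derivative of the difference from \<open>\<delta>\<close> to $R$. Since $\gamma < 1$, the integral
  of $\delta t^{\gamma-2}$ is governed by its lower end and is of order $\delta^\gamma$.\<close>

lemma mollified_difference_bound:
  fixes v :: "'a::euclidean_space \<Rightarrow> real"
  assumes v: "integrable lborel v" and g: "0 < \<gamma>" "\<gamma> < 1" and A: "A \<ge> 0"
    and \<delta>: "\<delta> = norm (x - y)" "0 < \<delta>" "\<delta> \<le> R"
    and h: "\<And>t. \<delta> \<le> t \<Longrightarrow> t \<le> R \<Longrightarrow> \<bar>(LINT z|lborel. v z * dilate x t lap_psi z) - (LINT z|lborel. v z * dilate y t lap_psi z)\<bar>
        \<le> \<delta> * t powr (real DIM('a) + \<gamma> - 1) * A"
  shows "\<bar>mollified v x \<delta> - mollified v y \<delta>\<bar> \<le> \<bar>mollified v x R - mollified v y R\<bar> + A / (1 - \<gamma>) * \<delta> powr \<gamma>"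
proof (cases "\<delta> = R")
  case True
  then show ?thesis using A g by simp
next
  case False
  with \<delta> have dR: "\<delta> < R" by simp
  let ?P = "\<lambda>t. mollified v x t - mollified v y t"
  let ?P' = "\<lambda>t. (LINT z|lborel. v z * dilate x t lap_psi z) / t ^ (DIM('a) + 1) - (LINT z|lborel. v z * dilate y t lap_psi z) / t ^ (DIM('a) + 1)"
  let ?\<phi> = "\<lambda>t. - (\<delta> * A / (1 - \<gamma>)) * t powr (\<gamma> - 1)"
  have P: "(?P has_real_derivative ?P' t) (at t)" if "t > 0" for t
    by (intro DERIV_diff mollified_scale_derivative[OF v that])
  have "norm (?P R - ?P \<delta>) \<le> ?\<phi> R - ?\<phi> \<delta>"
  proof (rule differentiable_bound_general[OF dR, where f = ?P and f' = ?P' and \<phi> = ?\<phi> and \<phi>' = "\<lambda>t. \<delta> * A * t powr (\<gamma> - 2)"])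
    show "continuous_on {\<delta>..R} ?P"
      by (rule DERIV_continuous_on[of _ _ ?P'], rule has_field_derivative_at_within, rule P) (use \<delta>(2) in auto)
    show "continuous_on {\<delta>..R} ?\<phi>"
      using \<delta> by (intro continuous_intros) auto
    fix r assume r: "\<delta> < r" "r < R"
    then have r0: "r > 0" using \<delta>(2) by linarith
    show "(?P has_vector_derivative ?P' r) (at r)"
      using P[OF r0] by (simp add: has_real_derivative_iff_has_vector_derivative)
    have "(?\<phi> has_real_derivative - (\<delta> * A / (1 - \<gamma>)) * ((\<gamma> - 1) * r powr (\<gamma> - 1 - 1))) (at r)"
      using r0 by (intro DERIV_cmult has_real_derivative_powr) auto
    moreover have "- (\<delta> * A / (1 - \<gamma>)) * ((\<gamma> - 1) * r powr (\<gamma> - 1 - 1)) = \<delta> * A * r powr (\<gamma> - 2)"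
      using g by (simp add: field_simps)
    ultimately show "(?\<phi> has_vector_derivative \<delta> * A * r powr (\<gamma> - 2)) (at r)"
      by (simp add: has_real_derivative_iff_has_vector_derivative)
    have "norm (?P' r) = \<bar>(LINT z|lborel. v z * dilate x r lap_psi z) - (LINT z|lborel. v z * dilate y r lap_psi z)\<bar> / r ^ (DIM('a) + 1)"
      using r0 by (simp add: diff_divide_distrib[symmetric] abs_divide del: power_Suc)
    also have "\<dots> \<le> (\<delta> * r powr (real DIM('a) + \<gamma> - 1) * A) / r ^ (DIM('a) + 1)"
      using r r0 by (intro divide_right_mono h) auto
    also have "\<dots> = \<delta> * A * (r powr (real DIM('a) + \<gamma> - 1) / r powr (real DIM('a) + 1))"
      using r0 by (simp add: powr_add powr_realpow mult_ac)
    also have "\<dots> = \<delta> * A * r powr (\<gamma> - 2)"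
      by (simp add: powr_diff[symmetric])
    finally show "norm (?P' r) \<le> \<delta> * A * r powr (\<gamma> - 2)" .
  qed
  also have "?\<phi> R - ?\<phi> \<delta> \<le> \<delta> * A / (1 - \<gamma>) * \<delta> powr (\<gamma> - 1)"
    using A g \<delta> by simp
  also have "\<dots> = A / (1 - \<gamma>) * (\<delta> powr 1 * \<delta> powr (\<gamma> - 1))"
    using \<delta> by simp
  also have "\<dots> = A / (1 - \<gamma>) * \<delta> powr \<gamma>"
    by (subst powr_add[symmetric]) simp
  finally show ?thesis by simp
qed

text \<open>A pointwise substitute for Hoelder continuity of order \<open>\<gamma>\<close> at $x$. The factor $t^{d+\gamma}$ is
  $t^{d+1}$, lost to the normalisation of the kernel, times the desired rate $t^{\gamma-1}$. The second
  bound involves the constant of $x$ only, although $y$ varies.\<close>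

definition scale_bounds :: "('a::euclidean_space \<Rightarrow> real) \<Rightarrow> real \<Rightarrow> real \<Rightarrow> 'a \<Rightarrow> real \<Rightarrow> bool" where
  "scale_bounds v \<gamma> R x A \<longleftrightarrow> A \<ge> 0 \<and> (\<forall>t. 0 < t \<and> t \<le> R \<longrightarrow>
     \<bar>LINT z|lborel. v z * dilate x t lap_psi z\<bar> \<le> t powr (real DIM('a) + \<gamma>) * A \<and>
     (\<forall>y. norm (x - y) \<le> t \<longrightarrow>
       \<bar>(LINT z|lborel. v z * dilate x t lap_psi z) - (LINT z|lborel. v z * dilate y t lap_psi z)\<bar>
        \<le> norm (x - y) * t powr (real DIM('a) + \<gamma> - 1) * A))"

text \<open>Telescoping over scales: go from $x$ to its average at scale $|x-y|$, up to scale $R$, where the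
  kernel is Lipschitz, and down again at $y$. The summand $1$ absorbs the contribution of scale $R$.\<close>

proposition pointwise_holder_of_scale_bounds:
  fixes v :: "'a::euclidean_space \<Rightarrow> real"
  assumes v: "integrable lborel v" and g: "0 < \<gamma>" "\<gamma> < 1" and R: "R > 0"
    and s: "\<And>n::nat. s n > (0::real)" "s \<longlonglongrightarrow> 0"
  obtains C where "C \<ge> 0"
    "\<And>x y A B. (\<lambda>n. mollified v x (s n)) \<longlonglongrightarrow> rho_mass TYPE('a) * v x \<Longrightarrow>
      (\<lambda>n. mollified v y (s n)) \<longlonglongrightarrow> rho_mass TYPE('a) * v y \<Longrightarrow>
      scale_bounds v \<gamma> R x A \<Longrightarrow> scale_bounds v \<gamma> R y B \<Longrightarrow> norm (x - y) \<le> R \<Longrightarrow>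
      \<bar>v x - v y\<bar> \<le> C * (A + B + 1) * norm (x - y) powr \<gamma>"
proof -
  define c where "c = rho_mass TYPE('a)"
  have c: "c > 0" unfolding c_def by (rule rho_mass_pos)
  obtain L where L: "L \<ge> 0" "\<And>z w::'a. \<bar>rho z - rho w\<bar> \<le> L * norm (z - w)"
    using bumps_lipschitz[OF rho_bump] by blast
  \<comment> \<open>At the top scale the average is Lipschitz, with a constant depending on the norm of $v$ in $L^1$.\<close>
  define E where "E = L / R ^ (DIM('a) + 1) * (LINT z|lborel. \<bar>v z\<bar>)"
  have E: "E \<ge> 0" unfolding E_def using L R by simp
  have VR: "\<bar>mollified v x R - mollified v y R\<bar> \<le> E * norm (x - y)" for x y
  proof -
    have int: "integrable lborel (\<lambda>z. v z * (dilate x R rho z / R ^ DIM('a)))" for x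
      using integrable_mult_dilate[OF v rho_bump, of x R] by auto
    have "mollified v x R - mollified v y R = (LINT z|lborel. v z * (dilate x R rho z / R ^ DIM('a)) - v z * (dilate y R rho z / R ^ DIM('a)))"
      unfolding mollified_def by (rule Bochner_Integration.integral_diff[OF int[of x] int[of y], symmetric])
    also have "\<bar>\<dots>\<bar> \<le> (LINT z|lborel. \<bar>v z * (dilate x R rho z / R ^ DIM('a)) - v z * (dilate y R rho z / R ^ DIM('a))\<bar>)"
      by (rule integral_abs_bound)
    also have "\<dots> \<le> (LINT z|lborel. (L / R ^ (DIM('a) + 1) * norm (x - y)) * \<bar>v z\<bar>)"
    proof (rule integral_mono)
      show "integrable lborel (\<lambda>z. \<bar>v z * (dilate x R rho z / R ^ DIM('a)) - v z * (dilate y R rho z / R ^ DIM('a))\<bar>)"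
        by (rule integrable_abs[OF Bochner_Integration.integrable_diff[OF int[of x] int[of y]]])
      show "integrable lborel (\<lambda>z. (L / R ^ (DIM('a) + 1) * norm (x - y)) * \<bar>v z\<bar>)"
        by (rule integrable_mult_right[OF integrable_abs[OF v]])
      fix z
      have "\<bar>dilate x R rho z - dilate y R rho z\<bar> \<le> L * norm ((1 / R) *\<^sub>R (z - x) - (1 / R) *\<^sub>R (z - y))"
        unfolding dilate_def by (rule L(2))
      also have "(1 / R) *\<^sub>R (z - x) - (1 / R) *\<^sub>R (z - y) = (1 / R) *\<^sub>R (y - x)"
        by (simp add: algebra_simps)
      also have "L * norm ((1 / R) *\<^sub>R (y - x)) = L / R * norm (x - y)"
        using R by (simp add: norm_minus_commute)
      finally have "\<bar>dilate x R rho z - dilate y R rho z\<bar> \<le> L / R * norm (x - y)" .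
      then have "\<bar>v z\<bar> * \<bar>dilate x R rho z - dilate y R rho z\<bar> / R ^ DIM('a) \<le> \<bar>v z\<bar> * (L / R * norm (x - y)) / R ^ DIM('a)"
        using R by (intro divide_right_mono mult_left_mono) auto
      moreover have "\<bar>v z * (dilate x R rho z / R ^ DIM('a)) - v z * (dilate y R rho z / R ^ DIM('a))\<bar>
          = \<bar>v z\<bar> * \<bar>dilate x R rho z - dilate y R rho z\<bar> / R ^ DIM('a)"
        using R by (simp add: abs_mult[symmetric] right_diff_distrib[symmetric] diff_divide_distrib[symmetric] abs_divide)
      ultimately show "\<bar>v z * (dilate x R rho z / R ^ DIM('a)) - v z * (dilate y R rho z / R ^ DIM('a))\<bar>
          \<le> (L / R ^ (DIM('a) + 1) * norm (x - y)) * \<bar>v z\<bar>"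
        by (simp add: mult_ac)
    qed
    also have "\<dots> = E * norm (x - y)" by (simp add: E_def)
    finally show ?thesis .
  qed
  define C0 where "C0 = 1 / \<gamma> + 1 / (1 - \<gamma>) + E * R powr (1 - \<gamma>)"
  have C0: "C0 \<ge> 0" unfolding C0_def using g E by simp
  show ?thesis
  proof (rule that[of "C0 / c"])
    show "C0 / c \<ge> 0" using C0 c by simp
    fix x y A B
    assume cx: "(\<lambda>n. mollified v x (s n)) \<longlonglongrightarrow> rho_mass TYPE('a) * v x"
      and cy: "(\<lambda>n. mollified v y (s n)) \<longlonglongrightarrow> rho_mass TYPE('a) * v y"
      and sx: "scale_bounds v \<gamma> R x A" and sy: "scale_bounds v \<gamma> R y B" and xy: "norm (x - y) \<le> R"
    show "\<bar>v x - v y\<bar> \<le> C0 / c * (A + B + 1) * norm (x - y) powr \<gamma>"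
    proof (cases "x = y")
      case False
      define \<delta> where "\<delta> = norm (x - y)"
      have d: "0 < \<delta>" "\<delta> \<le> R" using False xy by (auto simp: \<delta>_def)
      have A: "A \<ge> 0" "B \<ge> 0" using sx sy by (auto simp: scale_bounds_def)
      have 1: "\<bar>mollified v x \<delta> - c * v x\<bar> \<le> A / \<gamma> * \<delta> powr \<gamma>"
        by (rule mollified_convergence_rate[OF v g(1) d A(1) s]) (use cx sx in \<open>auto simp: c_def scale_bounds_def\<close>)
      have 2: "\<bar>mollified v y \<delta> - c * v y\<bar> \<le> B / \<gamma> * \<delta> powr \<gamma>"
        by (rule mollified_convergence_rate[OF v g(1) d A(2) s]) (use cy sy in \<open>auto simp: c_def scale_bounds_def\<close>)
      have 3: "\<bar>mollified v x \<delta> - mollified v y \<delta>\<bar> \<le> \<bar>mollified v x R - mollified v y R\<bar> + A / (1 - \<gamma>) * \<delta> powr \<gamma>"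
      proof (rule mollified_difference_bound[OF v g A(1) \<delta>_def d])
        fix t assume t: "\<delta> \<le> t" "t \<le> R"
        then have "0 < t" using d by linarith
        with sx t show "\<bar>(LINT z|lborel. v z * dilate x t lap_psi z) - (LINT z|lborel. v z * dilate y t lap_psi z)\<bar>
            \<le> \<delta> * t powr (real DIM('a) + \<gamma> - 1) * A"
          unfolding scale_bounds_def \<delta>_def by blast
      qed
      have "E * \<delta> \<le> E * R powr (1 - \<gamma>) * \<delta> powr \<gamma>"
      proof -
        have "\<delta> = \<delta> powr (1 - \<gamma>) * \<delta> powr \<gamma>" using d by (simp add: powr_add[symmetric])
        also have "\<dots> \<le> R powr (1 - \<gamma>) * \<delta> powr \<gamma>"
          using d g by (intro mult_right_mono powr_mono2) auto
        finally show ?thesis using E by (simp add: mult_left_mono mult.assoc)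
      qed
      then have 4: "\<bar>mollified v x R - mollified v y R\<bar> \<le> E * R powr (1 - \<gamma>) * \<delta> powr \<gamma>"
        using VR[of x y] by (simp add: \<delta>_def)
      have "c * \<bar>v x - v y\<bar> = \<bar>c * v x - c * v y\<bar>"
        using c by (simp add: abs_mult right_diff_distrib[symmetric])
      also have "\<dots> \<le> (A / \<gamma> + B / \<gamma> + A / (1 - \<gamma>) + E * R powr (1 - \<gamma>)) * \<delta> powr \<gamma>"
        using 1 2 3 4 by (simp add: distrib_right)
      also have "\<dots> \<le> (C0 * (A + B + 1)) * \<delta> powr \<gamma>"
      proof (rule mult_right_mono)
        have "A / \<gamma> + B / \<gamma> + A / (1 - \<gamma>) + E * R powr (1 - \<gamma>)
           \<le> (A + B + 1) * (1 / \<gamma>) + (A + B + 1) * (1 / (1 - \<gamma>)) + (A + B + 1) * (E * R powr (1 - \<gamma>))"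
        proof -
          have "A / \<gamma> + B / \<gamma> \<le> (A + B + 1) * (1 / \<gamma>)" using g by (simp add: add_divide_distrib[symmetric] divide_right_mono)
          moreover have "A / (1 - \<gamma>) \<le> (A + B + 1) * (1 / (1 - \<gamma>))" using g A by (simp add: divide_right_mono)
          moreover have "1 * (E * R powr (1 - \<gamma>)) \<le> (A + B + 1) * (E * R powr (1 - \<gamma>))"
            using E A by (intro mult_right_mono) auto
          ultimately show ?thesis by linarith
        qed
        also have "\<dots> = C0 * (A + B + 1)" by (simp add: C0_def algebra_simps)
        finally show "A / \<gamma> + B / \<gamma> + A / (1 - \<gamma>) + E * R powr (1 - \<gamma>) \<le> C0 * (A + B + 1)" .
      qed simp
      finally show ?thesis using c by (simp add: \<delta>_def field_simps)
    qed simp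
  qed
qed

lemma ball_borel [measurable]: "ball (x::'a::euclidean_space) r \<in> sets borel"
  by simp

text \<open>On a ball of radius $s$ the weight is at least $s^{-\kappa}$.\<close>

lemma ball_integral_of_weighted:
  fixes f :: "'a::euclidean_space \<Rightarrow> real"
  assumes [measurable]: "f \<in> borel_measurable borel" and s: "0 < s" "s \<le> R" and k: "\<kappa> \<ge> 0" and A: "A \<ge> 0"
    and H: "(\<integral>\<^sup>+y. indicator (ball x R) y * ennreal (\<bar>f y\<bar> * norm (x - y) powr (- \<kappa>)) \<partial>lborel) \<le> ennreal A"
  shows "(\<integral>\<^sup>+y. indicator (ball x s) y * ennreal \<bar>f y\<bar> \<partial>lborel) \<le> ennreal (s powr \<kappa> * A)"
proof -
  have "(\<integral>\<^sup>+y. indicator (ball x s) y * ennreal \<bar>f y\<bar> \<partial>lborel)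
     \<le> (\<integral>\<^sup>+y. ennreal (s powr \<kappa>) * (indicator (ball x R) y * ennreal (\<bar>f y\<bar> * norm (x - y) powr (- \<kappa>))) \<partial>lborel)"
  proof (rule nn_integral_mono_AE)
    have "AE y in lborel. y \<noteq> x" by (rule AE_lborel_singleton)
    then show "AE y in lborel. indicator (ball x s) y * ennreal \<bar>f y\<bar>
       \<le> ennreal (s powr \<kappa>) * (indicator (ball x R) y * ennreal (\<bar>f y\<bar> * norm (x - y) powr (- \<kappa>)))"
    proof eventually_elim
      case (elim y)
      show ?case
      proof (cases "y \<in> ball x s")
        case True
        define n where "n = norm (x - y)"
        have n: "0 < n" "n < s" using True elim by (auto simp: n_def dist_norm)
        have "1 = n powr \<kappa> * n powr (- \<kappa>)" using n by (simp add: powr_add[symmetric])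
        also have "\<dots> \<le> s powr \<kappa> * n powr (- \<kappa>)" using n k by (intro mult_right_mono powr_mono2) auto
        finally have "\<bar>f y\<bar> * 1 \<le> \<bar>f y\<bar> * (s powr \<kappa> * n powr (- \<kappa>))" by (intro mult_left_mono) auto
        then have "ennreal \<bar>f y\<bar> \<le> ennreal (s powr \<kappa> * (\<bar>f y\<bar> * n powr (- \<kappa>)))"
          by (intro ennreal_leI) (simp add: mult_ac)
        moreover have "y \<in> ball x R" using True s by auto
        ultimately show ?thesis using True by (simp add: n_def ennreal_mult')
      qed simp
    qed
  qed
  also have "\<dots> = ennreal (s powr \<kappa>) * (\<integral>\<^sup>+y. indicator (ball x R) y * ennreal (\<bar>f y\<bar> * norm (x - y) powr (- \<kappa>)) \<partial>lborel)"
    by (rule nn_integral_cmult) measurable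
  also have "\<dots> \<le> ennreal (s powr \<kappa>) * ennreal A" by (intro mult_left_mono H) auto
  finally show ?thesis by (simp add: ennreal_mult')
qed

lemma dilate_integral_bound:
  fixes f :: "'a::euclidean_space \<Rightarrow> real"
  assumes f: "integrable lborel f" and k: "k \<in> bumps" and t: "t > 0"
    and M: "\<And>z. \<bar>k z\<bar> \<le> M"
    and I: "(\<integral>\<^sup>+y. indicator (ball x t) y * ennreal \<bar>f y\<bar> \<partial>lborel) \<le> ennreal I" "I \<ge> 0"
  shows "\<bar>LINT y|lborel. f y * dilate x t k y\<bar> \<le> M * I"
proof -
  have [measurable]: "f \<in> borel_measurable borel" using f by auto
  have M0: "M \<ge> 0" using M[of 0] by linarith
  have "ennreal \<bar>LINT y|lborel. f y * dilate x t k y\<bar> \<le> (\<integral>\<^sup>+y. ennreal (norm (f y * dilate x t k y)) \<partial>lborel)"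
    using integral_norm_bound_ennreal[OF integrable_mult_dilate[OF f k]] by simp
  also have "\<dots> \<le> (\<integral>\<^sup>+y. ennreal M * (indicator (ball x t) y * ennreal \<bar>f y\<bar>) \<partial>lborel)"
  proof (rule nn_integral_mono)
    fix y
    show "ennreal (norm (f y * dilate x t k y)) \<le> ennreal M * (indicator (ball x t) y * ennreal \<bar>f y\<bar>)"
    proof (cases "y \<in> ball x t")
      case True
      have "\<bar>f y\<bar> * \<bar>dilate x t k y\<bar> \<le> \<bar>f y\<bar> * M" using M by (intro mult_left_mono) (auto simp: dilate_def)
      then show ?thesis using True M0 by (simp add: abs_mult ennreal_mult'[symmetric] mult.commute ennreal_leI)
    next
      case False
      then have "dilate x t k y = 0" by (rule dilate_outside[OF k t])
      then show ?thesis by simp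
    qed
  qed
  also have "\<dots> = ennreal M * (\<integral>\<^sup>+y. indicator (ball x t) y * ennreal \<bar>f y\<bar> \<partial>lborel)"
    by (rule nn_integral_cmult) measurable
  also have "\<dots> \<le> ennreal M * ennreal I" by (intro mult_left_mono I) auto
  finally show ?thesis using M0 I by (simp add: ennreal_mult[symmetric])
qed

lemma dilate_integral_difference_bound:
  fixes f :: "'a::euclidean_space \<Rightarrow> real"
  assumes f: "integrable lborel f" and k: "k \<in> bumps" and t: "t > 0" and xy: "norm (x - y) \<le> t"
    and M: "\<And>z w. \<bar>k z - k w\<bar> \<le> M * norm (z - w)"
    and I: "(\<integral>\<^sup>+y. indicator (ball x (2 * t)) y * ennreal \<bar>f y\<bar> \<partial>lborel) \<le> ennreal I" "I \<ge> 0" "M \<ge> 0"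
  shows "\<bar>(LINT z|lborel. f z * dilate x t k z) - (LINT z|lborel. f z * dilate y t k z)\<bar> \<le> M * (norm (x - y) / t) * I"
proof -
  have [measurable]: "f \<in> borel_measurable borel" using f by auto
  let ?N = "M * (norm (x - y) / t)"
  have N: "?N \<ge> 0" using I t by simp
  note int = integrable_mult_dilate[OF f k]
  have "(LINT z|lborel. f z * dilate x t k z) - (LINT z|lborel. f z * dilate y t k z)
     = (LINT z|lborel. f z * dilate x t k z - f z * dilate y t k z)"
    by (rule Bochner_Integration.integral_diff[OF int[of x t] int[of y t], symmetric])
  then have "ennreal \<bar>(LINT z|lborel. f z * dilate x t k z) - (LINT z|lborel. f z * dilate y t k z)\<bar>
      \<le> (\<integral>\<^sup>+z. ennreal (norm (f z * dilate x t k z - f z * dilate y t k z)) \<partial>lborel)"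
    using integral_norm_bound_ennreal[OF Bochner_Integration.integrable_diff[OF int[of x t] int[of y t]]] by simp
  also have "\<dots> \<le> (\<integral>\<^sup>+z. ennreal ?N * (indicator (ball x (2 * t)) z * ennreal \<bar>f z\<bar>) \<partial>lborel)"
  proof (rule nn_integral_mono)
    fix z
    show "ennreal (norm (f z * dilate x t k z - f z * dilate y t k z)) \<le> ennreal ?N * (indicator (ball x (2 * t)) z * ennreal \<bar>f z\<bar>)"
    proof (cases "z \<in> ball x (2 * t)")
      case True
      have "\<bar>dilate x t k z - dilate y t k z\<bar> \<le> M * norm ((1 / t) *\<^sub>R (z - x) - (1 / t) *\<^sub>R (z - y))"
        unfolding dilate_def by (rule M)
      also have "(1 / t) *\<^sub>R (z - x) - (1 / t) *\<^sub>R (z - y) = (1 / t) *\<^sub>R (y - x)"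
        by (simp add: algebra_simps)
      also have "M * norm ((1 / t) *\<^sub>R (y - x)) = ?N"
        using t by (simp add: norm_minus_commute)
      finally have "\<bar>f z\<bar> * \<bar>dilate x t k z - dilate y t k z\<bar> \<le> \<bar>f z\<bar> * ?N" by (intro mult_left_mono) auto
      then have "norm (f z * dilate x t k z - f z * dilate y t k z) \<le> ?N * \<bar>f z\<bar>"
        by (simp add: right_diff_distrib[symmetric] abs_mult mult.commute)
      then have "ennreal (norm (f z * dilate x t k z - f z * dilate y t k z)) \<le> ennreal (?N * \<bar>f z\<bar>)"
        by (rule ennreal_leI)
      then show ?thesis using True N by (simp only: ennreal_mult' indicator_simps mult_1)
    next
      case False
      then have z: "z \<notin> ball x t" "z \<notin> ball y t"
        using t xy norm_triangle_ineq4[of "x - y" "z - y"] by (auto simp: dist_norm norm_minus_commute)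
      then have "dilate x t k z = 0" "dilate y t k z = 0" using dilate_outside[OF k t] by blast+
      then show ?thesis by simp
    qed
  qed
  also have "\<dots> = ennreal ?N * (\<integral>\<^sup>+y. indicator (ball x (2 * t)) y * ennreal \<bar>f y\<bar> \<partial>lborel)"
    by (rule nn_integral_cmult) measurable
  also have "\<dots> \<le> ennreal ?N * ennreal I" by (intro mult_left_mono I) auto
  also have "\<dots> = ennreal (?N * I)" using N I(2) by (simp only: ennreal_mult)
  finally show ?thesis using mult_nonneg_nonneg[OF N I(2)] by (simp only: ennreal_le_iff)
qed

text \<open>The bridge from a weak equation to \<^const>\<open>scale_bounds\<close>. The exponent \<open>m\<close> is $0$ for the divergence
  form equation, which turns the Laplacian into two derivatives of the kernel, and $1$ for a function
  with known weak gradient, where only one derivative falls on the kernel and a factor $t$ remains.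
  The ball doubles in the difference bound because the ball around the second point has to be
  covered as well.\<close>

lemma scale_bounds_of_kernel_identity:
  fixes v :: "'a::euclidean_space \<Rightarrow> real" and f k :: "'i \<Rightarrow> 'a \<Rightarrow> real"
  assumes J: "finite J" and f: "\<And>j. j \<in> J \<Longrightarrow> integrable lborel (f j)"
    and k: "\<And>j. j \<in> J \<Longrightarrow> k j \<in> bumps" and R: "R > 0"
    and M: "\<And>j z. j \<in> J \<Longrightarrow> \<bar>k j z\<bar> \<le> M" "\<And>j z w. j \<in> J \<Longrightarrow> \<bar>k j z - k j w\<bar> \<le> M * norm (z - w)" "M \<ge> 0"
    and m: "m \<le> 1" and g: "0 < \<gamma>" "\<gamma> < 1" and A: "A \<ge> 0"
    and ident: "\<And>z t. 0 < t \<Longrightarrow> t \<le> R \<Longrightarrow> norm (x - z) \<le> R \<Longrightarrow>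
      (LINT y|lborel. v y * dilate z t lap_psi y) = b * t ^ m * (\<Sum>j\<in>J. LINT y|lborel. f j y * dilate z t (k j) y)"
    and b: "\<bar>b\<bar> \<le> B"
    and H: "\<And>j. j \<in> J \<Longrightarrow> (\<integral>\<^sup>+y. indicator (ball x (2 * R)) y * ennreal (\<bar>f j y\<bar> * norm (x - y) powr (- (real DIM('a) + \<gamma> - real m))) \<partial>lborel) \<le> ennreal A"
  shows "scale_bounds v \<gamma> R x (B * real (card J) * M * 2 ^ (DIM('a) + 1) * A)"
proof -
  let ?\<kappa> = "real DIM('a) + \<gamma> - real m"
  have "real m \<le> real DIM('a)" using m DIM_positive[where 'a='a] by linarith
  then have \<kappa>: "?\<kappa> \<ge> 0" using g by linarith
  have B: "B \<ge> 0" using b by linarith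
  let ?D = "B * real (card J) * M * 2 ^ (DIM('a) + 1) * A"
  have D: "B * real (card J) * M * A \<le> ?D"
  proof -
    have "B * real (card J) * M * 1 * A \<le> B * real (card J) * M * 2 ^ (DIM('a) + 1) * A"
      using B M A by (intro mult_right_mono mult_left_mono) (auto simp del: power_Suc)
    then show ?thesis by simp
  qed
  show ?thesis
    unfolding scale_bounds_def
  proof (intro conjI allI impI)
    show "?D \<ge> 0" using B M A by simp
    fix t assume t: "0 < t \<and> t \<le> R"
    have Im: "(\<integral>\<^sup>+y. indicator (ball x s) y * ennreal \<bar>f j y\<bar> \<partial>lborel) \<le> ennreal (s powr ?\<kappa> * A)"
      if "j \<in> J" "0 < s" "s \<le> 2 * R" for j s
      by (rule ball_integral_of_weighted[OF _ that(2,3) \<kappa> A H[OF that(1)]]) (use f[OF that(1)] in auto)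
    have tm: "t ^ m * t powr ?\<kappa> = t powr (real DIM('a) + \<gamma>)"
      using t by (simp add: powr_realpow[symmetric] powr_add[symmetric])
    have "\<bar>\<Sum>j\<in>J. LINT y|lborel. f j y * dilate x t (k j) y\<bar> \<le> (\<Sum>j\<in>J. M * (t powr ?\<kappa> * A))"
    proof (intro order_trans[OF sum_abs] sum_mono)
      fix j assume j: "j \<in> J"
      show "\<bar>LINT y|lborel. f j y * dilate x t (k j) y\<bar> \<le> M * (t powr ?\<kappa> * A)"
        by (rule dilate_integral_bound[OF f[OF j] k[OF j] _ M(1)[OF j] Im[OF j]]) (use t R A in auto)
    qed
    then have "\<bar>b * t ^ m\<bar> * \<bar>\<Sum>j\<in>J. LINT y|lborel. f j y * dilate x t (k j) y\<bar> \<le> (B * t ^ m) * (\<Sum>j\<in>J. M * (t powr ?\<kappa> * A))"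
      using b B t by (intro mult_mono) (auto simp: abs_mult)
    then have "\<bar>LINT y|lborel. v y * dilate x t lap_psi y\<bar> \<le> (B * t ^ m) * (\<Sum>j\<in>J. M * (t powr ?\<kappa> * A))"
      using ident[of t x] t R by (simp add: abs_mult)
    also have "\<dots> = (t ^ m * t powr ?\<kappa>) * (B * real (card J) * M * A)"
      by (simp add: mult_ac)
    also have "\<dots> \<le> t powr (real DIM('a) + \<gamma>) * ?D"
      unfolding tm by (intro mult_left_mono D) auto
    finally show "\<bar>LINT z|lborel. v z * dilate x t lap_psi z\<bar> \<le> t powr (real DIM('a) + \<gamma>) * ?D" .
    fix y assume xy: "norm (x - y) \<le> t"
    have "(LINT z|lborel. v z * dilate x t lap_psi z) - (LINT z|lborel. v z * dilate y t lap_psi z)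
      = b * t ^ m * (\<Sum>j\<in>J. (LINT z|lborel. f j z * dilate x t (k j) z) - (LINT z|lborel. f j z * dilate y t (k j) z))"
      using ident[of t x] ident[of t y] t R xy by (simp add: sum_subtractf right_diff_distrib)
    also have "\<bar>\<dots>\<bar> \<le> (B * t ^ m) * (\<Sum>j\<in>J. M * (norm (x - y) / t) * ((2 * t) powr ?\<kappa> * A))"
    proof -
      have "\<bar>\<Sum>j\<in>J. (LINT z|lborel. f j z * dilate x t (k j) z) - (LINT z|lborel. f j z * dilate y t (k j) z)\<bar>
         \<le> (\<Sum>j\<in>J. M * (norm (x - y) / t) * ((2 * t) powr ?\<kappa> * A))"
      proof (intro order_trans[OF sum_abs] sum_mono)
        fix j assume j: "j \<in> J"
        show "\<bar>(LINT z|lborel. f j z * dilate x t (k j) z) - (LINT z|lborel. f j z * dilate y t (k j) z)\<bar>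
            \<le> M * (norm (x - y) / t) * ((2 * t) powr ?\<kappa> * A)"
          by (rule dilate_integral_difference_bound[OF f[OF j] k[OF j] _ xy M(2)[OF j] Im[OF j]])
            (use t A M(3) in auto)
      qed
      then show ?thesis unfolding abs_mult[of "b * t ^ m"]
        using b B t by (intro mult_mono) (auto simp: abs_mult)
    qed
    also have "\<dots> = norm (x - y) * (B * real (card J) * M * A) * (t ^ m * (2 * t) powr ?\<kappa> / t)"
      by (simp add: mult_ac)
    also have "\<dots> \<le> norm (x - y) * (B * real (card J) * M * A) * (2 ^ (DIM('a) + 1) * t powr (real DIM('a) + \<gamma> - 1))"
    proof (rule mult_left_mono)
      have "(2 * t) powr ?\<kappa> = 2 powr ?\<kappa> * t powr ?\<kappa>" using t by (simp add: powr_mult)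
      then have "t ^ m * (2 * t) powr ?\<kappa> / t = 2 powr ?\<kappa> * ((t ^ m * t powr ?\<kappa>) / t)" by simp
      also have "\<dots> = 2 powr ?\<kappa> * t powr (real DIM('a) + \<gamma> - 1)"
        unfolding tm using t by (simp add: powr_diff)
      also have "\<dots> \<le> 2 powr real (DIM('a) + 1) * t powr (real DIM('a) + \<gamma> - 1)"
        using g by (intro mult_right_mono powr_mono) auto
      finally show "t ^ m * (2 * t) powr ?\<kappa> / t \<le> 2 ^ (DIM('a) + 1) * t powr (real DIM('a) + \<gamma> - 1)"
        by (subst (asm) powr_realpow) auto
    qed (use B M A in simp)
    also have "\<dots> = norm (x - y) * t powr (real DIM('a) + \<gamma> - 1) * ?D"
      by (simp add: mult_ac)
    finally show "\<bar>(LINT z|lborel. v z * dilate x t lap_psi z) - (LINT z|lborel. v z * dilate y t lap_psi z)\<bar>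
        \<le> norm (x - y) * t powr (real DIM('a) + \<gamma> - 1) * ?D" .
  qed
qed

section \<open>Riesz potentials and oscillation integrals\<close>

lemma nn_integral_translate_reflect:
  fixes f :: "'a::euclidean_space \<Rightarrow> ennreal"
  assumes [measurable]: "f \<in> borel_measurable borel"
  shows "(\<integral>\<^sup>+y. f (x - y) \<partial>lborel) = (\<integral>\<^sup>+y. f y \<partial>lborel)"
    and "(\<integral>\<^sup>+y. f (y - x) \<partial>lborel) = (\<integral>\<^sup>+y. f y \<partial>lborel)"
proof -
  show "(\<integral>\<^sup>+y. f (x - y) \<partial>lborel) = (\<integral>\<^sup>+y. f y \<partial>lborel)"
    using nn_integral_lborel_affine[of "\<lambda>y. f (x - y)" "-1" x] by simp
  show "(\<integral>\<^sup>+y. f (y - x) \<partial>lborel) = (\<integral>\<^sup>+y. f y \<partial>lborel)"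
    using nn_integral_lborel_affine[of "\<lambda>y. f (y - x)" "1" x] by simp
qed

text \<open>Take the least power for which \<open>R / 2 ^ m\<close> is at most \<open>r\<close>; the scale before it is the one required.\<close>

lemma dyadic_scale:
  assumes "0 < r" "r < (R::real)"
  obtains n :: nat where "r < R / 2 ^ n" "R / 2 ^ n / 2 \<le> r"
proof -
  obtain m :: nat where "(1 / 2) ^ m < r / R"
    using real_arch_pow_inv[of "r / R" "1 / 2"] assms by auto
  then have ex: "\<exists>m::nat. R / 2 ^ m \<le> r"
    using assms by (intro exI[of _ m]) (auto simp: field_simps)
  define m where "m = (LEAST m::nat. R / 2 ^ m \<le> r)"
  have 1: "R / 2 ^ m \<le> r" unfolding m_def using ex by (rule LeastI_ex)
  then have "m \<noteq> 0" using assms by (cases m) auto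
  then obtain n where n: "m = Suc n" by (cases m) auto
  have "\<not> R / 2 ^ n \<le> r" using not_less_Least[of n "\<lambda>m. R / 2 ^ m \<le> r"] n by (simp add: m_def)
  then show ?thesis using that[of n] 1 n by simp
qed

text \<open>Cover the ball by dyadic shells: the shell at distance $w_n = R 2^{-n}$ contributes at most a
  constant times $w_n^{\kappa}$, and these terms form a geometric series.\<close>

lemma radial_power_integrable:
  assumes \<kappa>: "\<kappa> > 0" and R: "R > 0"
  shows "(\<integral>\<^sup>+y. indicator (ball (0::'a::euclidean_space) R) y * ennreal (norm y powr (\<kappa> - real DIM('a))) \<partial>lborel) < top"
proof -
  define e where "e = \<kappa> - real DIM('a)"
  define w where "w n = R / 2 ^ n" for n :: nat
  have w: "w n > 0" for n using R by (simp add: w_def)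
  define b where "b = measure lborel (ball (0::'a) 1)"
  have b: "emeasure lborel (ball (0::'a) (w n)) = ennreal (w n ^ DIM('a) * b)" for n
  proof -
    have "emeasure lborel (ball (0::'a) (w n)) = ennreal (w n ^ DIM('a)) * emeasure lborel (ball (0::'a) 1)"
      using emeasure_lebesgue_ball_conv_unit_ball[of "w n" "0::'a"] w[of n] by simp
    also have "emeasure lborel (ball (0::'a) 1) = ennreal b"
      unfolding b_def using emeasure_ball_finite[of "0::'a" 1] by (intro emeasure_eq_ennreal_measure) auto
    finally show ?thesis using w[of n] by (simp add: ennreal_mult')
  qed
  have b0: "b \<ge> 0" by (simp add: b_def)
  have pt: "r powr e \<le> 2 powr \<bar>e\<bar> * s powr e" if "0 < r" "r < s" "s / 2 \<le> r" for r s :: real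
  proof (cases "e \<ge> 0")
    case True
    have "r powr e \<le> s powr e" using that True by (intro powr_mono2) auto
    also have "\<dots> \<le> 2 powr \<bar>e\<bar> * s powr e"
      using ge_one_powr_ge_zero[of 2 "\<bar>e\<bar>"] by (simp add: mult_le_cancel_right1)
    finally show ?thesis .
  next
    case False
    have "r powr e \<le> (s / 2) powr e" using that False by (intro powr_mono2') auto
    also have "\<dots> = 2 powr \<bar>e\<bar> * s powr e" using that False by (simp add: powr_divide powr_minus_divide)
    finally show ?thesis .
  qed
  define K where "K n = 2 powr \<bar>e\<bar> * w n powr e" for n
  have le: "indicator (ball (0::'a) R) y * ennreal (norm y powr e) \<le> (\<Sum>n. ennreal (K n) * indicator (ball 0 (w n)) y)" for y
  proof (cases "y \<in> ball 0 R \<and> y \<noteq> 0")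
    case True
    then have "0 < norm y" "norm y < R" by auto
    then obtain n where n: "norm y < R / 2 ^ n" "R / 2 ^ n / 2 \<le> norm y" by (rule dyadic_scale)
    have "norm y powr e \<le> K n" unfolding K_def w_def using n True by (intro pt) auto
    then have "indicator (ball (0::'a) R) y * ennreal (norm y powr e) \<le> ennreal (K n) * indicator (ball 0 (w n)) y"
      using True n by (simp add: w_def ennreal_leI)
    also have "\<dots> \<le> (\<Sum>n. ennreal (K n) * indicator (ball 0 (w n)) y)"
      using sum_le_suminf[of "\<lambda>n. ennreal (K n) * indicator (ball 0 (w n)) y" "{n}"] by (simp del: sum_mult_indicator)
    finally show ?thesis .
  qed auto
  have "(\<integral>\<^sup>+y. indicator (ball (0::'a) R) y * ennreal (norm y powr e) \<partial>lborel)
     \<le> (\<integral>\<^sup>+y. (\<Sum>n. ennreal (K n) * indicator (ball (0::'a) (w n)) y) \<partial>lborel)"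
    by (intro nn_integral_mono le)
  also have "\<dots> = (\<Sum>n. \<integral>\<^sup>+y. ennreal (K n) * indicator (ball (0::'a) (w n)) y \<partial>lborel)"
    by (intro nn_integral_suminf) measurable
  also have "\<dots> = (\<Sum>n. ennreal (K n * (w n ^ DIM('a) * b)))"
    by (simp add: nn_integral_cmult_indicator b K_def ennreal_mult')
  also have "\<dots> < top"
  proof -
    have "K n * (w n ^ DIM('a) * b) = (2 powr \<bar>e\<bar> * b * R powr \<kappa>) * ((1 / 2) powr \<kappa>) ^ n" for n
    proof -
      have "K n * (w n ^ DIM('a) * b) = 2 powr \<bar>e\<bar> * b * (w n powr e * w n powr real DIM('a))"
        using w[of n] by (simp add: K_def powr_realpow)
      also have "w n powr e * w n powr real DIM('a) = w n powr \<kappa>"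
        by (simp add: powr_add[symmetric] e_def)
      also have "w n powr \<kappa> = (R * (1 / 2) ^ n) powr \<kappa>" by (simp add: w_def power_divide)
      also have "\<dots> = R powr \<kappa> * ((1 / 2) powr \<kappa>) ^ n"
        using R by (simp add: powr_mult powr_power mult.commute powr_realpow[symmetric] powr_powr)
      finally show ?thesis by simp
    qed
    moreover have "summable (\<lambda>n. (2 powr \<bar>e\<bar> * b * R powr \<kappa>) * ((1 / 2) powr \<kappa>) ^ n)"
    proof (intro summable_mult summable_geometric)
      have "(1 / 2 :: real) powr \<kappa> < 1" using powr_less_mono2[of \<kappa> "1 / 2" 1] \<kappa> by simp
      then show "norm ((1 / 2 :: real) powr \<kappa>) < 1" by simp
    qed
    ultimately have "summable (\<lambda>n. K n * (w n ^ DIM('a) * b))" by (simp only:)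
    then show ?thesis
      using w b0 by (subst suminf_ennreal_eq[OF _ summable_sums]) (auto simp: K_def less_imp_le)
  qed
  finally show ?thesis by (simp add: e_def)
qed

text \<open>Young's inequality for $L^1 * L^2$: split $k = \sqrt k \sqrt k$, apply the Cauchy--Schwarz
  inequality and exchange the integrations.\<close>

lemma nn_integral_convolution_L2:
  fixes k :: "'a::euclidean_space \<Rightarrow> real" and h :: "'a \<Rightarrow> ennreal"
  assumes [measurable]: "k \<in> borel_measurable borel" "h \<in> borel_measurable borel" and k0: "\<And>z. k z \<ge> 0"
  shows "(\<integral>\<^sup>+x. (\<integral>\<^sup>+y. ennreal (k (x - y)) * h y \<partial>lborel)\<^sup>2 \<partial>lborel)
    \<le> (\<integral>\<^sup>+z. ennreal (k z) \<partial>lborel)\<^sup>2 * (\<integral>\<^sup>+y. (h y)\<^sup>2 \<partial>lborel)"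
proof -
  define I where "I = (\<integral>\<^sup>+z. ennreal (k z) \<partial>lborel)"
  have I1: "(\<integral>\<^sup>+y. ennreal (k (x - y)) \<partial>lborel) = I" for x
    unfolding I_def by (rule nn_integral_translate_reflect(1)[of "\<lambda>z. ennreal (k z)"]) measurable
  have I2: "(\<integral>\<^sup>+x. ennreal (k (x - y)) \<partial>lborel) = I" for y
    unfolding I_def by (rule nn_integral_translate_reflect(2)[of "\<lambda>z. ennreal (k z)"]) measurable
  have "(\<integral>\<^sup>+x. (\<integral>\<^sup>+y. ennreal (k (x - y)) * h y \<partial>lborel)\<^sup>2 \<partial>lborel)
     \<le> (\<integral>\<^sup>+x. I * (\<integral>\<^sup>+y. ennreal (k (x - y)) * (h y)\<^sup>2 \<partial>lborel) \<partial>lborel)"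
  proof (rule nn_integral_mono)
    fix x
    define f where "f y = ennreal (sqrt (k (x - y)))" for y
    have [measurable]: "f \<in> borel_measurable borel" unfolding f_def by measurable
    have f2: "f y * f y = ennreal (k (x - y))" for y
      using k0 by (simp add: f_def ennreal_mult'[symmetric])
    have "(\<integral>\<^sup>+y. ennreal (k (x - y)) * h y \<partial>lborel)\<^sup>2 = (\<integral>\<^sup>+y. f y * (f y * h y) \<partial>lborel)\<^sup>2"
      by (simp add: f2[symmetric] mult.assoc)
    also have "\<dots> \<le> (\<integral>\<^sup>+y. (f y)\<^sup>2 \<partial>lborel) * (\<integral>\<^sup>+y. (f y * h y)\<^sup>2 \<partial>lborel)"
      by (rule Cauchy_Schwarz_nn_integral) measurable
    also have "\<dots> = I * (\<integral>\<^sup>+y. ennreal (k (x - y)) * (h y)\<^sup>2 \<partial>lborel)"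
      by (simp add: power_mult_distrib power2_eq_square[of "f _"] f2 I1)
    finally show "(\<integral>\<^sup>+y. ennreal (k (x - y)) * h y \<partial>lborel)\<^sup>2 \<le> I * (\<integral>\<^sup>+y. ennreal (k (x - y)) * (h y)\<^sup>2 \<partial>lborel)" .
  qed
  also have "\<dots> = I * (\<integral>\<^sup>+x. (\<integral>\<^sup>+y. ennreal (k (x - y)) * (h y)\<^sup>2 \<partial>lborel) \<partial>lborel)"
    by (rule nn_integral_cmult) measurable
  also have "(\<integral>\<^sup>+x. (\<integral>\<^sup>+y. ennreal (k (x - y)) * (h y)\<^sup>2 \<partial>lborel) \<partial>lborel)
      = (\<integral>\<^sup>+y. (\<integral>\<^sup>+x. ennreal (k (x - y)) * (h y)\<^sup>2 \<partial>lborel) \<partial>lborel)"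
    by (rule lborel_pair.Fubini') measurable
  also have "\<dots> = (\<integral>\<^sup>+y. I * (h y)\<^sup>2 \<partial>lborel)"
    by (intro nn_integral_cong) (subst nn_integral_multc, auto simp: I2)
  also have "\<dots> = I * (\<integral>\<^sup>+y. (h y)\<^sup>2 \<partial>lborel)"
    by (rule nn_integral_cmult) measurable
  finally show ?thesis by (simp add: I_def power2_eq_square mult.assoc)
qed

text \<open>The Riesz potential of order \<open>\<kappa>\<close>, truncated at distance \<open>R\<close> so that its kernel is integrable.\<close>

definition riesz :: "real \<Rightarrow> real \<Rightarrow> ('a::euclidean_space \<Rightarrow> ennreal) \<Rightarrow> 'a \<Rightarrow> ennreal" where
  "riesz \<kappa> R h x = (\<integral>\<^sup>+y. indicator (ball x R) y * ennreal (norm (x - y) powr (\<kappa> - real DIM('a))) * h y \<partial>lborel)"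

lemma indicator_ball_norm: "indicator (ball x R) y = (indicator {..<R} (norm (x - y)) :: 'b::zero_neq_one)"
  for x y :: "'a::euclidean_space"
  by (auto simp: indicator_def dist_norm norm_minus_commute)

lemma riesz_measurable [measurable]:
  assumes [measurable]: "h \<in> borel_measurable borel"
  shows "riesz \<kappa> R h \<in> borel_measurable borel"
proof -
  have "(\<lambda>x. riesz \<kappa> R h x) \<in> borel_measurable lborel"
    unfolding riesz_def indicator_ball_norm by (rule lborel.borel_measurable_nn_integral) measurable
  then show ?thesis by simp
qed

lemma riesz_const_finite:
  assumes "\<kappa> > 0" "R > 0"
  shows "riesz \<kappa> R (\<lambda>_. 1) (x::'a) = riesz \<kappa> R (\<lambda>_. 1) (0::'a::euclidean_space)" "riesz \<kappa> R (\<lambda>_. 1) (0::'a::euclidean_space) < top"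
proof -
  show "riesz \<kappa> R (\<lambda>_. 1) (0::'a) < top"
    using radial_power_integrable[OF assms, where 'a='a] by (simp add: riesz_def)
  show "riesz \<kappa> R (\<lambda>_. 1) x = riesz \<kappa> R (\<lambda>_. 1) (0::'a)"
    using nn_integral_translate_reflect(1)[of "\<lambda>z. indicator (ball 0 R) z * ennreal (norm z powr (\<kappa> - real DIM('a)))" x]
    by (simp add: riesz_def indicator_ball_norm norm_minus_commute)
qed

lemma riesz_L2:
  fixes h :: "'a::euclidean_space \<Rightarrow> ennreal"
  assumes [measurable]: "h \<in> borel_measurable borel" and \<kappa>: "\<kappa> > 0" "R > 0"
    and h: "(\<integral>\<^sup>+y. (h y)\<^sup>2 \<partial>lborel) < top"
  shows "(\<integral>\<^sup>+x. (riesz \<kappa> R h x)\<^sup>2 \<partial>lborel) < top"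
proof -
  define k where "k z = indicator (ball (0::'a) R) z * norm z powr (\<kappa> - real DIM('a))" for z
  have [measurable]: "k \<in> borel_measurable borel" unfolding k_def by measurable
  have ek: "ennreal (k z) = indicator (ball 0 R) z * ennreal (norm z powr (\<kappa> - real DIM('a)))" for z
    by (simp add: k_def indicator_def)
  have "riesz \<kappa> R h x = (\<integral>\<^sup>+y. ennreal (k (x - y)) * h y \<partial>lborel)" for x
    unfolding riesz_def ek by (simp add: indicator_ball_norm norm_minus_commute)
  then have "(\<integral>\<^sup>+x. (riesz \<kappa> R h x)\<^sup>2 \<partial>lborel) \<le> (\<integral>\<^sup>+z. ennreal (k z) \<partial>lborel)\<^sup>2 * (\<integral>\<^sup>+y. (h y)\<^sup>2 \<partial>lborel)"
    using nn_integral_convolution_L2[of k h] by (simp add: k_def)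
  also have "\<dots> < top"
    using radial_power_integrable[OF \<kappa>, where 'a='a] h by (simp add: ek ennreal_mult_less_top power2_eq_square)
  finally show ?thesis .
qed

lemma ennreal_square_sum_le: "((a::ennreal) + b)\<^sup>2 \<le> 2 * a\<^sup>2 + 2 * b\<^sup>2"
proof (cases "a = top \<or> b = top")
  case True
  then show ?thesis by (auto simp: power2_eq_square ennreal_mult_top top_add ennreal_top_mult)
next
  case False
  then obtain x y where xy: "a = ennreal x" "x \<ge> 0" "b = ennreal y" "y \<ge> 0"
    by (metis ennreal_cases)
  have "(x + y)\<^sup>2 \<le> 2 * x\<^sup>2 + 2 * y\<^sup>2" using sum_squares_bound[of x y] by (simp add: power2_sum)
  then have "ennreal ((x + y)\<^sup>2) \<le> ennreal (2 * x\<^sup>2 + 2 * y\<^sup>2)" by (rule ennreal_leI)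
  also have "\<dots> = ennreal 2 * ennreal (x\<^sup>2) + ennreal 2 * ennreal (y\<^sup>2)"
    by (simp only: ennreal_plus ennreal_mult' zero_le_power2 zero_le_numeral mult_nonneg_nonneg)
  finally show ?thesis using xy by (simp add: ennreal_power ennreal_plus[symmetric] del: ennreal_plus)
qed

text \<open>A Dini-type integral of the oscillation at $x$, on the scale of Hoelder continuity of order \<open>\<gamma>\<close>.\<close>

definition oscillation :: "real \<Rightarrow> real \<Rightarrow> ('a::euclidean_space \<Rightarrow> real) \<Rightarrow> 'a \<Rightarrow> ennreal" where
  "oscillation \<gamma> R f x = (\<integral>\<^sup>+y. indicator (ball x R) y * ennreal (\<bar>f x - f y\<bar> * norm (x - y) powr (- (real DIM('a) + \<gamma>))) \<partial>lborel)"

lemma oscillation_measurable [measurable]: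
  assumes [measurable]: "f \<in> borel_measurable borel"
  shows "oscillation \<gamma> R f \<in> borel_measurable borel"
proof -
  have "(\<lambda>x. oscillation \<gamma> R f x) \<in> borel_measurable lborel"
    unfolding oscillation_def indicator_ball_norm by (rule lborel.borel_measurable_nn_integral) measurable
  then show ?thesis by simp
qed

text \<open>Compare $D$ with $r^\alpha$: a smaller difference is controlled by the power of $r$ alone, a larger
  one satisfies $D^2 \le D^q r^{\alpha(2-q)}$.\<close>

lemma gagliardo_exponent_lowering:
  fixes D r s \<alpha> q d :: real
  assumes D: "D \<ge> 0" and r: "0 < r" "r \<le> 1" and s: "s \<le> \<alpha>" and q: "q \<ge> 2"
  shows "D\<^sup>2 * r powr (- (d + 2 * s)) \<le> r powr (2 * (\<alpha> - s) - d) + D powr q * r powr (- (\<alpha> * q + d))"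
proof (cases "D \<le> r powr \<alpha>")
  case True
  have "D\<^sup>2 * r powr (- (d + 2 * s)) \<le> (r powr \<alpha>)\<^sup>2 * r powr (- (d + 2 * s))"
    using True D by (intro mult_right_mono power_mono) auto
  also have "(r powr \<alpha>)\<^sup>2 = r powr (2 * \<alpha>)" using r by (simp add: powr_power)
  also have "r powr (2 * \<alpha>) * r powr (- (d + 2 * s)) = r powr (2 * (\<alpha> - s) - d)"
    by (simp add: powr_add[symmetric] algebra_simps)
  finally show ?thesis using D by (simp add: add_increasing2)
next
  case False
  then have D0: "D > 0" "r powr \<alpha> \<le> D" using r by (auto intro: less_trans[of 0 "r powr \<alpha>"])
  have "D\<^sup>2 = D powr q * D powr (2 - q)" using D0 by (simp add: powr_add[symmetric] powr_numeral)
  also have "\<dots> \<le> D powr q * (r powr \<alpha>) powr (2 - q)"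
    using D0 r q by (intro mult_left_mono powr_mono2') auto
  finally have "D\<^sup>2 * r powr (- (d + 2 * s)) \<le> D powr q * (r powr (\<alpha> * (2 - q)) * r powr (- (d + 2 * s)))"
    by (simp add: powr_powr mult_right_mono mult.assoc[symmetric])
  also have "\<dots> = D powr q * r powr (- (\<alpha> * q + d) + 2 * (\<alpha> - s))"
    by (simp add: powr_add[symmetric] algebra_simps)
  also have "\<dots> \<le> D powr q * r powr (- (\<alpha> * q + d))"
    using r s by (intro mult_left_mono powr_mono') auto
  finally show ?thesis by (simp add: add_increasing)
qed

text \<open>Pass to exponent $2$ and an intermediate smoothness $s$ between \<open>\<gamma>\<close> and \<open>\<alpha>\<close>; the
  Cauchy--Schwarz inequality then separates the Gagliardo integrand from the kernel
  $|x-y|^{2(s-\gamma)-d}$, which is integrable.\<close>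

lemma oscillation_L2_of_gagliardo:
  fixes f :: "'a::euclidean_space \<Rightarrow> real"
  assumes [measurable]: "f \<in> borel_measurable borel" "U \<in> sets borel"
    and R: "0 < R" "R \<le> 1" and U: "bounded U" and \<gamma>: "\<gamma> < \<alpha>" and q: "q \<ge> 2"
    and G: "(\<integral>\<^sup>+x. \<integral>\<^sup>+y. indicator U x * (indicator (ball x R) y * ennreal (\<bar>f x - f y\<bar> powr q * norm (x - y) powr (- (\<alpha> * q + real DIM('a))))) \<partial>lborel \<partial>lborel) < top"
  shows "(\<integral>\<^sup>+x. indicator U x * (oscillation \<gamma> R f x)\<^sup>2 \<partial>lborel) < top"
proof -
  define s where "s = (\<gamma> + \<alpha>) / 2"
  have s: "\<gamma> < s" "s < \<alpha>" using \<gamma> by (auto simp: s_def)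
  let ?d = "real DIM('a)"
  define I where "I = riesz (2 * (s - \<gamma>)) R (\<lambda>_. 1) (0::'a)"
  define I' where "I' = riesz (2 * (\<alpha> - s)) R (\<lambda>_. 1) (0::'a)"
  have I: "I < top" "I' < top" unfolding I_def I'_def using s R by (auto intro!: riesz_const_finite)
  have Ix: "riesz (2 * (s - \<gamma>)) R (\<lambda>_. 1) x = I" "riesz (2 * (\<alpha> - s)) R (\<lambda>_. 1) x = I'" for x :: 'a
    unfolding I_def I'_def using s R by (intro riesz_const_finite(1); simp)+
  define Q where "Q x y = indicator (ball x R) y * ennreal (\<bar>f x - f y\<bar> powr q * norm (x - y) powr (- (\<alpha> * q + ?d)))" for x y
  have [measurable]: "(\<lambda>y. Q x y) \<in> borel_measurable borel" for x unfolding Q_def by measurable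
  have [measurable]: "case_prod Q \<in> borel_measurable (borel \<Otimes>\<^sub>M borel)"
    unfolding Q_def indicator_ball_norm by measurable
  have est: "(oscillation \<gamma> R f x)\<^sup>2 \<le> I * (I' + (\<integral>\<^sup>+y. Q x y \<partial>lborel))" for x
  proof -
    define a where "a y = indicator (ball x R) y * ennreal (norm (x - y) powr (s - \<gamma> - ?d / 2))" for y
    define b where "b y = indicator (ball x R) y * ennreal (\<bar>f x - f y\<bar> * norm (x - y) powr (- (?d / 2 + s)))" for y
    have [measurable]: "a \<in> borel_measurable borel" "b \<in> borel_measurable borel" unfolding a_def b_def by measurable
    have ab: "indicator (ball x R) y * ennreal (\<bar>f x - f y\<bar> * norm (x - y) powr (- (?d + \<gamma>))) = a y * b y" for y
      unfolding a_def b_def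
      by (auto simp: indicator_def ennreal_mult'[symmetric] mult.left_commute powr_add[symmetric] algebra_simps)
    have a2: "(a y)\<^sup>2 = indicator (ball x R) y * ennreal (norm (x - y) powr (2 * (s - \<gamma>) - ?d)) * 1" for y
      unfolding a_def by (auto simp: indicator_def power2_eq_square ennreal_mult'[symmetric] powr_add[symmetric] algebra_simps)
    have b2: "(b y)\<^sup>2 = indicator (ball x R) y * ennreal (\<bar>f x - f y\<bar>\<^sup>2 * norm (x - y) powr (- (?d + 2 * s)))" for y
    proof -
      have "(norm (x - y) powr (- (?d / 2 + s)))\<^sup>2 = norm (x - y) powr (- (?d + 2 * s))"
      proof -
        have "- (?d / 2 + s) + - (?d / 2 + s) = - (?d + 2 * s)" by simp
        then show ?thesis by (simp only: power2_eq_square powr_add[symmetric])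
      qed
      then show ?thesis unfolding b_def by (auto simp: indicator_def ennreal_power power_mult_distrib)
    qed
    have b3: "(b y)\<^sup>2 \<le> indicator (ball x R) y * ennreal (norm (x - y) powr (2 * (\<alpha> - s) - ?d)) * 1 + Q x y" for y
    proof (cases "y \<in> ball x R \<and> y \<noteq> x")
      case True
      have "\<bar>f x - f y\<bar>\<^sup>2 * norm (x - y) powr (- (?d + 2 * s)) \<le> norm (x - y) powr (2 * (\<alpha> - s) - ?d) + \<bar>f x - f y\<bar> powr q * norm (x - y) powr (- (\<alpha> * q + ?d))"
        by (rule gagliardo_exponent_lowering) (use True R s q in \<open>auto simp: dist_norm\<close>)
      then have "ennreal (\<bar>f x - f y\<bar>\<^sup>2 * norm (x - y) powr (- (?d + 2 * s))) \<le> ennreal (norm (x - y) powr (2 * (\<alpha> - s) - ?d) + \<bar>f x - f y\<bar> powr q * norm (x - y) powr (- (\<alpha> * q + ?d)))"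
        by (rule ennreal_leI)
      also have "\<dots> = ennreal (norm (x - y) powr (2 * (\<alpha> - s) - ?d)) + ennreal (\<bar>f x - f y\<bar> powr q * norm (x - y) powr (- (\<alpha> * q + ?d)))"
        by (rule ennreal_plus) auto
      finally have "ennreal (\<bar>f x - f y\<bar>\<^sup>2 * norm (x - y) powr (- (?d + 2 * s))) \<le> \<dots>" .
      then show ?thesis using True unfolding b2 Q_def by simp
    next
      case False
      then show ?thesis unfolding b2 by auto
    qed
    have "(oscillation \<gamma> R f x)\<^sup>2 = (\<integral>\<^sup>+y. a y * b y \<partial>lborel)\<^sup>2" unfolding oscillation_def ab ..
    also have "\<dots> \<le> (\<integral>\<^sup>+y. (a y)\<^sup>2 \<partial>lborel) * (\<integral>\<^sup>+y. (b y)\<^sup>2 \<partial>lborel)"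
      by (rule Cauchy_Schwarz_nn_integral) measurable
    also have "(\<integral>\<^sup>+y. (a y)\<^sup>2 \<partial>lborel) = I" unfolding a2 riesz_def[symmetric] by (rule Ix)
    also have "(\<integral>\<^sup>+y. (b y)\<^sup>2 \<partial>lborel) \<le> (\<integral>\<^sup>+y. indicator (ball x R) y * ennreal (norm (x - y) powr (2 * (\<alpha> - s) - ?d)) * 1 + Q x y \<partial>lborel)"
      by (intro nn_integral_mono b3)
    also have "\<dots> = riesz (2 * (\<alpha> - s)) R (\<lambda>_. 1) x + (\<integral>\<^sup>+y. Q x y \<partial>lborel)"
      unfolding riesz_def by (rule nn_integral_add) measurable
    finally show ?thesis unfolding Ix by (simp add: mult_left_mono)
  qed
  have "(\<integral>\<^sup>+x. indicator U x * (oscillation \<gamma> R f x)\<^sup>2 \<partial>lborel) \<le> (\<integral>\<^sup>+x. I * (I' * indicator U x + indicator U x * (\<integral>\<^sup>+y. Q x y \<partial>lborel)) \<partial>lborel)"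
  proof (rule nn_integral_mono)
    fix x
    show "indicator U x * (oscillation \<gamma> R f x)\<^sup>2 \<le> I * (I' * indicator U x + indicator U x * (\<integral>\<^sup>+y. Q x y \<partial>lborel))"
      using est[of x] by (auto simp: indicator_def)
  qed
  also have "\<dots> = I * (I' * emeasure lborel U + (\<integral>\<^sup>+x. indicator U x * (\<integral>\<^sup>+y. Q x y \<partial>lborel) \<partial>lborel))"
    by (simp add: nn_integral_cmult nn_integral_add nn_integral_cmult_indicator)
  also have "(\<integral>\<^sup>+x. indicator U x * (\<integral>\<^sup>+y. Q x y \<partial>lborel) \<partial>lborel) = (\<integral>\<^sup>+x. \<integral>\<^sup>+y. indicator U x * Q x y \<partial>lborel \<partial>lborel)"
    by (intro nn_integral_cong nn_integral_cmult[symmetric]) measurable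
  finally have "(\<integral>\<^sup>+x. indicator U x * (oscillation \<gamma> R f x)\<^sup>2 \<partial>lborel)
      \<le> I * (I' * emeasure lborel U + (\<integral>\<^sup>+x. \<integral>\<^sup>+y. indicator U x * Q x y \<partial>lborel \<partial>lborel))" .
  also have "\<dots> < top"
  proof -
    have "(\<integral>\<^sup>+x. \<integral>\<^sup>+y. indicator U x * Q x y \<partial>lborel \<partial>lborel) < top" using G unfolding Q_def .
    then show ?thesis using I emeasure_bounded_finite[OF U] by (simp add: ennreal_mult_less_top)
  qed
  finally show ?thesis .
qed

section \<open>Oscillation of functions with a square-integrable weak gradient\<close>

text \<open>The exceptional null set depends neither on the pair of points nor on the bounds \<open>A\<close> and \<open>B\<close>.\<close>

lemma AE_holder_of_scale_bounds:
  fixes v :: "'a::euclidean_space \<Rightarrow> real"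
  assumes v: "integrable lborel v" "\<And>x. x \<notin> ball 0 N \<Longrightarrow> v x = 0" and g: "0 < \<gamma>" "\<gamma> < 1" and R: "R > 0"
  obtains S C where "AE x in lborel. x \<in> S" "C \<ge> 0"
    "\<And>x y A B. x \<in> S \<Longrightarrow> y \<in> S \<Longrightarrow> scale_bounds v \<gamma> R x A \<Longrightarrow> scale_bounds v \<gamma> R y B \<Longrightarrow> norm (x - y) \<le> R \<Longrightarrow>
      \<bar>v x - v y\<bar> \<le> C * (A + B + 1) * norm (x - y) powr \<gamma>"
proof -
  obtain s where s: "\<And>n::nat. s n > (0::real)" "s \<longlonglongrightarrow> 0"
    "AE x in lborel. (\<lambda>n. mollified v x (s n)) \<longlonglongrightarrow> rho_mass TYPE('a) * v x"
    using mollified_AE_subsequence[where v = v and N = N, OF v] by blast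
  obtain C where C: "C \<ge> 0"
    "\<And>x y A B. (\<lambda>n. mollified v x (s n)) \<longlonglongrightarrow> rho_mass TYPE('a) * v x \<Longrightarrow>
      (\<lambda>n. mollified v y (s n)) \<longlonglongrightarrow> rho_mass TYPE('a) * v y \<Longrightarrow>
      scale_bounds v \<gamma> R x A \<Longrightarrow> scale_bounds v \<gamma> R y B \<Longrightarrow> norm (x - y) \<le> R \<Longrightarrow>
      \<bar>v x - v y\<bar> \<le> C * (A + B + 1) * norm (x - y) powr \<gamma>"
    using pointwise_holder_of_scale_bounds[OF v(1) g R s(1,2)] by blast
  show ?thesis
    by (rule that[of "{x. (\<lambda>n. mollified v x (s n)) \<longlonglongrightarrow> rho_mass TYPE('a) * v x}" C]) (use s(3) C in auto)
qed

lemma nn_integral_sum_squares_finite: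
  assumes "finite J" "\<And>j. j \<in> J \<Longrightarrow> h j \<in> borel_measurable M" "\<And>j. j \<in> J \<Longrightarrow> (\<integral>\<^sup>+x. (h j x)\<^sup>2 \<partial>M) < (top::ennreal)"
  shows "(\<integral>\<^sup>+x. (\<Sum>j\<in>J. h j x)\<^sup>2 \<partial>M) < top"
  using assms
proof (induction rule: finite_induct)
  case (insert i J)
  have [measurable]: "h i \<in> borel_measurable M" "(\<lambda>x. \<Sum>j\<in>J. h j x) \<in> borel_measurable M"
    using insert by (auto intro!: borel_measurable_sum)
  have "(\<integral>\<^sup>+x. (\<Sum>j\<in>insert i J. h j x)\<^sup>2 \<partial>M) \<le> (\<integral>\<^sup>+x. 2 * (h i x)\<^sup>2 + 2 * (\<Sum>j\<in>J. h j x)\<^sup>2 \<partial>M)"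
    using insert by (intro nn_integral_mono) (auto intro: ennreal_square_sum_le)
  also have "\<dots> = 2 * (\<integral>\<^sup>+x. (h i x)\<^sup>2 \<partial>M) + 2 * (\<integral>\<^sup>+x. (\<Sum>j\<in>J. h j x)\<^sup>2 \<partial>M)"
    by (subst nn_integral_add; (subst nn_integral_cmult)?; measurable) (simp add: nn_integral_cmult)
  also have "\<dots> < top" using insert by (simp add: ennreal_mult_less_top)
  finally show ?case .
qed simp

lemma finite_bumps_uniform:
  fixes k :: "'i \<Rightarrow> 'a::euclidean_space \<Rightarrow> real"
  assumes "finite J" "\<And>j. j \<in> J \<Longrightarrow> k j \<in> bumps"
  obtains M where "M \<ge> 0" "\<And>j z. j \<in> J \<Longrightarrow> \<bar>k j z\<bar> \<le> M" "\<And>j z w. j \<in> J \<Longrightarrow> \<bar>k j z - k j w\<bar> \<le> M * norm (z - w)"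
proof -
  have "\<forall>j\<in>J. \<exists>M. M \<ge> 0 \<and> (\<forall>z. \<bar>k j z\<bar> \<le> M) \<and> (\<forall>z w. \<bar>k j z - k j w\<bar> \<le> M * norm (z - w))"
  proof
    fix j assume "j \<in> J"
    then have kj: "k j \<in> bumps" by (rule assms)
    obtain M1 where M1: "M1 \<ge> 0" "\<And>z. \<bar>k j z\<bar> \<le> M1" using bumps_bounded[OF kj] by blast
    obtain M2 where M2: "M2 \<ge> 0" "\<And>z w. \<bar>k j z - k j w\<bar> \<le> M2 * norm (z - w)" using bumps_lipschitz[OF kj] by blast
    have "\<bar>k j z\<bar> \<le> max M1 M2" for z using M1(2)[of z] by simp
    moreover have "\<bar>k j z - k j w\<bar> \<le> max M1 M2 * norm (z - w)" for z w
      using M2(2)[of z w] by (rule order_trans) (intro mult_right_mono, auto)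
    ultimately show "\<exists>M. M \<ge> 0 \<and> (\<forall>z. \<bar>k j z\<bar> \<le> M) \<and> (\<forall>z w. \<bar>k j z - k j w\<bar> \<le> M * norm (z - w))"
      using M1(1) by (intro exI[of _ "max M1 M2"]) auto
  qed
  then obtain m where m: "\<And>j. j \<in> J \<Longrightarrow> m j \<ge> 0" "\<And>j z. j \<in> J \<Longrightarrow> \<bar>k j z\<bar> \<le> m j"
    "\<And>j z w. j \<in> J \<Longrightarrow> \<bar>k j z - k j w\<bar> \<le> m j * norm (z - w)" by metis
  have le: "m j \<le> sum m J" if "j \<in> J" for j using that m assms(1) by (intro member_le_sum) auto
  show ?thesis
  proof (rule that[of "sum m J"])
    show "sum m J \<ge> 0" using m by (intro sum_nonneg) auto
    fix j z assume j: "j \<in> J"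
    show "\<bar>k j z\<bar> \<le> sum m J" using m(2)[OF j, of z] le[OF j] by linarith
    fix w
    have "m j * norm (z - w) \<le> sum m J * norm (z - w)" using le[OF j] by (intro mult_right_mono) auto
    then show "\<bar>k j z - k j w\<bar> \<le> sum m J * norm (z - w)" using m(3)[OF j, of z w] by linarith
  qed
qed

lemma lap_psi_integral:
  fixes v :: "'a::euclidean_space \<Rightarrow> real"
  assumes v: "integrable lborel v" and t: "t > 0"
  shows "(LINT y|lborel. v y * dilate z t lap_psi y) = (\<Sum>j\<in>Basis. LINT y|lborel. v y * dilate z t (pd j (pd j psi)) y)"
proof -
  have "(LINT y|lborel. v y * dilate z t lap_psi y) = (LINT y|lborel. (\<Sum>j\<in>Basis. v y * dilate z t (pd j (pd j psi)) y))"
    by (simp add: dilate_def lap_psi_def sum_distrib_left)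
  also have "\<dots> = (\<Sum>j\<in>Basis. LINT y|lborel. v y * dilate z t (pd j (pd j psi)) y)"
    by (intro Bochner_Integration.integral_sum integrable_mult_dilate v bumps_deriv psi_bump)
  finally show ?thesis .
qed

text \<open>The weak identity for rescaled bumps; differentiating the rescaled bump produces the factor $1/t$.\<close>

lemma weak_derivative_dilate:
  fixes f w :: "'a::euclidean_space \<Rightarrow> real"
  assumes weak: "\<And>\<phi>. \<phi> \<in> test_functions \<Omega> \<Longrightarrow> (LINT y|lborel. f y * pd j \<phi> y) = - (LINT y|lborel. w y * \<phi> y)"
    and k: "k \<in> bumps" and t: "t > 0" and z: "cball z t \<subseteq> \<Omega>"
  shows "(LINT y|lborel. f y * dilate z t (pd j k) y) = - t * (LINT y|lborel. w y * dilate z t k y)"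
proof -
  have "(LINT y|lborel. f y * dilate z t (pd j k) y) = (LINT y|lborel. t * (f y * pd j (dilate z t k) y))"
    unfolding pd_dilate[OF k] using t by simp
  also have "\<dots> = t * (LINT y|lborel. f y * pd j (dilate z t k) y)" by simp
  also have "(LINT y|lborel. f y * pd j (dilate z t k) y) = - (LINT y|lborel. w y * dilate z t k y)"
    by (rule weak[OF dilate_test_function[OF k t z]])
  finally show ?thesis by simp
qed

text \<open>With $\Delta\psi = \sum_j \partial_j \partial_j \psi$, one derivative moves onto the function, so its
  scale derivatives are controlled by averages of the weak gradient. This yields a pointwise Hoelder
  bound of an order $g$ between \<open>\<gamma>\<close> and $1$ whose weight is a Riesz potential of order $1 - g$ of the
  gradient, hence in $L^2$. Inserting it into the oscillation integral leaves a Riesz potential of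
  order $g - \gamma$ of that weight.\<close>

proposition oscillation_L2_of_weak_derivative:
  fixes f :: "'a::euclidean_space \<Rightarrow> real" and w :: "'a \<Rightarrow> 'a \<Rightarrow> real"
  assumes f: "integrable lborel f" "\<And>x. x \<notin> ball 0 N \<Longrightarrow> f x = 0"
    and w: "\<And>j. j \<in> Basis \<Longrightarrow> integrable lborel (w j)" "\<And>j. j \<in> Basis \<Longrightarrow> (\<integral>\<^sup>+x. (ennreal \<bar>w j x\<bar>)\<^sup>2 \<partial>lborel) < top"
    and weak: "\<And>j \<phi>. j \<in> Basis \<Longrightarrow> \<phi> \<in> test_functions \<Omega> \<Longrightarrow> (LINT y|lborel. f y * pd j \<phi> y) = - (LINT y|lborel. w j y * \<phi> y)"
    and U: "U \<in> sets borel" "bounded U" "\<And>x. x \<in> U \<Longrightarrow> cball x (3 * R) \<subseteq> \<Omega>" and R: "R > 0"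
    and \<gamma>: "0 < \<gamma>" "\<gamma> < 1"
  shows "(\<integral>\<^sup>+x. indicator U x * (oscillation \<gamma> R f x)\<^sup>2 \<partial>lborel) < top"
proof -
  let ?d = "real DIM('a)"
  note [measurable] = U(1)
  have [measurable]: "f \<in> borel_measurable borel" using f by auto
  have wm [measurable]: "w j \<in> borel_measurable borel" if "j \<in> Basis" for j using w(1)[OF that] by auto
  \<comment> \<open>Any order strictly between \<open>\<gamma>\<close> and 1 would do.\<close>
  define g where "g = (\<gamma> + 1) / 2"
  have g: "0 < g" "g < 1" "\<gamma> < g" using \<gamma> by (auto simp: g_def)
  define h where "h j = riesz (1 - g) (2 * R) (\<lambda>y. ennreal \<bar>w j y\<bar>)" for j
  have hm: "h j \<in> borel_measurable borel" if "j \<in> Basis" for j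
    unfolding h_def by (intro riesz_measurable) (use wm[OF that] in measurable)
  have h2: "(\<integral>\<^sup>+x. (h j x)\<^sup>2 \<partial>lborel) < top" if "j \<in> Basis" for j
    unfolding h_def by (intro riesz_L2 w that) (use wm[OF that] g R in auto)
  define A where "A x = (\<Sum>j\<in>Basis. h j x)" for x
  have [measurable]: "A \<in> borel_measurable borel" unfolding A_def[abs_def] using hm by (intro borel_measurable_sum) auto
  have A2: "(\<integral>\<^sup>+x. (A x)\<^sup>2 \<partial>lborel) < top"
    unfolding A_def by (intro nn_integral_sum_squares_finite h2) (use hm in auto)
  have "AE x in lborel. (A x)\<^sup>2 \<noteq> \<infinity>"
    by (rule nn_integral_PInf_AE) (use A2 in auto)
  then have Afin: "AE x in lborel. A x < top"
    by eventually_elim (auto simp: less_top power2_eq_square ennreal_mult_eq_top_iff)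
  obtain S C where S: "AE x in lborel. x \<in> S" and C: "C \<ge> 0"
    "\<And>x y A B. x \<in> S \<Longrightarrow> y \<in> S \<Longrightarrow> scale_bounds f g R x A \<Longrightarrow> scale_bounds f g R y B \<Longrightarrow> norm (x - y) \<le> R \<Longrightarrow>
      \<bar>f x - f y\<bar> \<le> C * (A + B + 1) * norm (x - y) powr g"
    using AE_holder_of_scale_bounds[where v = f and N = N, OF f g(1,2) R] by blast
  obtain M where M: "M \<ge> 0" "\<And>j z. j \<in> Basis \<Longrightarrow> \<bar>pd j psi (z::'a)\<bar> \<le> M"
    "\<And>j z w. j \<in> Basis \<Longrightarrow> \<bar>pd j psi (z::'a) - pd j psi w\<bar> \<le> M * norm (z - w)"
    using finite_bumps_uniform[where J = "Basis::'a set" and k = "\<lambda>j. pd j psi"] bumps_deriv(2)[OF psi_bump] by (metis finite_Basis)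
  define D where "D = 1 * real (card (Basis::'a set)) * M * 2 ^ (DIM('a) + 1)"
  have D: "D \<ge> 0" unfolding D_def using M by simp
  have sb: "scale_bounds f g R x (D * enn2real (A x))" if V: "cball x (2 * R) \<subseteq> \<Omega>" and fin: "A x < top" for x
    unfolding D_def
  proof (rule scale_bounds_of_kernel_identity[where k = "\<lambda>j. pd j psi" and J = Basis and f = w and m = 1 and b = "- 1" and B = 1])
    fix z t assume t: "0 < t" "t \<le> R" "norm (x - z) \<le> R"
    have "cball z t \<subseteq> cball x (2 * R)"
    proof
      fix p assume "p \<in> cball z t"
      then show "p \<in> cball x (2 * R)" using t dist_triangle[of x p z] by (simp add: dist_norm)
    qed
    then have z: "cball z t \<subseteq> \<Omega>" using V by blast
    have "(LINT y|lborel. f y * dilate z t lap_psi y) = (\<Sum>j\<in>Basis. - t * (LINT y|lborel. w j y * dilate z t (pd j psi) y))"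
      unfolding lap_psi_integral[OF f(1) t(1)]
      by (intro sum.cong refl weak_derivative_dilate[OF weak _ t(1) z] bumps_deriv psi_bump)
    then show "(LINT y|lborel. f y * dilate z t lap_psi y) = (- 1) * t ^ 1 * (\<Sum>j\<in>Basis. LINT y|lborel. w j y * dilate z t (pd j psi) y)"
      by (simp add: sum_distrib_left)
  next
    fix j :: 'a assume j: "j \<in> Basis"
    have "(\<integral>\<^sup>+y. indicator (ball x (2 * R)) y * ennreal (\<bar>w j y\<bar> * norm (x - y) powr (- (?d + g - real 1))) \<partial>lborel) = h j x"
      unfolding h_def riesz_def
      by (intro nn_integral_cong) (simp add: ennreal_mult' algebra_simps)
    also have "\<dots> \<le> A x" unfolding A_def using j by (intro member_le_sum) auto
    also have "\<dots> = ennreal (enn2real (A x))" using fin by simp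
    finally show "(\<integral>\<^sup>+y. indicator (ball x (2 * R)) y * ennreal (\<bar>w j y\<bar> * norm (x - y) powr (- (?d + g - real 1))) \<partial>lborel) \<le> ennreal (enn2real (A x))" .
  qed (use w g R M bumps_deriv(2)[OF psi_bump] in auto)
  define C' where "C' = C * (D + 1)"
  have C': "C' \<ge> 0" unfolding C'_def using C D by simp
  let ?\<epsilon> = "g - \<gamma>"
  define \<kappa>0 where "\<kappa>0 = riesz ?\<epsilon> R (\<lambda>_. 1) (0::'a)"
  have \<kappa>0: "\<kappa>0 < top" unfolding \<kappa>0_def using g R by (intro riesz_const_finite) auto
  have osc: "AE x in lborel. x \<in> U \<longrightarrow> oscillation \<gamma> R f x \<le> ennreal C' * ((A x + 1) * \<kappa>0 + riesz ?\<epsilon> R A x)"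
    using S Afin
  proof eventually_elim
    case (elim x)
    show ?case
    proof
      assume xU: "x \<in> U"
      have "cball x (2 * R) \<subseteq> cball x (3 * R)" using R by (intro subset_cball) auto
      then have xV: "cball x (2 * R) \<subseteq> \<Omega>" using U(3)[OF xU] by blast
      have "oscillation \<gamma> R f x \<le> (\<integral>\<^sup>+y. ennreal C' * ((A x + 1) * (indicator (ball x R) y * ennreal (norm (x - y) powr (?\<epsilon> - ?d)) * 1)
          + indicator (ball x R) y * ennreal (norm (x - y) powr (?\<epsilon> - ?d)) * A y) \<partial>lborel)"
        unfolding oscillation_def
      proof (rule nn_integral_mono_AE)
        show "AE y in lborel. indicator (ball x R) y * ennreal (\<bar>f x - f y\<bar> * norm (x - y) powr - (?d + \<gamma>))
          \<le> ennreal C' * ((A x + 1) * (indicator (ball x R) y * ennreal (norm (x - y) powr (?\<epsilon> - ?d)) * 1)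
          + indicator (ball x R) y * ennreal (norm (x - y) powr (?\<epsilon> - ?d)) * A y)"
          using S Afin
        proof eventually_elim
          case el: (elim y)
          show ?case
          proof (cases "y \<in> ball x R")
            case True
            then have n: "norm (x - y) \<le> R" by (simp add: dist_norm)
            have "cball y (2 * R) \<subseteq> cball x (3 * R)"
            proof
              fix p assume "p \<in> cball y (2 * R)"
              then show "p \<in> cball x (3 * R)" using n dist_triangle[of x p y] by (simp add: dist_norm)
            qed
            then have yV: "cball y (2 * R) \<subseteq> \<Omega>" using U(3)[OF xU] by blast
            define a b where "a = enn2real (A x)" and "b = enn2real (A y)"
            have ab: "A x = ennreal a" "A y = ennreal b" "a \<ge> 0" "b \<ge> 0"
              using elim el by (auto simp: a_def b_def)
            have "\<bar>f x - f y\<bar> \<le> C * (D * a + D * b + 1) * norm (x - y) powr g"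
              unfolding a_def b_def by (intro C(2) sb xV yV n) (use elim el in auto)
            also have "C * (D * a + D * b + 1) \<le> C' * (a + b + 1)"
            proof -
              have "D * a + D * b + 1 \<le> (D + 1) * (a + b + 1)" using D ab by (simp add: algebra_simps)
              then show ?thesis unfolding C'_def using C by (simp add: mult_left_mono mult.assoc)
            qed
            finally have "\<bar>f x - f y\<bar> \<le> C' * (a + b + 1) * norm (x - y) powr g"
              by (simp add: mult_right_mono)
            then have "\<bar>f x - f y\<bar> * norm (x - y) powr - (?d + \<gamma>) \<le> C' * (a + b + 1) * norm (x - y) powr g * norm (x - y) powr - (?d + \<gamma>)"
              by (rule mult_right_mono) simp
            also have "\<dots> = C' * (a + b + 1) * norm (x - y) powr (?\<epsilon> - ?d)"
              by (simp add: mult.assoc powr_add[symmetric] algebra_simps)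
            finally have "ennreal (\<bar>f x - f y\<bar> * norm (x - y) powr - (?d + \<gamma>)) \<le> ennreal (C' * (a + b + 1) * norm (x - y) powr (?\<epsilon> - ?d))"
              by (rule ennreal_leI)
            also have "\<dots> = ennreal C' * ((A x + 1) * ennreal (norm (x - y) powr (?\<epsilon> - ?d)) + ennreal (norm (x - y) powr (?\<epsilon> - ?d)) * A y)"
            proof -
              have "C' * (a + b + 1) * p = C' * ((a + 1) * p + p * b)" for p :: real by (simp add: algebra_simps)
              then show ?thesis
                by (simp only: ab(1,2)) (simp only: ennreal_mult ennreal_plus mult_nonneg_nonneg add_nonneg_nonneg
                    ab(3,4) C' ennreal_1 powr_ge_zero zero_le_one)
            qed
            finally show ?thesis using True by simp
          qed simp
        qed
      qed
      also have "\<dots> = ennreal C' * ((A x + 1) * riesz ?\<epsilon> R (\<lambda>_. 1) x + riesz ?\<epsilon> R A x)"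
        unfolding riesz_def by (simp add: nn_integral_cmult nn_integral_add)
      also have "riesz ?\<epsilon> R (\<lambda>_. 1) x = \<kappa>0" unfolding \<kappa>0_def using g R by (intro riesz_const_finite) auto
      finally show "oscillation \<gamma> R f x \<le> ennreal C' * ((A x + 1) * \<kappa>0 + riesz ?\<epsilon> R A x)" .
    qed
  qed
  have "(\<integral>\<^sup>+x. indicator U x * (oscillation \<gamma> R f x)\<^sup>2 \<partial>lborel)
    \<le> (\<integral>\<^sup>+x. (ennreal C')\<^sup>2 * (2 * (\<kappa>0\<^sup>2 * (2 * (A x)\<^sup>2 + 2 * indicator U x)) + 2 * (riesz ?\<epsilon> R A x)\<^sup>2) \<partial>lborel)"
  proof (rule nn_integral_mono_AE)
    show "AE x in lborel. indicator U x * (oscillation \<gamma> R f x)\<^sup>2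
       \<le> (ennreal C')\<^sup>2 * (2 * (\<kappa>0\<^sup>2 * (2 * (A x)\<^sup>2 + 2 * indicator U x)) + 2 * (riesz ?\<epsilon> R A x)\<^sup>2)"
      using osc
    proof eventually_elim
      case (elim x)
      show ?case
      proof (cases "x \<in> U")
        case True
        then have "(oscillation \<gamma> R f x)\<^sup>2 \<le> (ennreal C' * ((A x + 1) * \<kappa>0 + riesz ?\<epsilon> R A x))\<^sup>2"
          using elim by (intro power_mono) auto
        also have "\<dots> \<le> (ennreal C')\<^sup>2 * (2 * ((A x + 1) * \<kappa>0)\<^sup>2 + 2 * (riesz ?\<epsilon> R A x)\<^sup>2)"
          unfolding power_mult_distrib[of "ennreal C'"] by (intro mult_left_mono ennreal_square_sum_le) auto
        also have "\<dots> \<le> (ennreal C')\<^sup>2 * (2 * (\<kappa>0\<^sup>2 * (2 * (A x)\<^sup>2 + 2 * 1\<^sup>2)) + 2 * (riesz ?\<epsilon> R A x)\<^sup>2)"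
        proof -
          have "((A x + 1) * \<kappa>0)\<^sup>2 \<le> \<kappa>0\<^sup>2 * (2 * (A x)\<^sup>2 + 2 * 1\<^sup>2)"
            unfolding power_mult_distrib mult.commute[of "(A x + 1)\<^sup>2"] by (intro mult_left_mono ennreal_square_sum_le) auto
          then show ?thesis by (intro mult_left_mono add_right_mono) auto
        qed
        finally show ?thesis using True by simp
      qed simp
    qed
  qed
  also have "\<dots> = (ennreal C')\<^sup>2 * (2 * (\<kappa>0\<^sup>2 * (2 * (\<integral>\<^sup>+x. (A x)\<^sup>2 \<partial>lborel) + 2 * emeasure lborel U)) + 2 * (\<integral>\<^sup>+x. (riesz ?\<epsilon> R A x)\<^sup>2 \<partial>lborel))"
    by (simp add: nn_integral_cmult nn_integral_add nn_integral_cmult_indicator)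
  also have "\<dots> < top"
    using \<kappa>0 A2 emeasure_bounded_finite[OF U(2)] riesz_L2[of A ?\<epsilon> R] g R
    by (simp add: ennreal_mult_less_top power2_eq_square)
  finally show ?thesis .
qed

section \<open>Borel representatives and uniqueness of weak derivatives\<close>

lemma AE_lebesgue_on_iff:
  assumes "\<Omega> \<in> sets borel"
  shows "(AE x in lebesgue_on \<Omega>. P x) \<longleftrightarrow> (AE x in lborel. x \<in> \<Omega> \<longrightarrow> P x)"
  using assms by (subst AE_restrict_space_iff) (auto simp: AE_completion_iff)

lemma lebesgue_on_borel_representative:
  fixes f :: "'a::euclidean_space \<Rightarrow> real"
  assumes O: "\<Omega> \<in> sets borel" and f: "f \<in> borel_measurable (lebesgue_on \<Omega>)"
  obtains f' where "f' \<in> borel_measurable borel" "\<And>x. x \<notin> \<Omega> \<Longrightarrow> f' x = 0" "AE x in lborel. x \<in> \<Omega> \<longrightarrow> f x = f' x"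
proof -
  have "(\<lambda>x. indicator \<Omega> x *\<^sub>R f x) \<in> borel_measurable lebesgue"
    using f by (subst (asm) borel_measurable_restrict_space_iff) (use O in auto)
  then obtain h where h: "h \<in> borel_measurable lborel" "AE x in lborel. indicator \<Omega> x *\<^sub>R f x = h x"
    using completion_ex_borel_measurable_real by blast
  note [measurable] = O
  show ?thesis
  proof (rule that[of "\<lambda>x. indicator \<Omega> x * h x"])
    show "(\<lambda>x. indicator \<Omega> x * h x) \<in> borel_measurable borel" using h(1) by measurable
    show "AE x in lborel. x \<in> \<Omega> \<longrightarrow> f x = indicator \<Omega> x * h x"
      using h(2) by eventually_elim auto
  qed auto
qed

text \<open>Integrals over a Borel set with respect to completed Lebesgue measure are integrals of a Borel
  representative, extended by zero, over the whole space. The latter form suits Tonelli's theorem,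
  because the completed measure on a product is not the product of the completed measures.\<close>

lemma lebesgue_on_transfer:
  fixes f :: "'a::euclidean_space \<Rightarrow> real"
  assumes O: "\<Omega> \<in> sets borel" and f': "f' \<in> borel_measurable borel" "\<And>x. x \<notin> \<Omega> \<Longrightarrow> f' x = 0"
    and ae: "AE x in lborel. x \<in> \<Omega> \<longrightarrow> f x = f' x"
  shows "f \<in> borel_measurable (lebesgue_on \<Omega>)"
    and "integrable (lebesgue_on \<Omega>) f \<longleftrightarrow> integrable lborel f'"
    and "(LINT x|lebesgue_on \<Omega>. f x) = (LINT x|lborel. f' x)"
proof -
  have aeq: "AE x in lebesgue. f' x = indicator \<Omega> x *\<^sub>R f x"
    using ae unfolding AE_completion_iff by eventually_elim (use f'(2) in \<open>auto simp: indicator_def\<close>)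
  have f'm: "f' \<in> borel_measurable lebesgue" using f'(1) by (simp add: measurable_completion)
  have fm: "(\<lambda>x. indicator \<Omega> x *\<^sub>R f x) \<in> borel_measurable lebesgue"
    by (rule borel_measurable_AE[OF f'm aeq])
  show "f \<in> borel_measurable (lebesgue_on \<Omega>)"
    by (subst borel_measurable_restrict_space_iff) (use O fm in auto)
  have "integrable (lebesgue_on \<Omega>) f \<longleftrightarrow> integrable lebesgue (\<lambda>x. indicator \<Omega> x *\<^sub>R f x)"
    by (rule integrable_restrict_space) (use O in auto)
  also have "\<dots> \<longleftrightarrow> integrable lebesgue f'"
    by (rule integrable_cong_AE[OF fm f'm]) (use aeq in eventually_elim, auto)
  also have "\<dots> \<longleftrightarrow> integrable lborel f'" using f'(1) by (intro integrable_completion) auto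
  finally show "integrable (lebesgue_on \<Omega>) f \<longleftrightarrow> integrable lborel f'" .
  have "(LINT x|lebesgue_on \<Omega>. f x) = (LINT x|lebesgue. indicator \<Omega> x *\<^sub>R f x)"
    by (rule integral_restrict_space) (use O in auto)
  also have "\<dots> = (LINT x|lebesgue. f' x)"
    by (rule integral_cong_AE[OF fm f'm]) (use aeq in eventually_elim, auto)
  also have "\<dots> = (LINT x|lborel. f' x)" using f'(1) by (intro integral_completion) auto
  finally show "(LINT x|lebesgue_on \<Omega>. f x) = (LINT x|lborel. f' x)" .
qed

lemma AE_lborel_pairI:
  fixes P Q :: "'a::euclidean_space \<Rightarrow> bool"
  assumes P: "AE x in lborel. P x" and Q: "AE x in lborel. Q x"
  shows "AE z in (lborel :: ('a \<times> 'a) measure). P (fst z) \<and> Q (snd z)"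
proof -
  obtain N where N: "N \<in> null_sets lborel" "{x. \<not> P x} \<subseteq> N"
    using P unfolding eventually_ae_filter by auto
  obtain N' where N': "N' \<in> null_sets lborel" "{x. \<not> Q x} \<subseteq> N'"
    using Q unfolding eventually_ae_filter by auto
  have [measurable]: "N \<in> sets borel" "N' \<in> sets borel" using N N' by auto
  have "AE z in (lborel :: 'a measure) \<Otimes>\<^sub>M (lborel :: 'a measure). fst z \<notin> N \<and> snd z \<notin> N'"
  proof (rule lborel_pair.AE_pair_measure)
    show "{x \<in> space ((lborel :: 'a measure) \<Otimes>\<^sub>M (lborel :: 'a measure)). fst x \<notin> N \<and> snd x \<notin> N'} \<in> sets (lborel \<Otimes>\<^sub>M lborel)"
      by measurable
    have "AE x in lborel. x \<notin> N" "AE x in lborel. x \<notin> N'" using N N' by (auto intro: AE_not_in)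
    then show "AE x in lborel. AE y in lborel. fst (x, y) \<notin> N \<and> snd (x, y) \<notin> N'"
      by (auto elim!: eventually_mono)
  qed
  then have "AE z in (lborel :: ('a \<times> 'a) measure). fst z \<notin> N \<and> snd z \<notin> N'" unfolding lborel_prod .
  then show ?thesis by eventually_elim (use N N' in auto)
qed

lemma test_function_regularity:
  assumes \<phi>: "\<phi> \<in> test_functions \<Omega>"
  shows "\<phi> \<in> borel_measurable borel" "i \<in> Basis \<Longrightarrow> pd i \<phi> \<in> borel_measurable borel"
    "\<exists>M. \<forall>x. \<bar>\<phi> x\<bar> \<le> M" "i \<in> Basis \<Longrightarrow> \<exists>M. \<forall>x. \<bar>pd i \<phi> x\<bar> \<le> M"
proof -
  have Ck0: "Ck 0 \<phi>" and Ck1: "Ck (Suc 0) \<phi>" using \<phi> unfolding test_functions_def by blast+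
  then have c0: "continuous_on UNIV \<phi>" and c1: "i \<in> Basis \<Longrightarrow> continuous_on UNIV (pd i \<phi>)" for i
    by (auto simp: pd_def)
  let ?K = "closure {x. \<phi> x \<noteq> 0}"
  have K: "compact ?K" using \<phi> unfolding test_functions_def by auto
  show "\<phi> \<in> borel_measurable borel" "i \<in> Basis \<Longrightarrow> pd i \<phi> \<in> borel_measurable borel"
    by (rule borel_measurable_continuous_onI[OF c0], rule borel_measurable_continuous_onI[OF c1])
  have out: "\<phi> y = 0" if "y \<notin> ?K" for y using that closure_subset[of "{x. \<phi> x \<noteq> 0}"] by blast
  have out': "pd i \<phi> y = 0" if "y \<notin> ?K" for y i
  proof -
    have "((\<lambda>_. 0::real) has_derivative (\<lambda>_. 0)) (at y)" by simp
    then have "(\<phi> has_derivative (\<lambda>_. 0)) (at y)"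
    proof (rule has_derivative_transform_within_open[where s = "- ?K"])
      show "open (- ?K)" by (intro open_Compl closed_closure)
      show "y \<in> - ?K" using that by simp
      show "0 = \<phi> z" if "z \<in> - ?K" for z using out[of z] that by simp
    qed
    then show ?thesis by (rule pd_I)
  qed
  have bd: "\<exists>M. \<forall>x. \<bar>h x\<bar> \<le> M" if "continuous_on UNIV h" "\<And>y. y \<notin> ?K \<Longrightarrow> h y = (0::real)" for h
  proof -
    have "compact (h ` ?K)" by (intro compact_continuous_image continuous_on_subset[OF that(1)] K) auto
    then obtain M where M: "\<And>y. y \<in> ?K \<Longrightarrow> \<bar>h y\<bar> \<le> M" by (metis bounded_iff compact_imp_bounded imageI real_norm_def)
    have "\<bar>h y\<bar> \<le> max M 0" for y using M[of y] that(2)[of y] by (cases "y \<in> ?K") auto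
    then show ?thesis by blast
  qed
  show "\<exists>M. \<forall>x. \<bar>\<phi> x\<bar> \<le> M" by (rule bd[OF c0 out])
  show "i \<in> Basis \<Longrightarrow> \<exists>M. \<forall>x. \<bar>pd i \<phi> x\<bar> \<le> M" by (rule bd[OF c1 out'])
qed

lemma integrable_bounded_scaleR:
  fixes v :: "'a \<Rightarrow> 'b::euclidean_space" and \<phi> :: "'a \<Rightarrow> real"
  assumes v: "integrable M v" and [measurable]: "\<phi> \<in> borel_measurable M" and b: "\<exists>B. \<forall>x. \<bar>\<phi> x\<bar> \<le> B"
  shows "integrable M (\<lambda>x. \<phi> x *\<^sub>R v x)"
proof -
  obtain B where B: "\<And>x. \<bar>\<phi> x\<bar> \<le> B" using b by blast
  have [measurable]: "v \<in> borel_measurable M" using v by auto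
  show ?thesis
  proof (rule Bochner_Integration.integrable_bound)
    show "integrable M (\<lambda>x. B * norm (v x))" using v by simp
    show "AE x in M. norm (\<phi> x *\<^sub>R v x) \<le> norm (B * norm (v x))"
    proof (rule AE_I2)
      fix x
      have "\<bar>\<phi> x\<bar> * norm (v x) \<le> B * norm (v x)" by (intro mult_right_mono B) auto
      then show "norm (\<phi> x *\<^sub>R v x) \<le> norm (B * norm (v x))" by simp
    qed
  qed measurable
qed

lemma integrable_mult_bounded_real:
  fixes v \<phi> :: "'a \<Rightarrow> real"
  assumes "integrable M v" "\<phi> \<in> borel_measurable M" "\<exists>B. \<forall>x. \<bar>\<phi> x\<bar> \<le> B"
  shows "integrable M (\<lambda>x. v x * \<phi> x)"
  using integrable_bounded_scaleR[OF assms] by (simp add: mult.commute)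

text \<open>The fundamental lemma of the calculus of variations, tested only with dilates of \<open>rho\<close>: all small
  averages vanish, and they converge to a multiple of $v$.\<close>

lemma weak_zero_AE:
  fixes v :: "'a::euclidean_space \<Rightarrow> real"
  assumes v: "integrable lborel v" "\<And>x. x \<notin> ball 0 N \<Longrightarrow> v x = 0" and r: "r > 0"
    and zero: "\<And>x t. x \<in> V \<Longrightarrow> 0 < t \<Longrightarrow> t < r \<Longrightarrow> (LINT y|lborel. v y * dilate x t rho y) = 0"
  shows "AE x in lborel. x \<in> V \<longrightarrow> v x = 0"
proof -
  obtain s where s: "\<And>n::nat. s n > (0::real)" "s \<longlonglongrightarrow> 0"
    "AE x in lborel. (\<lambda>n. mollified v x (s n)) \<longlonglongrightarrow> rho_mass TYPE('a) * v x"
    using mollified_AE_subsequence[where v = v and N = N, OF v] by blast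
  have ev: "\<forall>\<^sub>F n in sequentially. s n < r" using s(2) r by (rule order_tendstoD)
  show ?thesis
    using s(3)
  proof eventually_elim
    case (elim x)
    show ?case
    proof
      assume x: "x \<in> V"
      have "\<forall>\<^sub>F n in sequentially. 0 = mollified v x (s n)"
        using ev
      proof eventually_elim
        case (elim n)
        have "(LINT y|lborel. v y * dilate x (s n) rho y / s n ^ DIM('a)) = 0"
          using zero[OF x s(1) elim] by simp
        then show ?case by (simp add: mollified_def)
      qed
      then have "(\<lambda>n. mollified v x (s n)) \<longlonglongrightarrow> 0" by (rule Lim_transform_eventually[OF tendsto_const])
      with elim have "rho_mass TYPE('a) * v x = 0" using LIMSEQ_unique by blast
      then show "v x = 0" using rho_mass_pos[where 'a='a] by simp
    qed
  qed
qed

lemma closed_inner_set: "closed {x. ball x r \<subseteq> \<Omega>}"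
proof -
  have "- {x. ball x r \<subseteq> \<Omega>} = (\<Union>z\<in>- \<Omega>. ball z r)"
    by (auto simp: dist_commute)
  then have "open (- {x. ball x r \<subseteq> \<Omega>})" by (metis open_UN open_ball)
  then show ?thesis by (simp add: closed_def)
qed

text \<open>The two candidates are only locally integrable. Cut them off to the compact set of points at
  distance at least $r$ from the complement, apply the previous lemma, and let $r$ run through a
  sequence tending to zero.\<close>

proposition weak_partial_unique:
  fixes u v1 v2 :: "'a::euclidean_space \<Rightarrow> real"
  assumes O: "open \<Omega>" "bounded \<Omega>" and w1: "weak_partial \<Omega> i u v1" and w2: "weak_partial \<Omega> i u v2"
  shows "AE x in lborel. x \<in> \<Omega> \<longrightarrow> v1 x = v2 x"
proof -
  have Ob: "\<Omega> \<in> sets borel" using O by auto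
  have step: "AE x in lborel. cball x (2 * r) \<subseteq> \<Omega> \<longrightarrow> v1 x = v2 x" if r: "r > 0" for r
  proof -
    \<comment> \<open>Open balls in the definition make $K$ closed; dilates of radius less than $r$ around the points
      considered are supported in $K$.\<close>
    define K where "K = {x. ball x r \<subseteq> \<Omega>}"
    have KO: "K \<subseteq> \<Omega>" using r by (auto simp: K_def subset_iff)
    have Kc: "compact K" unfolding compact_eq_bounded_closed
      using closed_inner_set[of r \<Omega>] bounded_subset[OF O(2) KO] by (auto simp: K_def)
    have Kb: "K \<in> sets borel" using Kc by (simp add: compact_imp_closed)
    have int: "integrable lebesgue (\<lambda>x. indicator K x *\<^sub>R v1 x)" "integrable lebesgue (\<lambda>x. indicator K x *\<^sub>R v2 x)"
      using w1 w2 Kc KO unfolding weak_partial_def L1_loc_def set_integrable_def by auto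
    define v where "v x = indicator K x *\<^sub>R v1 x - indicator K x *\<^sub>R v2 x" for x
    have vi: "integrable lebesgue v" unfolding v_def by (intro Bochner_Integration.integrable_diff int)
    then have "v \<in> borel_measurable lebesgue" by auto
    then obtain h where h: "h \<in> borel_measurable lborel" "AE x in lborel. v x = h x"
      using completion_ex_borel_measurable_real by blast
    define v' where "v' x = indicator K x * h x" for x
    note [measurable] = Kb
    have v'm [measurable]: "v' \<in> borel_measurable borel" unfolding v'_def using h(1) by measurable
    have vv': "AE x in lebesgue. v x = v' x"
      unfolding AE_completion_iff using h(2) by eventually_elim (auto simp: v'_def v_def indicator_def)
    have v'ml: "v' \<in> borel_measurable lebesgue" by (simp add: measurable_completion)
    have v'i: "integrable lborel v'"
      using integrable_cong_AE[of v lebesgue v'] vi vv' v'ml integrable_completion[of v' lborel] by auto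
    obtain N where "\<Omega> \<subseteq> ball 0 N" using bounded_subset_ballD[OF O(2), of 0] by blast
    then have N: "\<And>x. x \<notin> ball 0 N \<Longrightarrow> v' x = 0" using KO by (auto simp: v'_def indicator_def)
    have "AE x in lborel. x \<in> {x. cball x (2 * r) \<subseteq> \<Omega>} \<longrightarrow> v' x = 0"
    proof (rule weak_zero_AE[where v = v' and N = N, OF v'i N r])
      fix x t assume x: "x \<in> {x. cball x (2 * r) \<subseteq> \<Omega>}" and t: "0 < t" "t < r"
      let ?\<phi> = "dilate x t rho"
      have sub: "cball x t \<subseteq> K"
      proof
        fix y assume y: "y \<in> cball x t"
        have "ball y r \<subseteq> cball x (2 * r)"
        proof
          fix p assume "p \<in> ball y r"
          then show "p \<in> cball x (2 * r)" using y t dist_triangle[of x p y] by simp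
        qed
        then show "y \<in> K" using x by (auto simp: K_def)
      qed
      have test: "?\<phi> \<in> test_functions \<Omega>"
        by (rule dilate_test_function[OF rho_bump t(1)]) (use sub KO in blast)
      have out: "?\<phi> y = 0" if "y \<notin> K" for y
        by (rule dilate_outside[OF rho_bump t(1)]) (use that sub ball_subset_cball[of x t] in blast)
      have \<phi>m: "?\<phi> \<in> borel_measurable lebesgue" by (intro measurable_completion) measurable
      have conv: "(LINT y|lebesgue_on \<Omega>. ?\<phi> y *\<^sub>R w y) = (LINT y|lebesgue. (indicator K y *\<^sub>R w y) * ?\<phi> y)" for w :: "'a \<Rightarrow> real"
      proof -
        have "(LINT y|lebesgue_on \<Omega>. ?\<phi> y *\<^sub>R w y) = (LINT y|lebesgue. indicator \<Omega> y *\<^sub>R (?\<phi> y *\<^sub>R w y))"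
          using Ob by (intro integral_restrict_space) auto
        also have "\<dots> = (LINT y|lebesgue. (indicator K y *\<^sub>R w y) * ?\<phi> y)"
          using KO out by (intro Bochner_Integration.integral_cong) (auto simp: indicator_def)
        finally show ?thesis .
      qed
      have bd: "\<exists>B. \<forall>y. \<bar>?\<phi> y\<bar> \<le> B" by (rule test_function_regularity(3)[OF test])
      have "(LINT y|lebesgue_on \<Omega>. ?\<phi> y *\<^sub>R v1 y) = (LINT y|lebesgue_on \<Omega>. ?\<phi> y *\<^sub>R v2 y)"
        using w1 w2 test unfolding weak_partial_def by (metis neg_equal_iff_equal)
      then have "0 = (LINT y|lebesgue. (indicator K y *\<^sub>R v1 y) * ?\<phi> y) - (LINT y|lebesgue. (indicator K y *\<^sub>R v2 y) * ?\<phi> y)"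
        unfolding conv by simp
      also have "\<dots> = (LINT y|lebesgue. (indicator K y *\<^sub>R v1 y) * ?\<phi> y - (indicator K y *\<^sub>R v2 y) * ?\<phi> y)"
        by (rule Bochner_Integration.integral_diff[symmetric]) (intro integrable_mult_bounded_real int \<phi>m bd)+
      also have "\<dots> = (LINT y|lebesgue. v y * ?\<phi> y)" by (simp add: v_def left_diff_distrib)
      also have "\<dots> = (LINT y|lebesgue. v' y * ?\<phi> y)"
      proof (rule integral_cong_AE)
        show "(\<lambda>y. v y * ?\<phi> y) \<in> borel_measurable lebesgue" using vi \<phi>m by auto
        show "(\<lambda>y. v' y * ?\<phi> y) \<in> borel_measurable lebesgue" using v'ml \<phi>m by auto
        show "AE y in lebesgue. v y * ?\<phi> y = v' y * ?\<phi> y" using vv' by eventually_elim auto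
      qed
      also have "\<dots> = (LINT y|lborel. v' y * ?\<phi> y)" by (rule integral_completion) measurable
      finally show "(LINT y|lborel. v' y * ?\<phi> y) = 0" by simp
    qed
    moreover have "AE x in lborel. v x = v' x" using vv' unfolding AE_completion_iff .
    ultimately show ?thesis
    proof eventually_elim
      case (elim x)
      show ?case
      proof
        assume x: "cball x (2 * r) \<subseteq> \<Omega>"
        have "ball x r \<subseteq> cball x (2 * r)" using r by auto
        then have "x \<in> K" using x unfolding K_def by blast
        then show "v1 x = v2 x" using elim x by (simp add: v_def)
      qed
    qed
  qed
  have "AE x in lborel. \<forall>n::nat. cball x (2 * (1 / real (Suc n))) \<subseteq> \<Omega> \<longrightarrow> v1 x = v2 x"
    unfolding AE_all_countable by (intro allI step) simp
  then show ?thesis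
  proof eventually_elim
    case (elim x)
    show ?case
    proof
      assume "x \<in> \<Omega>"
      then obtain e where e: "e > 0" "cball x e \<subseteq> \<Omega>" using O(1) open_contains_cball by blast
      obtain n where n: "1 / real (Suc n) < e / 2" using nat_approx_posE[of "e / 2"] e(1) by auto
      have "cball x (2 * (1 / real (Suc n))) \<subseteq> cball x e" using n by (intro subset_cball) simp
      then show "v1 x = v2 x" using elim e(2) by blast
    qed
  qed
qed

text \<open>The integral of the translated bump does not depend on the translation; differentiate it.\<close>

lemma integral_dilate_pd_zero:
  fixes k :: "'a::euclidean_space \<Rightarrow> real"
  assumes k: "k \<in> bumps" and t: "t > 0"
  shows "(LINT y|lborel. dilate x t (pd j k) y) = 0"
proof -
  obtain M where M: "M \<ge> 0" "\<And>z. \<bar>pd j k z\<bar> \<le> M" using bumps_bounded[OF bumps_deriv(2)[OF k]] by blast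
  \<comment> \<open>This ball contains the supports of all translates by \<open>s *\<^sub>R j\<close> with \<open>s\<close> between -1 and 1, so that
    its indicator can serve as the dominating integrable function.\<close>
  let ?B = "ball x (t + norm j)"
  let ?k = "\<lambda>s y. dilate (x - s *\<^sub>R j) t k y"
  let ?k' = "\<lambda>s y. (1 / t) * dilate (x - s *\<^sub>R j) t (pd j k) y"
  note [measurable] = bumps_measurable[OF k] bumps_measurable[OF bumps_deriv(2)[OF k, of j]]
  have iB: "integrable lborel (indicator ?B :: 'a \<Rightarrow> real)"
    by (intro integrable_real_indicator) (auto simp: emeasure_ball_finite)
  have sub: "ball (x - s *\<^sub>R j) t \<subseteq> ?B" if "-1 < s" "s < 1" for s
  proof
    fix p assume p: "p \<in> ball (x - s *\<^sub>R j) t"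
    have "norm (s *\<^sub>R j) \<le> 1 * norm j" unfolding norm_scaleR using that by (intro mult_right_mono) auto
    then have "dist x (x - s *\<^sub>R j) \<le> norm j" by (simp add: dist_norm)
    then show "p \<in> ?B" using p dist_triangle[of x p "x - s *\<^sub>R j"] by simp
  qed
  have eq: "indicator ?B y * dilate (x - s *\<^sub>R j) t f y = dilate (x - s *\<^sub>R j) t f y" if "-1 < s" "s < 1" "f \<in> bumps" for s y f
  proof (cases "y \<in> ?B")
    case False
    then have "y \<notin> ball (x - s *\<^sub>R j) t" using sub[OF that(1,2)] by blast
    then show ?thesis using dilate_outside[OF that(3) t] by simp
  qed simp
  have "((\<lambda>s. LINT y|lborel. indicator ?B y * ?k s y) has_real_derivative (LINT y|lborel. indicator ?B y * ?k' 0 y)) (at 0)"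
  proof (rule has_real_derivative_integral[OF iB, where a = "-1" and b = 1 and B = "M / t"])
    fix s y :: real and z :: 'a
    have "((\<lambda>s. (1 / t) *\<^sub>R (z - (x - s *\<^sub>R j))) has_derivative (\<lambda>h. (h / t) *\<^sub>R j)) (at s)"
      using t by (auto intro!: derivative_eq_intros simp: field_simps)
    from has_derivative_compose[OF this bumps_has_derivative[OF k]]
    have "((\<lambda>s. ?k s z) has_derivative (\<lambda>h. (h / t) * dilate (x - s *\<^sub>R j) t (pd j k) z)) (at s)"
      by (simp add: dilate_def linear_cmul[OF pd_linear[OF k]])
    then show "((\<lambda>s. ?k s z) has_real_derivative ?k' s z) (at s)"
      unfolding has_field_derivative_def by (rule has_derivative_eq_rhs) (auto simp: fun_eq_iff)
    show "\<bar>?k' s z\<bar> \<le> M / t"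
      using t M by (simp add: abs_mult dilate_def divide_right_mono)
    show "integrable lborel (\<lambda>y. indicator ?B y * ?k s y)"
      by (intro integrable_mult_dilate iB k)
  qed (auto)
  moreover have const: "(LINT y|lborel. indicator ?B y * ?k s y) = (LINT y|lborel. dilate x t k y)" if s: "-1 < s" "s < 1" for s
  proof -
    have "(LINT y|lborel. indicator ?B y * ?k s y) = (LINT y|lborel. dilate x t k (s *\<^sub>R j + y))"
      unfolding eq[OF s k] by (simp add: dilate_def algebra_simps)
    also have "\<dots> = (LINT y|distr lborel borel ((+) (s *\<^sub>R j)). dilate x t k y)"
      by (subst integral_distr) auto
    also have "distr lborel borel ((+) (s *\<^sub>R j)) = lborel" by (rule lborel_distr_plus)
    finally show ?thesis .
  qed
  have "((\<lambda>s. LINT y|lborel. indicator ?B y * ?k s y) has_real_derivative 0) (at 0)"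
  proof (rule has_field_derivative_transform_within_open)
    show "((\<lambda>s::real. LINT y|lborel. dilate x t k y) has_real_derivative 0) (at 0)" by (rule DERIV_const)
    show "(0::real) \<in> {-1<..<1}" "open {-1<..<1::real}" by auto
    show "(LINT y|lborel. dilate x t k y) = (LINT y|lborel. indicator ?B y * ?k s y)" if "s \<in> {-1<..<1}" for s
      using const[of s] that by simp
  qed
  ultimately have "(LINT y|lborel. indicator ?B y * ?k' 0 y) = 0" by (rule DERIV_unique)
  moreover have "indicator ?B y * ?k' 0 y = (1 / t) * dilate x t (pd j k) y" for y
    using eq[of 0 "pd j k" y] bumps_deriv(2)[OF k, of j] by (simp add: mult.left_commute[of "indicator ?B y"])
  ultimately have "(LINT y|lborel. (1 / t) * dilate x t (pd j k) y) = 0" by (simp only:)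
  then show ?thesis using t by simp
qed

section \<open>The equation frozen at a point\<close>

text \<open>As $w$ is a gradient, $w_i \partial_j \partial_j \psi$ and $w_j \partial_j \partial_i \psi$ have the same
  integral, so the Laplacian tested with $w_i$ becomes $w$ tested with $\nabla \partial_i \psi$, to which
  the equation applies. The constants \<open>F0\<close> may be subtracted because derivatives of bumps integrate
  to zero; they are multiplied by the indicator of the domain to stay integrable.\<close>

lemma frozen_equation:
  fixes u a :: "'a::euclidean_space \<Rightarrow> real" and w F :: "'a \<Rightarrow> 'a \<Rightarrow> real"
  assumes O: "\<Omega> \<in> sets borel" "bounded \<Omega>"
    and w: "\<And>j. j \<in> Basis \<Longrightarrow> integrable lborel (w j)"
    and F: "\<And>j. j \<in> Basis \<Longrightarrow> integrable lborel (F j)"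
    and a: "a \<in> borel_measurable borel" "\<And>x. \<bar>a x\<bar> \<le> A0"
    and weak: "\<And>j \<phi>. j \<in> Basis \<Longrightarrow> \<phi> \<in> test_functions \<Omega> \<Longrightarrow> (LINT y|lborel. u y * pd j \<phi> y) = - (LINT y|lborel. w j y * \<phi> y)"
    and eqn: "\<And>\<phi>. \<phi> \<in> test_functions \<Omega> \<Longrightarrow> (\<Sum>j\<in>Basis. LINT y|lborel. a y * w j y * pd j \<phi> y) = - (\<Sum>j\<in>Basis. LINT y|lborel. F j y * pd j \<phi> y)"
    and i: "i \<in> Basis" and t: "t > 0" and z: "cball z t \<subseteq> \<Omega>" and a0: "a0 \<noteq> 0"
  shows "(LINT y|lborel. w i y * dilate z t lap_psi y)
    = - (1 / a0) * (\<Sum>j\<in>Basis. LINT y|lborel. ((F j y - F0 j * indicator \<Omega> y) + (a y - a0) * w j y) * dilate z t (pd j (pd i psi)) y)"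
proof -
  have pb: "pd j psi \<in> bumps" "pd j (pd l psi) \<in> bumps" for j l :: 'a
    by (intro bumps_deriv psi_bump)+
  let ?\<chi> = "\<lambda>j. dilate z t (pd j (pd i psi))"
  note [measurable] = O(1) a(1)
  have swap: "(LINT y|lborel. w i y * dilate z t (pd j (pd j psi)) y) = (LINT y|lborel. w j y * ?\<chi> j y)" if j: "j \<in> Basis" for j
  proof -
    have "- t * (LINT y|lborel. w i y * dilate z t (pd j (pd j psi)) y) = (LINT y|lborel. u y * dilate z t (pd i (pd j (pd j psi))) y)"
      by (rule weak_derivative_dilate[symmetric, OF weak[OF i] pb(2) t z])
    also have "pd i (pd j (pd j psi)) = pd j (pd j (pd i psi))"
      by (simp add: pd_commute[OF pb(1), of i j] pd_commute[OF psi_bump, of i j])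
    also have "(LINT y|lborel. u y * dilate z t (pd j (pd j (pd i psi))) y) = - t * (LINT y|lborel. w j y * ?\<chi> j y)"
      by (rule weak_derivative_dilate[OF weak[OF j] pb(2) t z])
    finally show ?thesis using t by simp
  qed
  have lap: "(LINT y|lborel. w i y * dilate z t lap_psi y) = (\<Sum>j\<in>Basis. LINT y|lborel. w j y * ?\<chi> j y)"
    unfolding lap_psi_integral[OF w[OF i] t] by (intro sum.cong refl swap)
  have test: "dilate z t (pd i psi) \<in> test_functions \<Omega>"
    by (rule dilate_test_function[OF pb(1) t z])
  have "(\<Sum>j\<in>Basis. LINT y|lborel. a y * w j y * ((1 / t) * ?\<chi> j y)) = - (\<Sum>j\<in>Basis. LINT y|lborel. F j y * ((1 / t) * ?\<chi> j y))"
    using eqn[OF test] unfolding pd_dilate[OF pb(1)] .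
  then have "(1 / t) * (\<Sum>j\<in>Basis. LINT y|lborel. a y * w j y * ?\<chi> j y) = (1 / t) * (- (\<Sum>j\<in>Basis. LINT y|lborel. F j y * ?\<chi> j y))"
    by (simp add: sum_divide_distrib)
  then have e: "(\<Sum>j\<in>Basis. LINT y|lborel. a y * w j y * ?\<chi> j y) = - (\<Sum>j\<in>Basis. LINT y|lborel. F j y * ?\<chi> j y)"
    using t by (subst (asm) mult_cancel_left) auto
  have "(LINT y|lborel. ((F j y - F0 j * indicator \<Omega> y) + (a y - a0) * w j y) * ?\<chi> j y)
     = (LINT y|lborel. F j y * ?\<chi> j y) + (LINT y|lborel. a y * w j y * ?\<chi> j y) - a0 * (LINT y|lborel. w j y * ?\<chi> j y)"
    if j: "j \<in> Basis" for j
  proof -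
    have iO: "integrable lborel (indicator \<Omega> :: 'a \<Rightarrow> real)"
      using emeasure_bounded_finite[OF O(2)] O(1) by (intro integrable_real_indicator) auto
    have aw: "integrable lborel (\<lambda>y. a y * w j y)"
      unfolding mult.commute[of "a _"]
      by (rule integrable_mult_bounded_real[OF w[OF j]]) (use a in auto)
    note 1 = integrable_mult_dilate[OF F[OF j] pb(2)[of j i], of z t]
    note 2 = integrable_mult_right[OF integrable_mult_dilate[OF iO pb(2)[of j i], of z t], of "F0 j"]
    note 3 = integrable_mult_dilate[OF aw pb(2)[of j i], of z t]
    note 4 = integrable_mult_right[OF integrable_mult_dilate[OF w[OF j] pb(2)[of j i], of z t], of a0]
    have out: "indicator \<Omega> y * ?\<chi> j y = ?\<chi> j y" for y
    proof (cases "y \<in> \<Omega>")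
      case False
      then have "y \<notin> ball z t" using z ball_subset_cball by blast
      then show ?thesis using dilate_outside[OF pb(2) t] by simp
    qed simp
    have zero: "(LINT y|lborel. indicator \<Omega> y * ?\<chi> j y) = 0"
      unfolding out by (rule integral_dilate_pd_zero[OF pb(1) t])
    have "(LINT y|lborel. ((F j y - F0 j * indicator \<Omega> y) + (a y - a0) * w j y) * ?\<chi> j y)
      = (LINT y|lborel. (F j y * ?\<chi> j y - F0 j * (indicator \<Omega> y * ?\<chi> j y)) + (a y * w j y * ?\<chi> j y - a0 * (w j y * ?\<chi> j y)))"
      by (intro Bochner_Integration.integral_cong refl) (simp add: algebra_simps)
    also have "\<dots> = (LINT y|lborel. F j y * ?\<chi> j y - F0 j * (indicator \<Omega> y * ?\<chi> j y)) + (LINT y|lborel. a y * w j y * ?\<chi> j y - a0 * (w j y * ?\<chi> j y))"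
      by (rule Bochner_Integration.integral_add[OF Bochner_Integration.integrable_diff[OF 1 2] Bochner_Integration.integrable_diff[OF 3 4]])
    also have "\<dots> = (LINT y|lborel. F j y * ?\<chi> j y) + (LINT y|lborel. a y * w j y * ?\<chi> j y) - a0 * (LINT y|lborel. w j y * ?\<chi> j y)"
      unfolding Bochner_Integration.integral_diff[OF 1 2] Bochner_Integration.integral_diff[OF 3 4] by (simp add: zero)
    finally show ?thesis .
  qed
  then have "(\<Sum>j\<in>Basis. LINT y|lborel. ((F j y - F0 j * indicator \<Omega> y) + (a y - a0) * w j y) * ?\<chi> j y)
     = (\<Sum>j\<in>Basis. (LINT y|lborel. F j y * ?\<chi> j y) + (LINT y|lborel. a y * w j y * ?\<chi> j y) - a0 * (LINT y|lborel. w j y * ?\<chi> j y))"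
    by (rule sum.cong[OF refl])
  also have "\<dots> = - a0 * (\<Sum>j\<in>Basis. LINT y|lborel. w j y * ?\<chi> j y)"
    using e by (simp add: sum.distrib sum_subtractf sum_distrib_left sum_negf)
  finally show ?thesis unfolding lap using a0 by simp
qed

text \<open>The geometric mean of the two bounds on \<open>m\<close>. This is where smoothness of the coefficient is traded
  for integrability of $g^{\beta/\alpha}$.\<close>

lemma interpolated_oscillation:
  fixes m A g r :: real
  assumes m: "0 \<le> m" "m \<le> A" "m \<le> g * r powr \<alpha>" and g: "g \<ge> 0" and \<alpha>: "0 < \<beta>" "\<beta> < \<alpha>"
  shows "m \<le> A powr (1 - \<beta> / \<alpha>) * (g powr (\<beta> / \<alpha>) * r powr \<beta>)"
proof (cases "m = 0")
  case False
  have k: "0 < \<beta> / \<alpha>" "\<beta> / \<alpha> < 1" using \<alpha> by auto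
  have "m = m powr (1 - \<beta> / \<alpha>) * m powr (\<beta> / \<alpha>)" using False m by (simp add: powr_add[symmetric])
  also have "\<dots> \<le> A powr (1 - \<beta> / \<alpha>) * (g * r powr \<alpha>) powr (\<beta> / \<alpha>)"
    using m k by (intro mult_mono powr_mono2) auto
  also have "(g * r powr \<alpha>) powr (\<beta> / \<alpha>) = g powr (\<beta> / \<alpha>) * r powr \<beta>"
    using g \<alpha> by (simp add: powr_mult powr_powr)
  finally show ?thesis .
qed (use g in auto)

text \<open>The weight in the pointwise Hoelder bound for the gradient: the oscillation of the datum plus the
  product of a power of \<open>g\<close> with a Riesz potential of the gradient. Infinite values are sent to $0$;
  they occur on a null set only.\<close>

definition holder_weight ::
  "real \<Rightarrow> real \<Rightarrow> real \<Rightarrow> real \<Rightarrow> ('a::euclidean_space \<Rightarrow> 'a \<Rightarrow> real) \<Rightarrow> ('a \<Rightarrow> 'a \<Rightarrow> real) \<Rightarrow> ('a \<Rightarrow> real) \<Rightarrow> 'a \<Rightarrow> real" where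
  "holder_weight \<alpha> \<beta> \<gamma> r F w g x =
     (\<Sum>j\<in>Basis. enn2real (oscillation \<gamma> r (F j) x) + \<bar>g x\<bar> powr (\<beta> / \<alpha>) * enn2real (riesz (\<beta> - \<gamma>) r (\<lambda>y. ennreal \<bar>w j y\<bar>) x))"

text \<open>For almost every $x$ in \<open>U\<close> the equation frozen at $x$ gives \<^const>\<open>scale_bounds\<close> with a multiple of
  the weight at $x$.\<close>

proposition weak_gradient_pointwise_holder:
  fixes u a g :: "'a::euclidean_space \<Rightarrow> real" and w F :: "'a \<Rightarrow> 'a \<Rightarrow> real"
  assumes O: "\<Omega> \<in> sets borel" "bounded \<Omega>"
    and w: "\<And>j. j \<in> Basis \<Longrightarrow> integrable lborel (w j)" "\<And>j x. j \<in> Basis \<Longrightarrow> x \<notin> \<Omega> \<Longrightarrow> w j x = 0"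
      "\<And>j. j \<in> Basis \<Longrightarrow> (\<integral>\<^sup>+x. (ennreal \<bar>w j x\<bar>)\<^sup>2 \<partial>lborel) < top"
    and F: "\<And>j. j \<in> Basis \<Longrightarrow> integrable lborel (F j)"
    and a: "a \<in> borel_measurable borel" "\<And>x. \<bar>a x\<bar> \<le> A0"
    and low: "a_low > 0" "AE x in lborel. x \<in> \<Omega> \<longrightarrow> a_low \<le> a x"
    and hol: "AE x in lborel. AE y in lborel. x \<in> \<Omega> \<longrightarrow> y \<in> \<Omega> \<longrightarrow> \<bar>a x - a y\<bar> \<le> \<bar>g x\<bar> * norm (x - y) powr \<alpha>"
    and weak: "\<And>j \<phi>. j \<in> Basis \<Longrightarrow> \<phi> \<in> test_functions \<Omega> \<Longrightarrow> (LINT y|lborel. u y * pd j \<phi> y) = - (LINT y|lborel. w j y * \<phi> y)"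
    and eqn: "\<And>\<phi>. \<phi> \<in> test_functions \<Omega> \<Longrightarrow> (\<Sum>j\<in>Basis. LINT y|lborel. a y * w j y * pd j \<phi> y) = - (\<Sum>j\<in>Basis. LINT y|lborel. F j y * pd j \<phi> y)"
    and U: "U \<in> sets borel" "\<And>x. x \<in> U \<Longrightarrow> cball x (2 * R) \<subseteq> \<Omega>" and R: "R > 0"
    and exps: "0 < \<gamma>" "\<gamma> < \<beta>" "\<beta> < \<alpha>" "\<alpha> \<le> 1"
    and osc: "\<And>j. j \<in> Basis \<Longrightarrow> (\<integral>\<^sup>+x. indicator U x * (oscillation \<gamma> (2 * R) (F j) x)\<^sup>2 \<partial>lborel) < top"
    and i: "i \<in> Basis"
  obtains S C where "AE x in lborel. x \<in> S" "C \<ge> 0"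
    "\<And>x y. x \<in> S \<Longrightarrow> x \<in> U \<Longrightarrow> y \<in> S \<Longrightarrow> y \<in> U \<Longrightarrow> norm (x - y) \<le> R \<Longrightarrow>
      \<bar>w i x - w i y\<bar> \<le> C * (holder_weight \<alpha> \<beta> \<gamma> (2 * R) F w g x + holder_weight \<alpha> \<beta> \<gamma> (2 * R) F w g y + 1) * norm (x - y) powr \<gamma>"
proof -
  let ?d = "real DIM('a)"
  let ?W = "holder_weight \<alpha> \<beta> \<gamma> (2 * R) F w g"
  let ?osc = "\<lambda>j. oscillation \<gamma> (2 * R) (F j)"
  let ?rz = "\<lambda>j. riesz (\<beta> - \<gamma>) (2 * R) (\<lambda>y. ennreal \<bar>w j y\<bar>)"
  note [measurable] = O(1) a(1) U(1)
  have wm: "w j \<in> borel_measurable borel" and Fm: "F j \<in> borel_measurable borel" if "j \<in> Basis" for j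
    using w(1)[OF that] F[OF that] by auto
  obtain N where "\<Omega> \<subseteq> ball 0 N" using bounded_subset_ballD[OF O(2), of 0] by blast
  then have N: "w i x = 0" if "x \<notin> ball 0 N" for x using w(2)[OF i] that by blast
  have g1: "0 < \<gamma>" "\<gamma> < 1" using exps by auto
  obtain S0 C0 where S0: "AE x in lborel. x \<in> S0" and C0: "C0 \<ge> 0"
    "\<And>x y A B. x \<in> S0 \<Longrightarrow> y \<in> S0 \<Longrightarrow> scale_bounds (w i) \<gamma> R x A \<Longrightarrow> scale_bounds (w i) \<gamma> R y B \<Longrightarrow> norm (x - y) \<le> R \<Longrightarrow>
      \<bar>w i x - w i y\<bar> \<le> C0 * (A + B + 1) * norm (x - y) powr \<gamma>"
    using AE_holder_of_scale_bounds[where v = "w i" and N = N, OF w(1)[OF i] N g1 R] by blast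
  have rzfin: "AE x in lborel. \<forall>j\<in>Basis. ?rz j x < top"
  proof (rule AE_finite_allI)
    fix j :: 'a assume j: "j \<in> Basis"
    have [measurable]: "w j \<in> borel_measurable borel" by (rule wm[OF j])
    have "AE x in lborel. (?rz j x)\<^sup>2 \<noteq> \<infinity>"
    proof (rule nn_integral_PInf_AE)
      show "(\<integral>\<^sup>+x. (?rz j x)\<^sup>2 \<partial>lborel) \<noteq> \<infinity>"
        using riesz_L2[of "\<lambda>y. ennreal \<bar>w j y\<bar>" "\<beta> - \<gamma>" "2 * R"] w(3)[OF j] exps R by auto
    qed measurable
    then show "AE x in lborel. ?rz j x < top"
      by eventually_elim (auto simp: less_top power2_eq_square ennreal_mult_eq_top_iff)
  qed simp
  have oscfin: "AE x in lborel. \<forall>j\<in>Basis. x \<in> U \<longrightarrow> ?osc j x < top"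
  proof (rule AE_finite_allI)
    fix j :: 'a assume j: "j \<in> Basis"
    have [measurable]: "F j \<in> borel_measurable borel" by (rule Fm[OF j])
    have "AE x in lborel. indicator U x * (?osc j x)\<^sup>2 \<noteq> \<infinity>"
    proof (rule nn_integral_PInf_AE)
      show "(\<integral>\<^sup>+x. indicator U x * (?osc j x)\<^sup>2 \<partial>lborel) \<noteq> \<infinity>"
        using osc[OF j] by auto
    qed measurable
    then show "AE x in lborel. x \<in> U \<longrightarrow> ?osc j x < top"
      by eventually_elim (auto simp: less_top power2_eq_square ennreal_mult_eq_top_iff)
  qed simp
  define S where "S = {x \<in> S0. (\<forall>j\<in>Basis. ?rz j x < top) \<and> (\<forall>j\<in>Basis. x \<in> U \<longrightarrow> ?osc j x < top)
     \<and> (x \<in> \<Omega> \<longrightarrow> a_low \<le> a x) \<and> (AE y in lborel. x \<in> \<Omega> \<longrightarrow> y \<in> \<Omega> \<longrightarrow> \<bar>a x - a y\<bar> \<le> \<bar>g x\<bar> * norm (x - y) powr \<alpha>)}"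
  have S: "AE x in lborel. x \<in> S"
    using S0 rzfin oscfin low(2) hol by eventually_elim (simp add: S_def)
  obtain M where M: "M \<ge> 0" "\<And>j z. j \<in> Basis \<Longrightarrow> \<bar>pd j (pd i psi) (z::'a)\<bar> \<le> M"
    "\<And>j z w. j \<in> Basis \<Longrightarrow> \<bar>pd j (pd i psi) (z::'a) - pd j (pd i psi) w\<bar> \<le> M * norm (z - w)"
    using finite_bumps_uniform[where J = "Basis::'a set" and k = "\<lambda>j. pd j (pd i psi)"]
      bumps_deriv(2)[OF bumps_deriv(2)[OF psi_bump]] by (metis finite_Basis)
  define Ca where "Ca = (2 * A0) powr (1 - \<beta> / \<alpha>)"
  have Ca: "Ca \<ge> 0" by (simp add: Ca_def)
  define D where "D = (1 / a_low) * real (card (Basis::'a set)) * M * 2 ^ (DIM('a) + 1)"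
  have D: "D \<ge> 0" unfolding D_def using M low(1) by simp
  have W0: "?W x \<ge> 0" for x unfolding holder_weight_def by (intro sum_nonneg) auto
  have sb: "scale_bounds (w i) \<gamma> R x (D * ((1 + Ca) * ?W x))" if xS: "x \<in> S" and xU: "x \<in> U" for x
  proof -
    define f where "f j y = (F j y - F j x * indicator \<Omega> y) + (a y - a x) * w j y" for j y
    have "x \<in> cball x (2 * R)" using R by simp
    then have xO: "x \<in> \<Omega>" using U(2)[OF xU] by blast
    have ax: "a_low \<le> a x" using xS xO by (simp add: S_def)
    have fi: "integrable lborel (f j)" if j: "j \<in> Basis" for j
    proof -
      have "integrable lborel (\<lambda>y. w j y * (a y - a x))"
      proof (rule integrable_mult_bounded_real[OF w(1)[OF j]])
        have "\<bar>a y - a x\<bar> \<le> 2 * A0" for y using a(2)[of x] a(2)[of y] by linarith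
        then show "\<exists>B. \<forall>y. \<bar>a y - a x\<bar> \<le> B" by blast
      qed measurable
      moreover have "integrable lborel (indicator \<Omega> :: 'a \<Rightarrow> real)"
        using emeasure_bounded_finite[OF O(2)] O(1) by (intro integrable_real_indicator) auto
      ultimately show ?thesis unfolding f_def[abs_def] using F[OF j] by (auto simp: mult.commute[of _ "w j _"])
    qed
    have "scale_bounds (w i) \<gamma> R x ((1 / a_low) * real (card (Basis::'a set)) * M * 2 ^ (DIM('a) + 1) * ((1 + Ca) * ?W x))"
    proof (rule scale_bounds_of_kernel_identity[where k = "\<lambda>j. pd j (pd i psi)" and J = Basis and f = f and m = 0 and b = "- (1 / a x)"])
      fix z t assume t: "0 < t" "t \<le> R" "norm (x - z) \<le> R"
      have "cball z t \<subseteq> cball x (2 * R)"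
      proof
        fix p assume "p \<in> cball z t"
        then show "p \<in> cball x (2 * R)" using t dist_triangle[of x p z] by (simp add: dist_norm)
      qed
      then have z: "cball z t \<subseteq> \<Omega>" using U(2)[OF xU] by blast
      have "a x \<noteq> 0" using ax low(1) by simp
      from frozen_equation[OF O w(1) F a weak eqn i t(1) z this, where ?F0.0 = "\<lambda>j. F j x"]
      show "(LINT y|lborel. w i y * dilate z t lap_psi y) = - (1 / a x) * t ^ 0 * (\<Sum>j\<in>Basis. LINT y|lborel. f j y * dilate z t (pd j (pd i psi)) y)"
        by (simp add: f_def)
    next
      show "\<bar>- (1 / a x)\<bar> \<le> 1 / a_low" using ax low(1) by (simp add: frac_le)
      show "0 \<le> (1 + Ca) * ?W x" using Ca W0 by simp
    next
      fix j :: 'a assume j: "j \<in> Basis"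
      have [measurable]: "w j \<in> borel_measurable borel" "F j \<in> borel_measurable borel" by (rule wm[OF j], rule Fm[OF j])
      let ?g = "\<bar>g x\<bar> powr (\<beta> / \<alpha>)"
      have aey: "AE y in lborel. x \<in> \<Omega> \<longrightarrow> y \<in> \<Omega> \<longrightarrow> \<bar>a x - a y\<bar> \<le> \<bar>g x\<bar> * norm (x - y) powr \<alpha>"
        using xS by (simp add: S_def)
      have "(\<integral>\<^sup>+y. indicator (ball x (2 * R)) y * ennreal (\<bar>f j y\<bar> * norm (x - y) powr (- (?d + \<gamma> - real 0))) \<partial>lborel)
        \<le> (\<integral>\<^sup>+y. indicator (ball x (2 * R)) y * ennreal (\<bar>F j x - F j y\<bar> * norm (x - y) powr (- (?d + \<gamma>)))
            + ennreal (Ca * ?g) * (indicator (ball x (2 * R)) y * ennreal (norm (x - y) powr (\<beta> - \<gamma> - ?d)) * ennreal \<bar>w j y\<bar>) \<partial>lborel)"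
      proof (rule nn_integral_mono_AE)
        show "AE y in lborel. indicator (ball x (2 * R)) y * ennreal (\<bar>f j y\<bar> * norm (x - y) powr (- (?d + \<gamma> - real 0)))
          \<le> indicator (ball x (2 * R)) y * ennreal (\<bar>F j x - F j y\<bar> * norm (x - y) powr (- (?d + \<gamma>)))
            + ennreal (Ca * ?g) * (indicator (ball x (2 * R)) y * ennreal (norm (x - y) powr (\<beta> - \<gamma> - ?d)) * ennreal \<bar>w j y\<bar>)"
          using aey
        proof eventually_elim
          case (elim y)
          show ?case
          proof (cases "y \<in> ball x (2 * R)")
            case True
            then have yO: "y \<in> \<Omega>" using U(2)[OF xU] ball_subset_cball by blast
            let ?n = "norm (x - y)"
            have "\<bar>a x - a y\<bar> \<le> (2 * A0) powr (1 - \<beta> / \<alpha>) * (\<bar>g x\<bar> powr (\<beta> / \<alpha>) * ?n powr \<beta>)"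
            proof (rule interpolated_oscillation)
              show "\<bar>a x - a y\<bar> \<le> 2 * A0" using a(2)[of x] a(2)[of y] by linarith
              show "\<bar>a x - a y\<bar> \<le> \<bar>g x\<bar> * ?n powr \<alpha>" using elim xO yO by simp
            qed (use exps in auto)
            then have "\<bar>(a y - a x) * w j y\<bar> \<le> Ca * (?g * ?n powr \<beta>) * \<bar>w j y\<bar>"
              unfolding Ca_def abs_mult abs_minus_commute[of "a y"] by (rule mult_right_mono) simp
            then have "\<bar>f j y\<bar> \<le> \<bar>F j x - F j y\<bar> + Ca * (?g * ?n powr \<beta>) * \<bar>w j y\<bar>"
              using yO abs_triangle_ineq[of "F j y - F j x" "(a y - a x) * w j y"] by (simp add: f_def abs_minus_commute)
            then have "\<bar>f j y\<bar> * ?n powr (- (?d + \<gamma>)) \<le> (\<bar>F j x - F j y\<bar> + Ca * (?g * ?n powr \<beta>) * \<bar>w j y\<bar>) * ?n powr (- (?d + \<gamma>))"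
              by (rule mult_right_mono) simp
            also have "\<dots> = \<bar>F j x - F j y\<bar> * ?n powr (- (?d + \<gamma>)) + Ca * ?g * (?n powr \<beta> * ?n powr (- (?d + \<gamma>)) * \<bar>w j y\<bar>)"
              by (simp add: algebra_simps)
            also have "?n powr \<beta> * ?n powr (- (?d + \<gamma>)) = ?n powr (\<beta> - \<gamma> - ?d)"
              by (simp add: powr_add[symmetric] algebra_simps)
            finally have "ennreal (\<bar>f j y\<bar> * ?n powr (- (?d + \<gamma>))) \<le>
                ennreal (\<bar>F j x - F j y\<bar> * ?n powr (- (?d + \<gamma>)) + Ca * ?g * (?n powr (\<beta> - \<gamma> - ?d) * \<bar>w j y\<bar>))"
              by (rule ennreal_leI)
            also have "\<dots> = ennreal (\<bar>F j x - F j y\<bar> * ?n powr (- (?d + \<gamma>))) + ennreal (Ca * ?g) * (ennreal (?n powr (\<beta> - \<gamma> - ?d)) * ennreal \<bar>w j y\<bar>)"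
              using Ca by (simp only: ennreal_mult ennreal_plus mult_nonneg_nonneg powr_ge_zero abs_ge_zero)
            finally show ?thesis using True by simp
          qed simp
        qed
      qed
      also have "\<dots> = ?osc j x + ennreal (Ca * ?g) * ?rz j x"
        unfolding oscillation_def riesz_def by (subst nn_integral_add; (subst nn_integral_cmult)?; measurable)
      also have "\<dots> = ennreal (enn2real (?osc j x)) + ennreal (Ca * ?g) * ennreal (enn2real (?rz j x))"
        using xS xU j by (simp add: S_def)
      also have "\<dots> = ennreal (enn2real (?osc j x) + Ca * (?g * enn2real (?rz j x)))"
        using Ca by (simp only: ennreal_mult ennreal_plus mult_nonneg_nonneg powr_ge_zero enn2real_nonneg mult.assoc)
      also have "\<dots> \<le> ennreal ((1 + Ca) * ?W x)"
      proof (rule ennreal_leI)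
        let ?o = "enn2real (?osc j x)" let ?r = "?g * enn2real (?rz j x)"
        have le: "?o + ?r \<le> ?W x" unfolding holder_weight_def by (rule member_le_sum[OF j]) auto
        have "?o + Ca * ?r \<le> (1 + Ca) * (?o + ?r)" using Ca by (simp add: algebra_simps)
        also have "\<dots> \<le> (1 + Ca) * ?W x" using Ca le by (intro mult_left_mono) auto
        finally show "?o + Ca * ?r \<le> (1 + Ca) * ?W x" .
      qed
      finally show "(\<integral>\<^sup>+y. indicator (ball x (2 * R)) y * ennreal (\<bar>f j y\<bar> * norm (x - y) powr (- (?d + \<gamma> - real 0))) \<partial>lborel) \<le> ennreal ((1 + Ca) * ?W x)" .
    qed (use fi R M g1 bumps_deriv(2)[OF bumps_deriv(2)[OF psi_bump]] in auto)
    then show ?thesis by (simp add: D_def)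
  qed
  show ?thesis
  proof (rule that[of S "C0 * (D * (1 + Ca) + 1)"])
    show "AE x in lborel. x \<in> S" by (rule S)
    show "C0 * (D * (1 + Ca) + 1) \<ge> 0" using C0 D Ca by simp
    fix x y assume xy: "x \<in> S" "x \<in> U" "y \<in> S" "y \<in> U" "norm (x - y) \<le> R"
    let ?E = "D * (1 + Ca)"
    have "\<bar>w i x - w i y\<bar> \<le> C0 * (D * ((1 + Ca) * ?W x) + D * ((1 + Ca) * ?W y) + 1) * norm (x - y) powr \<gamma>"
      using xy by (intro C0(2) sb) (auto simp: S_def)
    also have "\<dots> \<le> C0 * (?E + 1) * (?W x + ?W y + 1) * norm (x - y) powr \<gamma>"
    proof (rule mult_right_mono)
      have "?E \<ge> 0" using D Ca by simp
      then have "?E * ?W x + ?E * ?W y + 1 \<le> (?E + 1) * (?W x + ?W y + 1)"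
        using W0[of x] W0[of y] by (simp add: algebra_simps)
      from mult_left_mono[OF this C0(1)]
      show "C0 * (D * ((1 + Ca) * ?W x) + D * ((1 + Ca) * ?W y) + 1) \<le> C0 * (?E + 1) * (?W x + ?W y + 1)"
        by (simp only: mult.assoc)
    qed simp
    finally show "\<bar>w i x - w i y\<bar> \<le> C0 * (?E + 1) * (?W x + ?W y + 1) * norm (x - y) powr \<gamma>" .
  qed
qed

section \<open>From pointwise Hoelder bounds to fractional Sobolev seminorms\<close>

lemma powr_sum_le:
  fixes a :: "'i \<Rightarrow> real"
  assumes J: "finite J" and a: "\<And>j. j \<in> J \<Longrightarrow> a j \<ge> 0" and p: "p \<ge> 0"
  shows "(\<Sum>j\<in>J. a j) powr p \<le> real (card J) powr p * (\<Sum>j\<in>J. a j powr p)"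
proof (cases "J = {}")
  case False
  obtain m where m: "m \<in> J" "\<And>j. j \<in> J \<Longrightarrow> a j \<le> a m"
    using obtains_MAX[OF J False, of a] by (metis J Max_ge finite_imageI imageI)
  have "(\<Sum>j\<in>J. a j) \<le> real (card J) * a m"
    using sum_bounded_above[of J a "a m"] m by simp
  then have "(\<Sum>j\<in>J. a j) powr p \<le> (real (card J) * a m) powr p"
    using a p by (intro powr_mono2 sum_nonneg) auto
  also have "\<dots> = real (card J) powr p * a m powr p"
    using a[OF m(1)] by (simp add: powr_mult)
  also have "\<dots> \<le> real (card J) powr p * (\<Sum>j\<in>J. a j powr p)"
    using m(1) J by (intro mult_left_mono member_le_sum) auto
  finally show ?thesis .
qed simp

lemma powr_le_one_plus:
  fixes x :: real
  assumes "x \<ge> 0" "0 \<le> p" "p \<le> q"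
  shows "x powr p \<le> 1 + x powr q"
proof (cases "x \<le> 1")
  case True
  have "x powr p \<le> 1" using True assms powr_mono2[of p x 1] by simp
  then show ?thesis by (simp add: add_increasing2)
next
  case False
  then have "x powr p \<le> x powr q" using assms by (intro powr_mono) auto
  then show ?thesis by simp
qed

text \<open>Young's inequality with exponents $2/p$ and $2/(2-p)$.\<close>

lemma product_powr_le:
  fixes G r p :: real
  assumes G: "G \<ge> 0" and r: "r \<ge> 0" and p: "0 < p" "p < 2"
  shows "(G * r) powr p \<le> r\<^sup>2 + G powr (2 * p / (2 - p))"
proof -
  have "(G * r) powr p = (r powr p) * (G powr p)" using G r by (simp add: powr_mult)
  also have "\<dots> \<le> (r powr p) powr (2 / p) / (2 / p) + (G powr p) powr (2 / (2 - p)) / (2 / (2 - p))"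
    using p by (intro Youngs_inequality) (auto simp: field_simps)
  also have "(r powr p) powr (2 / p) = r\<^sup>2" using r p by (simp add: powr_powr powr_numeral)
  also have "(G powr p) powr (2 / (2 - p)) = G powr (2 * p / (2 - p))" by (simp add: powr_powr mult.commute)
  also have "r\<^sup>2 / (2 / p) \<le> r\<^sup>2" using p divide_left_mono[of 1 "2 / p" "r\<^sup>2"] by simp
  also have "G powr (2 * p / (2 - p)) / (2 / (2 - p)) \<le> G powr (2 * p / (2 - p))"
    using p divide_left_mono[of 1 "2 / (2 - p)" "G powr (2 * p / (2 - p))"] by simp
  finally show ?thesis by simp
qed

lemma ennreal_enn2real_square_le: "ennreal ((enn2real a)\<^sup>2) \<le> a\<^sup>2"
proof (cases "a = top")
  case False
  then show ?thesis by (simp add: ennreal_power[symmetric] ennreal_enn2real less_top)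
qed simp

lemma holder_weight_measurable:
  assumes "\<And>j. j \<in> Basis \<Longrightarrow> F j \<in> borel_measurable borel" "\<And>j. j \<in> Basis \<Longrightarrow> w j \<in> borel_measurable borel"
    and [measurable]: "g \<in> borel_measurable borel"
  shows "holder_weight \<alpha> \<beta> \<gamma> r F w g \<in> borel_measurable borel"
proof -
  have "(\<lambda>x. enn2real (oscillation \<gamma> r (F j) x) + \<bar>g x\<bar> powr (\<beta> / \<alpha>) * enn2real (riesz (\<beta> - \<gamma>) r (\<lambda>y. ennreal \<bar>w j y\<bar>) x)) \<in> borel_measurable borel"
    if j: "j \<in> Basis" for j
  proof -
    note [measurable] = assms(1,2)[OF j]
    show ?thesis by measurable
  qed
  then show ?thesis unfolding holder_weight_def[abs_def] by (intro borel_measurable_sum) auto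
qed

text \<open>Since $p < 2$, the oscillation and the Riesz potential may be raised to the power $2$, and the
  Riesz potential leaves the exponent $2p/(2-p)$ for $|g|^{\beta/\alpha}$.\<close>

proposition holder_weight_Lp:
  fixes F w :: "'a::euclidean_space \<Rightarrow> 'a \<Rightarrow> real"
  assumes Fm: "\<And>j. j \<in> Basis \<Longrightarrow> F j \<in> borel_measurable borel"
    and w: "\<And>j. j \<in> Basis \<Longrightarrow> w j \<in> borel_measurable borel" "\<And>j. j \<in> Basis \<Longrightarrow> (\<integral>\<^sup>+x. (ennreal \<bar>w j x\<bar>)\<^sup>2 \<partial>lborel) < top"
    and g: "g \<in> borel_measurable borel" "(\<integral>\<^sup>+x. ennreal (\<bar>g x\<bar> powr q) \<partial>lborel) < top"
    and U: "U \<in> sets borel" "bounded U" and r: "r > 0" and \<gamma>: "\<gamma> < \<beta>"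
    and osc: "\<And>j. j \<in> Basis \<Longrightarrow> (\<integral>\<^sup>+x. indicator U x * (oscillation \<gamma> r (F j) x)\<^sup>2 \<partial>lborel) < top"
    and p: "0 < p" "p < 2" and e: "0 \<le> \<beta> / \<alpha>" "\<beta> / \<alpha> * (2 * p / (2 - p)) \<le> q"
  shows "(\<integral>\<^sup>+x. indicator U x * ennreal (holder_weight \<alpha> \<beta> \<gamma> r F w g x powr p) \<partial>lborel) < top"
proof -
  let ?o = "\<lambda>j. oscillation \<gamma> r (F j)" and ?r = "\<lambda>j. riesz (\<beta> - \<gamma>) r (\<lambda>y. ennreal \<bar>w j y\<bar>)"
  note [measurable] = g(1) U(1)
  define C where "C = real (card (Basis::'a set)) powr p * 2 powr p"
  have C: "C \<ge> 0" by (simp add: C_def)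
  have pt: "indicator U x * ennreal (holder_weight \<alpha> \<beta> \<gamma> r F w g x powr p)
     \<le> ennreal C * (\<Sum>j\<in>Basis. indicator U x * (?o j x)\<^sup>2 + (?r j x)\<^sup>2 + 2 * indicator U x + ennreal (\<bar>g x\<bar> powr q))" for x
  proof (cases "x \<in> U")
    case True
    define o' r' G where "o' j = enn2real (?o j x)" and "r' j = enn2real (?r j x)" and "G = \<bar>g x\<bar> powr (\<beta> / \<alpha>)" for j
    have nn: "o' j \<ge> 0" "r' j \<ge> 0" "G \<ge> 0" for j by (auto simp: o'_def r'_def G_def)
    have one: "(o' j + G * r' j) powr p \<le> 2 powr p * ((o' j)\<^sup>2 + (r' j)\<^sup>2 + 2 + \<bar>g x\<bar> powr q)" for j
    proof -
      \<comment> \<open>The two summands are written as a family indexed by the truth values.\<close>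
      have "(\<Sum>b\<in>UNIV. if b then o' j else G * r' j) powr p \<le> real (card (UNIV::bool set)) powr p * (\<Sum>b\<in>UNIV. (if b then o' j else G * r' j) powr p)"
        using nn p by (intro powr_sum_le) auto
      then have "(o' j + G * r' j) powr p \<le> 2 powr p * (o' j powr p + (G * r' j) powr p)"
        by (simp add: UNIV_bool add.commute)
      also have "o' j powr p + (G * r' j) powr p \<le> (o' j)\<^sup>2 + (r' j)\<^sup>2 + 2 + \<bar>g x\<bar> powr q"
      proof -
        have 1: "o' j powr p \<le> 1 + (o' j)\<^sup>2" using powr_le_one_plus[of "o' j" p 2] nn(1)[of j] p by (simp add: powr_numeral)
        have 2: "(G * r' j) powr p \<le> (r' j)\<^sup>2 + G powr (2 * p / (2 - p))" by (rule product_powr_le[OF nn(3,2) p])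
        have "G powr (2 * p / (2 - p)) = \<bar>g x\<bar> powr (\<beta> / \<alpha> * (2 * p / (2 - p)))" by (simp add: G_def powr_powr)
        also have "\<dots> \<le> 1 + \<bar>g x\<bar> powr q" using e p by (intro powr_le_one_plus mult_nonneg_nonneg) auto
        finally show ?thesis using 1 2 by linarith
      qed
      finally show ?thesis by (simp add: mult_left_mono)
    qed
    have "holder_weight \<alpha> \<beta> \<gamma> r F w g x powr p = (\<Sum>j\<in>Basis. o' j + G * r' j) powr p"
      by (simp add: holder_weight_def o'_def r'_def G_def)
    also have "\<dots> \<le> real (card (Basis::'a set)) powr p * (\<Sum>j\<in>Basis. (o' j + G * r' j) powr p)"
      using nn p by (intro powr_sum_le) auto
    also have "\<dots> \<le> real (card (Basis::'a set)) powr p * (\<Sum>j\<in>Basis. 2 powr p * ((o' j)\<^sup>2 + (r' j)\<^sup>2 + 2 + \<bar>g x\<bar> powr q))"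
      by (intro mult_left_mono sum_mono one) auto
    also have "\<dots> = C * (\<Sum>j\<in>Basis. (o' j)\<^sup>2 + (r' j)\<^sup>2 + 2 + \<bar>g x\<bar> powr q)"
      by (simp add: C_def sum_distrib_left mult.assoc)
    finally have "ennreal (holder_weight \<alpha> \<beta> \<gamma> r F w g x powr p) \<le> ennreal (C * (\<Sum>j\<in>Basis. (o' j)\<^sup>2 + (r' j)\<^sup>2 + 2 + \<bar>g x\<bar> powr q))"
      by (rule ennreal_leI)
    also have "\<dots> = ennreal C * (\<Sum>j\<in>Basis. ennreal ((o' j)\<^sup>2 + (r' j)\<^sup>2 + 2 + \<bar>g x\<bar> powr q))"
      by (subst ennreal_mult'[OF C], subst sum_ennreal) auto
    also have "\<dots> \<le> ennreal C * (\<Sum>j\<in>Basis. (?o j x)\<^sup>2 + (?r j x)\<^sup>2 + 2 + ennreal (\<bar>g x\<bar> powr q))"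
    proof (intro mult_left_mono sum_mono)
      fix j
      have "ennreal ((o' j)\<^sup>2 + (r' j)\<^sup>2 + 2 + \<bar>g x\<bar> powr q) = ennreal ((o' j)\<^sup>2) + ennreal ((r' j)\<^sup>2) + ennreal 2 + ennreal (\<bar>g x\<bar> powr q)"
        by (simp only: ennreal_plus zero_le_power2 powr_ge_zero add_nonneg_nonneg zero_le_numeral)
      also have "\<dots> \<le> (?o j x)\<^sup>2 + (?r j x)\<^sup>2 + 2 + ennreal (\<bar>g x\<bar> powr q)"
        unfolding o'_def r'_def by (intro add_mono ennreal_enn2real_square_le) auto
      finally show "ennreal ((o' j)\<^sup>2 + (r' j)\<^sup>2 + 2 + \<bar>g x\<bar> powr q) \<le> (?o j x)\<^sup>2 + (?r j x)\<^sup>2 + 2 + ennreal (\<bar>g x\<bar> powr q)" .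
    qed simp
    finally show ?thesis using True by simp
  qed simp
  have int: "(\<integral>\<^sup>+x. indicator U x * (?o j x)\<^sup>2 + (?r j x)\<^sup>2 + 2 * indicator U x + ennreal (\<bar>g x\<bar> powr q) \<partial>lborel) < top" if j: "j \<in> Basis" for j
  proof -
    note [measurable] = Fm[OF j] w(1)[OF j]
    have "(\<integral>\<^sup>+x. (?r j x)\<^sup>2 \<partial>lborel) < top"
      using w(2)[OF j] r \<gamma> by (intro riesz_L2) auto
    then show ?thesis
      using osc[OF j] g(2) emeasure_bounded_finite[OF U(2)]
      by (simp add: nn_integral_add nn_integral_cmult ennreal_mult_less_top)
  qed
  have "(\<integral>\<^sup>+x. indicator U x * ennreal (holder_weight \<alpha> \<beta> \<gamma> r F w g x powr p) \<partial>lborel)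
     \<le> (\<integral>\<^sup>+x. ennreal C * (\<Sum>j\<in>Basis. indicator U x * (?o j x)\<^sup>2 + (?r j x)\<^sup>2 + 2 * indicator U x + ennreal (\<bar>g x\<bar> powr q)) \<partial>lborel)"
    by (intro nn_integral_mono pt)
  also have "\<dots> = ennreal C * (\<Sum>j\<in>Basis. \<integral>\<^sup>+x. indicator U x * (?o j x)\<^sup>2 + (?r j x)\<^sup>2 + 2 * indicator U x + ennreal (\<bar>g x\<bar> powr q) \<partial>lborel)"
  proof -
    have m: "(\<lambda>x. indicator U x * (?o j x)\<^sup>2 + (?r j x)\<^sup>2 + 2 * indicator U x + ennreal (\<bar>g x\<bar> powr q)) \<in> borel_measurable lborel" if j: "j \<in> Basis" for j
    proof -
      note [measurable] = Fm[OF j] w(1)[OF j]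
      show ?thesis by measurable
    qed
    show ?thesis
      by (subst nn_integral_cmult) (use m in \<open>auto simp: nn_integral_sum intro!: borel_measurable_sum\<close>)
  qed
  also have "\<dots> < top" using int by (simp add: ennreal_mult_less_top)
  finally show ?thesis .
qed

text \<open>Close to the diagonal the pointwise bound leaves the kernel $|x-y|^{(\gamma-\sigma)p-d}$, which is
  integrable in either variable; away from the diagonal the kernel is bounded.\<close>

proposition gagliardo_of_pointwise_holder:
  fixes v B :: "'a::euclidean_space \<Rightarrow> real"
  assumes [measurable]: "v \<in> borel_measurable borel" "B \<in> borel_measurable borel" and B: "\<And>x. B x \<ge> 0"
    and U: "U \<in> sets borel" "bounded U" and R: "R > 0" and C: "C \<ge> 0" and p: "p \<ge> 1" and \<gamma>: "0 \<le> \<sigma>" "\<sigma> < \<gamma>"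
    and S: "AE x in lborel. x \<in> S"
    and hol: "\<And>x y. x \<in> S \<Longrightarrow> x \<in> U \<Longrightarrow> y \<in> S \<Longrightarrow> y \<in> U \<Longrightarrow> norm (x - y) \<le> R \<Longrightarrow> \<bar>v x - v y\<bar> \<le> C * (B x + B y + 1) * norm (x - y) powr \<gamma>"
    and Bp: "(\<integral>\<^sup>+x. indicator U x * ennreal (B x powr p) \<partial>lborel) < top"
    and vp: "(\<integral>\<^sup>+x. indicator U x * ennreal (\<bar>v x\<bar> powr p) \<partial>lborel) < top"
  shows "(\<integral>\<^sup>+x. \<integral>\<^sup>+y. indicator U x * (indicator U y * ennreal (\<bar>v x - v y\<bar> powr p * norm (x - y) powr (- (real DIM('a) + \<sigma> * p)))) \<partial>lborel \<partial>lborel) < top"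
proof -
  let ?d = "real DIM('a)"
  note [measurable] = U(1)
  define \<kappa> where "\<kappa> = (\<gamma> - \<sigma>) * p"
  have \<kappa>: "\<kappa> > 0" using \<gamma> p by (simp add: \<kappa>_def)
  define h where "h x = indicator U x * ennreal (B x powr p + 1)" for x
  define hv where "hv x = indicator U x * ennreal (\<bar>v x\<bar> powr p)" for x
  have [measurable]: "h \<in> borel_measurable borel" "hv \<in> borel_measurable borel" unfolding h_def hv_def by measurable
  define k where "k x y = indicator (ball x (2 * R)) y * ennreal (norm (x - y) powr (\<kappa> - ?d))" for x y :: 'a
  have [measurable]: "case_prod k \<in> borel_measurable (borel \<Otimes>\<^sub>M borel)" unfolding k_def indicator_ball_norm by measurable
  have [measurable]: "k x \<in> borel_measurable borel" for x unfolding k_def by measurable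
  define C1 where "C1 = C powr p * 3 powr p"
  define C2 where "C2 = R powr (- (?d + \<sigma> * p)) * 2 powr p"
  have C12: "C1 \<ge> 0" "C2 \<ge> 0" by (auto simp: C1_def C2_def)
  define Q where "Q x y = indicator U x * (indicator U y * ennreal (\<bar>v x - v y\<bar> powr p * norm (x - y) powr (- (?d + \<sigma> * p))))" for x y
  have bound: "Q x y \<le> ennreal C1 * (h x * k x y + k x y * h y) + ennreal C2 * (hv x * indicator U y + indicator U x * hv y)"
    if xS: "x \<in> S" and yS: "y \<in> S" for x y
  proof (cases "x \<in> U \<and> y \<in> U")
    case True
    let ?n = "norm (x - y)"
    show ?thesis
    proof (cases "?n \<le> R")
      case near: True
      have "\<bar>v x - v y\<bar> powr p \<le> (C * (B x + B y + 1) * ?n powr \<gamma>) powr p"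
        using hol[OF xS _ yS] True near p by (intro powr_mono2) auto
      also have "\<dots> = C powr p * (B x + B y + 1) powr p * ?n powr (\<gamma> * p)"
        using C B[of x] B[of y] by (simp add: powr_mult powr_powr)
      also have "(B x + B y + 1) powr p \<le> 3 powr p * ((B x powr p + 1) + (B y powr p + 1))"
      proof -
        have "(\<Sum>j\<in>{0,1,2::nat}. if j = 0 then B x else if j = 1 then B y else 1) powr p
           \<le> real (card {0,1,2::nat}) powr p * (\<Sum>j\<in>{0,1,2::nat}. (if j = 0 then B x else if j = 1 then B y else 1) powr p)"
          using B p by (intro powr_sum_le) auto
        then have "(B x + B y + 1) powr p \<le> 3 powr p * (B x powr p + B y powr p + 1)"
          by (simp add: add.assoc)
        also have "\<dots> \<le> 3 powr p * ((B x powr p + 1) + (B y powr p + 1))"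
          by (intro mult_left_mono) auto
        finally show ?thesis .
      qed
      finally have "\<bar>v x - v y\<bar> powr p \<le> C1 * ((B x powr p + 1) + (B y powr p + 1)) * ?n powr (\<gamma> * p)"
        by (simp add: C1_def mult_left_mono mult_right_mono mult.assoc)
      then have "\<bar>v x - v y\<bar> powr p * ?n powr (- (?d + \<sigma> * p)) \<le> C1 * ((B x powr p + 1) + (B y powr p + 1)) * ?n powr (\<gamma> * p) * ?n powr (- (?d + \<sigma> * p))"
        by (rule mult_right_mono) simp
      also have "\<dots> = C1 * ((B x powr p + 1) * ?n powr (\<kappa> - ?d) + ?n powr (\<kappa> - ?d) * (B y powr p + 1))"
      proof -
        have "\<gamma> * p + - (?d + \<sigma> * p) = \<kappa> - ?d" by (simp add: \<kappa>_def algebra_simps)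
        then have "?n powr (\<gamma> * p) * ?n powr (- (?d + \<sigma> * p)) = ?n powr (\<kappa> - ?d)" by (simp only: powr_add[symmetric])
        then show ?thesis by (simp only: mult.assoc) (simp add: algebra_simps)
      qed
      finally have "ennreal (\<bar>v x - v y\<bar> powr p * ?n powr (- (?d + \<sigma> * p))) \<le> ennreal (C1 * ((B x powr p + 1) * ?n powr (\<kappa> - ?d) + ?n powr (\<kappa> - ?d) * (B y powr p + 1)))"
        by (rule ennreal_leI)
      also have "\<dots> = ennreal C1 * (ennreal (B x powr p + 1) * ennreal (?n powr (\<kappa> - ?d)) + ennreal (?n powr (\<kappa> - ?d)) * ennreal (B y powr p + 1))"
        using C12 by (simp only: ennreal_mult ennreal_plus mult_nonneg_nonneg add_nonneg_nonneg powr_ge_zero zero_le_one)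
      also have "\<dots> = ennreal C1 * (h x * k x y + k x y * h y)"
        using True near R by (simp add: h_def k_def dist_norm)
      finally have "Q x y \<le> ennreal C1 * (h x * k x y + k x y * h y)" using True by (simp add: Q_def)
      then show ?thesis by (rule add_increasing2[rotated]) simp
    next
      case far: False
      have "\<bar>v x - v y\<bar> powr p \<le> (\<Sum>b\<in>UNIV. if b then \<bar>v x\<bar> else \<bar>v y\<bar>) powr p"
        using p by (intro powr_mono2) (auto simp: UNIV_bool)
      also have "\<dots> \<le> real (card (UNIV::bool set)) powr p * (\<Sum>b\<in>UNIV. (if b then \<bar>v x\<bar> else \<bar>v y\<bar>) powr p)"
        using p by (intro powr_sum_le) auto
      also have "\<dots> = 2 powr p * (\<bar>v x\<bar> powr p + \<bar>v y\<bar> powr p)" by (simp add: UNIV_bool add.commute)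
      finally have "\<bar>v x - v y\<bar> powr p * ?n powr (- (?d + \<sigma> * p)) \<le> (2 powr p * (\<bar>v x\<bar> powr p + \<bar>v y\<bar> powr p)) * R powr (- (?d + \<sigma> * p))"
      proof (intro mult_mono powr_mono2')
        have "\<sigma> * p \<ge> 0" using \<gamma> p by simp
        then show "- (?d + \<sigma> * p) \<le> 0" by simp
      qed (use far R in auto)
      also have "\<dots> = C2 * (\<bar>v x\<bar> powr p + \<bar>v y\<bar> powr p)" by (simp add: C2_def)
      finally have "ennreal (\<bar>v x - v y\<bar> powr p * ?n powr (- (?d + \<sigma> * p))) \<le> ennreal (C2 * (\<bar>v x\<bar> powr p + \<bar>v y\<bar> powr p))"
        by (rule ennreal_leI)
      also have "\<dots> = ennreal C2 * (ennreal (\<bar>v x\<bar> powr p) + ennreal (\<bar>v y\<bar> powr p))"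
        using C12 by (simp only: ennreal_mult ennreal_plus add_nonneg_nonneg powr_ge_zero)
      finally have "Q x y \<le> ennreal C2 * (hv x * indicator U y + indicator U x * hv y)" using True by (simp add: Q_def hv_def)
      then show ?thesis by (rule add_increasing[rotated]) simp
    qed
  qed (auto simp: Q_def)
  \<comment> \<open>The radius \<open>2 * R\<close> makes the open ball contain all pairs at distance at most \<open>R\<close>.\<close>
  define k0 where "k0 = riesz \<kappa> (2 * R) (\<lambda>_. 1) (0::'a)"
  have k0: "k0 < top" unfolding k0_def using \<kappa> R by (intro riesz_const_finite) auto
  have k1: "(\<integral>\<^sup>+y. k x y \<partial>lborel) = k0" for x
    using riesz_const_finite(1)[of \<kappa> "2 * R" x] \<kappa> R unfolding k0_def[symmetric] by (simp add: riesz_def k_def)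
  have k2: "(\<integral>\<^sup>+x. k x y \<partial>lborel) = k0" for y
    using k1[of y] by (simp add: k_def norm_minus_commute indicator_ball_norm)
  have Ih: "(\<integral>\<^sup>+x. h x \<partial>lborel) < top"
  proof -
    have "(\<integral>\<^sup>+x. h x \<partial>lborel) = (\<integral>\<^sup>+x. indicator U x * ennreal (B x powr p) + indicator U x \<partial>lborel)"
      by (intro nn_integral_cong) (auto simp: h_def indicator_def)
    also have "\<dots> = (\<integral>\<^sup>+x. indicator U x * ennreal (B x powr p) \<partial>lborel) + emeasure lborel U"
      by (simp add: nn_integral_add)
    finally show ?thesis using Bp emeasure_bounded_finite[OF U(2)] by simp
  qed
  have Ihv: "(\<integral>\<^sup>+x. hv x \<partial>lborel) < top" using vp by (simp add: hv_def)
  have "(\<integral>\<^sup>+x. \<integral>\<^sup>+y. Q x y \<partial>lborel \<partial>lborel)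
    \<le> (\<integral>\<^sup>+x. \<integral>\<^sup>+y. ennreal C1 * (h x * k x y + k x y * h y) + ennreal C2 * (hv x * indicator U y + indicator U x * hv y) \<partial>lborel \<partial>lborel)"
  proof (rule nn_integral_mono_AE)
    show "AE x in lborel. (\<integral>\<^sup>+y. Q x y \<partial>lborel) \<le> (\<integral>\<^sup>+y. ennreal C1 * (h x * k x y + k x y * h y) + ennreal C2 * (hv x * indicator U y + indicator U x * hv y) \<partial>lborel)"
      using S
    proof eventually_elim
      case (elim x)
      show ?case by (rule nn_integral_mono_AE) (use S in eventually_elim, use bound elim in blast)
    qed
  qed
  also have "\<dots> = (\<integral>\<^sup>+x. ennreal C1 * (h x * k0 + (\<integral>\<^sup>+y. k x y * h y \<partial>lborel)) + ennreal C2 * (hv x * emeasure lborel U + indicator U x * (\<integral>\<^sup>+y. hv y \<partial>lborel)) \<partial>lborel)"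
    by (intro nn_integral_cong) (simp add: nn_integral_add nn_integral_cmult k1)
  also have "\<dots> = ennreal C1 * ((\<integral>\<^sup>+x. h x \<partial>lborel) * k0 + (\<integral>\<^sup>+x. \<integral>\<^sup>+y. k x y * h y \<partial>lborel \<partial>lborel))
     + ennreal C2 * ((\<integral>\<^sup>+x. hv x \<partial>lborel) * emeasure lborel U + emeasure lborel U * (\<integral>\<^sup>+y. hv y \<partial>lborel))"
  proof -
    have [measurable]: "(\<lambda>x. \<integral>\<^sup>+y. k x y * h y \<partial>lborel) \<in> borel_measurable borel"
    proof -
      have "(\<lambda>x. \<integral>\<^sup>+y. k x y * h y \<partial>lborel) \<in> borel_measurable lborel"
        by (rule lborel.borel_measurable_nn_integral) measurable
      then show ?thesis by simp
    qed
    show ?thesis by (simp add: nn_integral_add nn_integral_cmult nn_integral_multc)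
  qed
  also have "(\<integral>\<^sup>+x. \<integral>\<^sup>+y. k x y * h y \<partial>lborel \<partial>lborel) = (\<integral>\<^sup>+y. \<integral>\<^sup>+x. k x y * h y \<partial>lborel \<partial>lborel)"
    by (rule lborel_pair.Fubini') measurable
  also have "\<dots> = (\<integral>\<^sup>+y. k0 * h y \<partial>lborel)"
    by (intro nn_integral_cong) (subst nn_integral_multc, auto simp: k2)
  also have "\<dots> = k0 * (\<integral>\<^sup>+y. h y \<partial>lborel)" by (simp add: nn_integral_cmult)
  finally have "(\<integral>\<^sup>+x. \<integral>\<^sup>+y. Q x y \<partial>lborel \<partial>lborel) \<le> ennreal C1 * ((\<integral>\<^sup>+x. h x \<partial>lborel) * k0 + k0 * (\<integral>\<^sup>+y. h y \<partial>lborel))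
     + ennreal C2 * ((\<integral>\<^sup>+x. hv x \<partial>lborel) * emeasure lborel U + emeasure lborel U * (\<integral>\<^sup>+y. hv y \<partial>lborel))" .
  also have "\<dots> < top"
    using k0 Ih Ihv emeasure_bounded_finite[OF U(2)] by (simp add: ennreal_mult_less_top)
  finally show ?thesis by (simp add: Q_def)
qed

section \<open>Sobolev functions in terms of Borel components\<close>

lemma ennreal_square_abs: "(ennreal \<bar>x\<bar>)\<^sup>2 = ennreal (\<bar>x\<bar> powr 2)"
  by (simp add: ennreal_power powr_numeral)

lemma integrable_indicator_bounded:
  "U \<in> sets borel \<Longrightarrow> bounded U \<Longrightarrow> integrable lborel (indicator U :: 'a::euclidean_space \<Rightarrow> real)"
  using emeasure_bounded_finite[of U] by (intro integrable_real_indicator) auto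

lemma integrable_powr_mono:
  fixes f :: "'a::euclidean_space \<Rightarrow> real"
  assumes [measurable]: "f \<in> borel_measurable borel" and U: "U \<in> sets borel" "bounded U"
    and p: "0 < p" "p \<le> q" and q: "integrable lborel (\<lambda>x. \<bar>f x\<bar> powr q)"
  shows "integrable lborel (\<lambda>x. indicator U x * \<bar>f x\<bar> powr p)"
proof (rule Bochner_Integration.integrable_bound)
  note [measurable] = U(1)
  show "integrable lborel (\<lambda>x. indicator U x + \<bar>f x\<bar> powr q)"
    by (intro Bochner_Integration.integrable_add integrable_indicator_bounded U q)
  show "(\<lambda>x. indicator U x * \<bar>f x\<bar> powr p) \<in> borel_measurable lborel" by measurable
  show "AE x in lborel. norm (indicator U x * \<bar>f x\<bar> powr p) \<le> norm (indicator U x + \<bar>f x\<bar> powr q)"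
  proof (rule AE_I2)
    fix x
    show "norm (indicator U x * \<bar>f x\<bar> powr p) \<le> norm (indicator U x + \<bar>f x\<bar> powr q)"
      using powr_le_one_plus[of "\<bar>f x\<bar>" p q] p by (auto simp: indicator_def)
  qed
qed

lemma Lp_component_representative:
  fixes v :: "'a::euclidean_space \<Rightarrow> 'b::euclidean_space"
  assumes O: "\<Omega> \<in> sets borel" "bounded \<Omega>" and v: "v \<in> Lp_on q \<Omega>" and q: "q \<ge> 2" and c: "c \<in> Basis"
  obtains f where "f \<in> borel_measurable borel" "\<And>x. x \<notin> \<Omega> \<Longrightarrow> f x = 0" "AE x in lborel. x \<in> \<Omega> \<longrightarrow> v x \<bullet> c = f x"
    "integrable lborel f" "(\<integral>\<^sup>+x. (ennreal \<bar>f x\<bar>)\<^sup>2 \<partial>lborel) < top" "integrable lborel (\<lambda>x. \<bar>f x\<bar> powr q)"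
proof -
  have vm: "v \<in> borel_measurable (lebesgue_on \<Omega>)" and vi: "integrable (lebesgue_on \<Omega>) (\<lambda>x. norm (v x) powr q)"
    using v by (auto simp: Lp_on_def)
  have vc: "(\<lambda>x. v x \<bullet> c) \<in> borel_measurable (lebesgue_on \<Omega>)" using vm by measurable
  obtain f where f: "f \<in> borel_measurable borel" "\<And>x. x \<notin> \<Omega> \<Longrightarrow> f x = 0" "AE x in lborel. x \<in> \<Omega> \<longrightarrow> v x \<bullet> c = f x"
    using lebesgue_on_borel_representative[OF O(1) vc] by blast
  note [measurable] = f(1) vc
  have "integrable (lebesgue_on \<Omega>) (\<lambda>x. \<bar>v x \<bullet> c\<bar> powr q)"
  proof (rule Bochner_Integration.integrable_bound[OF vi])
    show "AE x in lebesgue_on \<Omega>. norm (\<bar>v x \<bullet> c\<bar> powr q) \<le> norm (norm (v x) powr q)"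
      using q Basis_le_norm[OF c] by (intro AE_I2) (auto intro!: powr_mono2)
  qed measurable
  moreover have "integrable (lebesgue_on \<Omega>) (\<lambda>x. \<bar>v x \<bullet> c\<bar> powr q) \<longleftrightarrow> integrable lborel (\<lambda>x. \<bar>f x\<bar> powr q)"
  proof (rule lebesgue_on_transfer(2)[OF O(1)])
    show "AE x in lborel. x \<in> \<Omega> \<longrightarrow> \<bar>v x \<bullet> c\<bar> powr q = \<bar>f x\<bar> powr q" using f(3) by eventually_elim auto
  qed (use f in auto)
  ultimately have fq: "integrable lborel (\<lambda>x. \<bar>f x\<bar> powr q)" by simp
  have f1: "integrable lborel f"
  proof (rule Bochner_Integration.integrable_bound[OF integrable_powr_mono[OF f(1) O _ _ fq, of 1]])
    show "AE x in lborel. norm (f x) \<le> norm (indicator \<Omega> x * \<bar>f x\<bar> powr 1)"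
      using f(2) by (intro AE_I2) (auto simp: indicator_def)
  qed (use q in auto)
  have "integrable lborel (\<lambda>x. indicator \<Omega> x * \<bar>f x\<bar> powr 2)"
    using q by (intro integrable_powr_mono[OF f(1) O _ _ fq]) auto
  then have "(\<integral>\<^sup>+x. ennreal (norm (indicator \<Omega> x * \<bar>f x\<bar> powr 2)) \<partial>lborel) < top"
    by (simp add: integrable_iff_bounded)
  also have "(\<integral>\<^sup>+x. ennreal (norm (indicator \<Omega> x * \<bar>f x\<bar> powr 2)) \<partial>lborel) = (\<integral>\<^sup>+x. (ennreal \<bar>f x\<bar>)\<^sup>2 \<partial>lborel)"
    unfolding ennreal_square_abs using f(2) by (intro nn_integral_cong) (auto simp: indicator_def)
  finally show ?thesis using that[OF f f1 _ fq] by blast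
qed

lemma Lp_on_integrable:
  fixes v :: "'a::euclidean_space \<Rightarrow> 'b::euclidean_space"
  assumes O: "\<Omega> \<in> sets borel" "bounded \<Omega>" and v: "v \<in> Lp_on q \<Omega>" and q: "q \<ge> 1"
  shows "integrable (lebesgue_on \<Omega>) v"
proof (rule Bochner_Integration.integrable_bound)
  have "integrable (lebesgue_on \<Omega>) (\<lambda>_. 1::real) \<longleftrightarrow> integrable lborel (indicator \<Omega> :: 'a \<Rightarrow> real)"
    by (rule lebesgue_on_transfer(2)[OF O(1)]) (use O in auto)
  then show "integrable (lebesgue_on \<Omega>) (\<lambda>x. 1 + norm (v x) powr q)"
    using integrable_indicator_bounded[OF O] v by (auto simp: Lp_on_def)
  show "v \<in> borel_measurable (lebesgue_on \<Omega>)" using v by (simp add: Lp_on_def)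
  show "AE x in lebesgue_on \<Omega>. norm (v x) \<le> norm (1 + norm (v x) powr q)"
    using powr_le_one_plus[of "norm (v _)" 1 q] q by (intro AE_I2) simp
qed

lemma borel_measurable_lebesgue_on_borel:
  "f \<in> borel_measurable borel \<Longrightarrow> f \<in> borel_measurable (lebesgue_on \<Omega>)"
  by (intro measurable_restrict_space1 measurable_completion) simp

lemma weak_partial_component:
  fixes F W :: "'a::euclidean_space \<Rightarrow> 'b::euclidean_space" and f w :: "'a \<Rightarrow> real"
  assumes O: "\<Omega> \<in> sets borel" and wp: "weak_partial \<Omega> j F W" and j: "j \<in> Basis"
    and int: "integrable (lebesgue_on \<Omega>) F" "integrable (lebesgue_on \<Omega>) W"
    and f: "f \<in> borel_measurable borel" "\<And>x. x \<notin> \<Omega> \<Longrightarrow> f x = 0" "AE x in lborel. x \<in> \<Omega> \<longrightarrow> F x \<bullet> c = f x"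
    and w: "w \<in> borel_measurable borel" "\<And>x. x \<notin> \<Omega> \<Longrightarrow> w x = 0" "AE x in lborel. x \<in> \<Omega> \<longrightarrow> W x \<bullet> c = w x"
    and \<phi>: "\<phi> \<in> test_functions \<Omega>"
  shows "(LINT y|lborel. f y * pd j \<phi> y) = - (LINT y|lborel. w y * \<phi> y)"
proof -
  note [measurable] = f(1) w(1) test_function_regularity(1)[OF \<phi>] test_function_regularity(2)[OF \<phi> j]
  have i1: "integrable (lebesgue_on \<Omega>) (\<lambda>x. pd j \<phi> x *\<^sub>R F x)"
    by (intro integrable_bounded_scaleR int borel_measurable_lebesgue_on_borel test_function_regularity(2,4)[OF \<phi> j])
  have i2: "integrable (lebesgue_on \<Omega>) (\<lambda>x. \<phi> x *\<^sub>R W x)"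
    by (intro integrable_bounded_scaleR int borel_measurable_lebesgue_on_borel test_function_regularity(1,3)[OF \<phi>])
  have "(LINT x|lebesgue_on \<Omega>. pd j \<phi> x *\<^sub>R F x) = - (LINT x|lebesgue_on \<Omega>. \<phi> x *\<^sub>R W x)"
    using wp \<phi> unfolding weak_partial_def pd_def by blast
  then have "(LINT x|lebesgue_on \<Omega>. pd j \<phi> x *\<^sub>R F x) \<bullet> c = - ((LINT x|lebesgue_on \<Omega>. \<phi> x *\<^sub>R W x) \<bullet> c)"
    by simp
  moreover have "(LINT x|lebesgue_on \<Omega>. pd j \<phi> x *\<^sub>R F x) \<bullet> c = (LINT x|lebesgue_on \<Omega>. (pd j \<phi> x *\<^sub>R F x) \<bullet> c)"
    by (rule integral_inner_left[symmetric]) (rule i1)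
  moreover have "(LINT x|lebesgue_on \<Omega>. \<phi> x *\<^sub>R W x) \<bullet> c = (LINT x|lebesgue_on \<Omega>. (\<phi> x *\<^sub>R W x) \<bullet> c)"
    by (rule integral_inner_left[symmetric]) (rule i2)
  moreover have "(LINT x|lebesgue_on \<Omega>. (pd j \<phi> x *\<^sub>R F x) \<bullet> c) = (LINT y|lborel. f y * pd j \<phi> y)"
  proof (rule lebesgue_on_transfer(3)[OF O])
    show "AE x in lborel. x \<in> \<Omega> \<longrightarrow> (pd j \<phi> x *\<^sub>R F x) \<bullet> c = f x * pd j \<phi> x"
      using f(3) by eventually_elim auto
  qed (use f(2) in auto)
  moreover have "(LINT x|lebesgue_on \<Omega>. (\<phi> x *\<^sub>R W x) \<bullet> c) = (LINT y|lborel. w y * \<phi> y)"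
  proof (rule lebesgue_on_transfer(3)[OF O])
    show "AE x in lborel. x \<in> \<Omega> \<longrightarrow> (\<phi> x *\<^sub>R W x) \<bullet> c = w x * \<phi> x"
      using w(3) by eventually_elim auto
  qed (use w(2) in auto)
  ultimately show ?thesis by simp
qed

lemma grad_integral:
  fixes V :: "'a::euclidean_space \<Rightarrow> 'a" and f :: "'a \<Rightarrow> 'a \<Rightarrow> real" and b b' :: "'a \<Rightarrow> real"
  assumes O: "\<Omega> \<in> sets borel" and \<phi>: "\<phi> \<in> test_functions \<Omega>"
    and f: "\<And>j. j \<in> Basis \<Longrightarrow> f j \<in> borel_measurable borel" "\<And>j x. j \<in> Basis \<Longrightarrow> x \<notin> \<Omega> \<Longrightarrow> f j x = 0"
      "\<And>j. j \<in> Basis \<Longrightarrow> AE x in lborel. x \<in> \<Omega> \<longrightarrow> V x \<bullet> j = f j x" "\<And>j. j \<in> Basis \<Longrightarrow> integrable lborel (f j)"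
    and b: "b' \<in> borel_measurable borel" "\<And>x. \<bar>b' x\<bar> \<le> B" "AE x in lborel. x \<in> \<Omega> \<longrightarrow> b x = b' x"
  shows "(LINT x|lebesgue_on \<Omega>. b x * (V x \<bullet> grad \<phi> x)) = (\<Sum>j\<in>Basis. LINT y|lborel. b' y * f j y * pd j \<phi> y)"
proof -
  have m: "f j \<in> borel_measurable borel" "pd j \<phi> \<in> borel_measurable borel" if "j \<in> Basis" for j
    using f(1)[OF that] test_function_regularity(2)[OF \<phi> that] by auto
  note [measurable] = b(1)
  have all: "AE x in lborel. \<forall>j\<in>Basis. x \<in> \<Omega> \<longrightarrow> V x \<bullet> j = f j x"
    by (rule AE_finite_allI) (use f(3) in auto)
  have "(LINT x|lebesgue_on \<Omega>. b x * (V x \<bullet> grad \<phi> x)) = (LINT x|lborel. (\<Sum>j\<in>Basis. b' x * f j x * pd j \<phi> x))"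
  proof (rule lebesgue_on_transfer(3)[OF O])
    show "(\<lambda>x. \<Sum>j\<in>Basis. b' x * f j x * pd j \<phi> x) \<in> borel_measurable borel"
    proof (rule borel_measurable_sum)
      fix j :: 'a assume j: "j \<in> Basis"
      note [measurable] = m[OF j]
      show "(\<lambda>x. b' x * f j x * pd j \<phi> x) \<in> borel_measurable borel" by measurable
    qed
    show "(\<Sum>j\<in>Basis. b' x * f j x * pd j \<phi> x) = 0" if "x \<notin> \<Omega>" for x
      using f(2) that by (intro sum.neutral) auto
    show "AE x in lborel. x \<in> \<Omega> \<longrightarrow> b x * (V x \<bullet> grad \<phi> x) = (\<Sum>j\<in>Basis. b' x * f j x * pd j \<phi> x)"
      using all b(3)
    proof eventually_elim
      case (elim x)
      show ?case
      proof
        assume x: "x \<in> \<Omega>"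
        have "V x \<bullet> grad \<phi> x = (\<Sum>j\<in>Basis. pd j \<phi> x * (V x \<bullet> j))"
          by (simp add: grad_def pd_def inner_sum_right)
        also have "\<dots> = (\<Sum>j\<in>Basis. pd j \<phi> x * f j x)" using elim x by (intro sum.cong) auto
        finally show "b x * (V x \<bullet> grad \<phi> x) = (\<Sum>j\<in>Basis. b' x * f j x * pd j \<phi> x)"
          using elim x by (simp add: sum_distrib_left mult_ac)
      qed
    qed
  qed
  also have "\<dots> = (\<Sum>j\<in>Basis. LINT y|lborel. b' y * f j y * pd j \<phi> y)"
  proof (rule Bochner_Integration.integral_sum)
    fix j :: 'a assume j: "j \<in> Basis"
    note [measurable] = m[OF j]
    have "integrable lborel (\<lambda>y. f j y * b' y)"
      by (rule integrable_mult_bounded_real[OF f(4)[OF j]]) (use b in auto)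
    then have "integrable lborel (\<lambda>y. b' y * f j y)" by (simp only: mult.commute)
    then show "integrable lborel (\<lambda>y. b' y * f j y * pd j \<phi> y)"
      by (rule integrable_mult_bounded_real) (use test_function_regularity(2,4)[OF \<phi> j] in auto)
  qed
  finally show ?thesis .
qed

lemma integrable_lborel_pair_iff:
  fixes k :: "'a::euclidean_space \<times> 'a \<Rightarrow> real"
  assumes [measurable]: "k \<in> borel_measurable borel"
  shows "integrable lborel k \<longleftrightarrow> (\<integral>\<^sup>+x. \<integral>\<^sup>+y. ennreal \<bar>k (x, y)\<bar> \<partial>lborel \<partial>lborel) < top"
proof -
  have km: "(\<lambda>z. ennreal \<bar>k z\<bar>) \<in> borel_measurable (lborel \<Otimes>\<^sub>M lborel)"
    unfolding lborel_prod by measurable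
  have "(\<integral>\<^sup>+x. \<integral>\<^sup>+y. ennreal \<bar>k (x, y)\<bar> \<partial>lborel \<partial>lborel) = (\<integral>\<^sup>+z. ennreal \<bar>k z\<bar> \<partial>(lborel \<Otimes>\<^sub>M lborel))"
    using lborel.nn_integral_fst[OF km] by simp
  then show ?thesis by (simp add: integrable_iff_bounded lborel_prod)
qed

lemma difference_quotient_powr:
  fixes n m :: real
  assumes "n \<ge> 0" "m \<ge> 0" "p > 0"
  shows "(m / n powr (s + d / p)) powr p = m powr p * n powr (- (s * p + d))"
proof -
  have "(s + d / p) * p = s * p + d" using assms by (simp add: field_simps)
  moreover have "(m / n powr (s + d / p)) powr p = m powr p / (n powr ((s + d / p) * p))"
    using assms by (simp add: powr_divide powr_powr)
  ultimately show ?thesis by (simp only: powr_minus_divide) simp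
qed

text \<open>The Gagliardo seminorm in the definition of the space, read off componentwise for a Borel
  representative.\<close>

proposition oscillation_L2_of_fractional_Sobolev:
  fixes F :: "'a::euclidean_space \<Rightarrow> 'b::euclidean_space" and f :: "'a \<Rightarrow> real"
  assumes O: "\<Omega> \<in> sets borel" and F: "F \<in> Sobolev \<alpha> q \<Omega>" and \<alpha>: "0 < \<alpha>" "\<alpha> < 1" and q: "q \<ge> 2" and c: "c \<in> Basis"
    and f: "f \<in> borel_measurable borel" "AE x in lborel. x \<in> \<Omega> \<longrightarrow> F x \<bullet> c = f x"
    and U: "U \<in> sets borel" "bounded U" "\<And>x. x \<in> U \<Longrightarrow> ball x r \<subseteq> \<Omega>" and r: "0 < r" "r \<le> 1" and \<gamma>: "\<gamma> < \<alpha>"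
  shows "(\<integral>\<^sup>+x. indicator U x * (oscillation \<gamma> r f x)\<^sup>2 \<partial>lborel) < top"
proof (rule oscillation_L2_of_gagliardo[OF f(1) U(1) r U(2) \<gamma> q])
  let ?d = "real DIM('a)"
  note [measurable] = f(1) O U(1)
  define h where "h z = norm (F (fst z) - F (snd z)) / norm (fst z - snd z) powr (\<alpha> + ?d / q)" for z
  have "(\<lambda>(x, y). norm (F x - F y) / norm (x - y) powr (\<alpha> + ?d / q)) \<in> Lp_on q (\<Omega> \<times> \<Omega>)"
    using F \<alpha> by (simp add: Sobolev_def)
  moreover have "(\<lambda>(x, y). norm (F x - F y) / norm (x - y) powr (\<alpha> + ?d / q)) = h"
    by (auto simp: h_def fun_eq_iff)
  ultimately have hi: "integrable (lebesgue_on (\<Omega> \<times> \<Omega>)) (\<lambda>z. norm (h z) powr q)"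
    by (simp add: Lp_on_def)
  define k where "k z = \<bar>F (fst z) \<bullet> c - F (snd z) \<bullet> c\<bar> powr q * norm (fst z - snd z) powr (- (\<alpha> * q + ?d))" for z
  define k' where "k' z = indicator \<Omega> (fst z) * indicator \<Omega> (snd z) * (\<bar>f (fst z) - f (snd z)\<bar> powr q * norm (fst z - snd z) powr (- (\<alpha> * q + ?d)))" for z
  have OO [measurable]: "\<Omega> \<times> \<Omega> \<in> sets borel"
    using O by (simp add: borel_prod[symmetric])
  have k'm [measurable]: "k' \<in> borel_measurable borel" unfolding k'_def borel_prod[symmetric] by measurable
  have kk': "AE z in lborel. z \<in> \<Omega> \<times> \<Omega> \<longrightarrow> k z = k' z"
    using AE_lborel_pairI[OF f(2) f(2)] by eventually_elim (auto simp: k_def k'_def)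
  have k'0: "k' z = 0" if "z \<notin> \<Omega> \<times> \<Omega>" for z using that by (cases z) (auto simp: k'_def)
  note tr = lebesgue_on_transfer[OF OO k'm k'0 kk']
  have "integrable (lebesgue_on (\<Omega> \<times> \<Omega>)) k"
  proof (rule Bochner_Integration.integrable_bound[OF hi tr(1)])
    show "AE z in lebesgue_on (\<Omega> \<times> \<Omega>). norm (k z) \<le> norm (norm (h z) powr q)"
    proof (rule AE_I2)
      fix z :: "'a \<times> 'a"
      have "norm (h z) powr q = norm (F (fst z) - F (snd z)) powr q * norm (fst z - snd z) powr (- (\<alpha> * q + ?d))"
        unfolding h_def using q by (simp add: difference_quotient_powr)
      moreover have "\<bar>F (fst z) \<bullet> c - F (snd z) \<bullet> c\<bar> powr q \<le> norm (F (fst z) - F (snd z)) powr q"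
        using q Basis_le_norm[OF c, of "F (fst z) - F (snd z)"] by (intro powr_mono2) (auto simp: inner_diff_left)
      ultimately show "norm (k z) \<le> norm (norm (h z) powr q)"
        unfolding k_def by (simp add: mult_right_mono)
    qed
  qed
  then have "integrable lborel k'" using tr(2) by blast
  then have fin: "(\<integral>\<^sup>+x. \<integral>\<^sup>+y. ennreal \<bar>k' (x, y)\<bar> \<partial>lborel \<partial>lborel) < top"
    by (simp add: integrable_lborel_pair_iff)
  have "(\<integral>\<^sup>+x. \<integral>\<^sup>+y. indicator U x * (indicator (ball x r) y * ennreal (\<bar>f x - f y\<bar> powr q * norm (x - y) powr (- (\<alpha> * q + ?d)))) \<partial>lborel \<partial>lborel)
     \<le> (\<integral>\<^sup>+x. \<integral>\<^sup>+y. ennreal \<bar>k' (x, y)\<bar> \<partial>lborel \<partial>lborel)"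
  proof (intro nn_integral_mono)
    fix x y
    show "indicator U x * (indicator (ball x r) y * ennreal (\<bar>f x - f y\<bar> powr q * norm (x - y) powr (- (\<alpha> * q + ?d)))) \<le> ennreal \<bar>k' (x, y)\<bar>"
    proof (cases "x \<in> U \<and> y \<in> ball x r")
      case True
      then have "x \<in> \<Omega>" "y \<in> \<Omega>" using U(3)[of x] centre_in_ball[of x r] r by blast+
      then show ?thesis using True by (simp add: k'_def)
    qed auto
  qed
  also note fin
  finally show "(\<integral>\<^sup>+x. \<integral>\<^sup>+y. indicator U x * (indicator (ball x r) y * ennreal (\<bar>f x - f y\<bar> powr q * norm (x - y) powr (- (\<alpha> * q + ?d)))) \<partial>lborel \<partial>lborel) < top" .
qed

proposition oscillation_L2_of_Sobolev:
  fixes F :: "'a::euclidean_space \<Rightarrow> 'b::euclidean_space" and f :: "'a \<Rightarrow> real"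
  assumes O: "\<Omega> \<in> sets borel" "bounded \<Omega>" and F: "F \<in> Sobolev \<alpha> q \<Omega>" and \<alpha>: "0 < \<alpha>" "\<alpha> \<le> 1" and q: "q \<ge> 2" and c: "c \<in> Basis"
    and f: "f \<in> borel_measurable borel" "\<And>x. x \<notin> \<Omega> \<Longrightarrow> f x = 0" "AE x in lborel. x \<in> \<Omega> \<longrightarrow> F x \<bullet> c = f x" "integrable lborel f"
    and U: "U \<in> sets borel" "bounded U" "\<And>x. x \<in> U \<Longrightarrow> cball x (3 * r) \<subseteq> \<Omega>" and r: "0 < r" "r \<le> 1" and \<gamma>: "0 < \<gamma>" "\<gamma> < \<alpha>"
  shows "(\<integral>\<^sup>+x. indicator U x * (oscillation \<gamma> r f x)\<^sup>2 \<partial>lborel) < top"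
proof (cases "\<alpha> = 1")
  case False
  show ?thesis
  proof (rule oscillation_L2_of_fractional_Sobolev[OF O(1) F \<alpha>(1) _ q c f(1,3) U(1,2) _ r \<gamma>(2)])
    show "\<alpha> < 1" using False \<alpha> by simp
    fix x assume "x \<in> U"
    moreover have "ball x r \<subseteq> cball x (3 * r)" using r by auto
    ultimately show "ball x r \<subseteq> \<Omega>" using U(3) by blast
  qed
next
  case True
  then have FL: "F \<in> Lp_on q \<Omega>" and "\<forall>j\<in>Basis. \<exists>W\<in>Lp_on q \<Omega>. weak_partial \<Omega> j F W"
    using F by (auto simp: Sobolev_def)
  then obtain W where W: "\<And>j. j \<in> Basis \<Longrightarrow> W j \<in> Lp_on q \<Omega>" "\<And>j. j \<in> Basis \<Longrightarrow> weak_partial \<Omega> j F (W j)" by metis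
  have "\<forall>j\<in>Basis. \<exists>w. w \<in> borel_measurable borel \<and> (\<forall>x. x \<notin> \<Omega> \<longrightarrow> w x = 0) \<and> (AE x in lborel. x \<in> \<Omega> \<longrightarrow> W j x \<bullet> c = w x)
     \<and> integrable lborel w \<and> (\<integral>\<^sup>+x. (ennreal \<bar>w x\<bar>)\<^sup>2 \<partial>lborel) < top"
  proof
    fix j :: 'a assume j: "j \<in> Basis"
    show "\<exists>w. w \<in> borel_measurable borel \<and> (\<forall>x. x \<notin> \<Omega> \<longrightarrow> w x = 0) \<and> (AE x in lborel. x \<in> \<Omega> \<longrightarrow> W j x \<bullet> c = w x)
       \<and> integrable lborel w \<and> (\<integral>\<^sup>+x. (ennreal \<bar>w x\<bar>)\<^sup>2 \<partial>lborel) < top"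
      by (rule Lp_component_representative[OF O W(1)[OF j] q c]) blast
  qed
  from bchoice[OF this] obtain w where w':
    "\<forall>j\<in>Basis. w j \<in> borel_measurable borel \<and> (\<forall>x. x \<notin> \<Omega> \<longrightarrow> w j x = 0) \<and> (AE x in lborel. x \<in> \<Omega> \<longrightarrow> W j x \<bullet> c = w j x)
     \<and> integrable lborel (w j) \<and> (\<integral>\<^sup>+x. (ennreal \<bar>w j x\<bar>)\<^sup>2 \<partial>lborel) < top"
    by blast
  then have w: "\<And>j. j \<in> Basis \<Longrightarrow> w j \<in> borel_measurable borel" "\<And>j x. j \<in> Basis \<Longrightarrow> x \<notin> \<Omega> \<Longrightarrow> w j x = 0"
    "\<And>j. j \<in> Basis \<Longrightarrow> AE x in lborel. x \<in> \<Omega> \<longrightarrow> W j x \<bullet> c = w j x"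
    "\<And>j. j \<in> Basis \<Longrightarrow> integrable lborel (w j)" "\<And>j. j \<in> Basis \<Longrightarrow> (\<integral>\<^sup>+x. (ennreal \<bar>w j x\<bar>)\<^sup>2 \<partial>lborel) < top"
    by blast+
  obtain N where "\<Omega> \<subseteq> ball 0 N" using bounded_subset_ballD[OF O(2), of 0] by blast
  then have N: "f x = 0" if "x \<notin> ball 0 N" for x using f(2) that by blast
  show ?thesis
  proof (rule oscillation_L2_of_weak_derivative[where \<Omega> = \<Omega> and w = w, OF f(4) N w(4,5) _ U(1,2,3) r(1) \<gamma>(1)])
    fix j :: 'a and \<phi> assume j: "j \<in> Basis" and \<phi>: "\<phi> \<in> test_functions \<Omega>"
    show "(LINT y|lborel. f y * pd j \<phi> y) = - (LINT y|lborel. w j y * \<phi> y)"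
      by (rule weak_partial_component[OF O(1) W(2)[OF j] j Lp_on_integrable[OF O FL] Lp_on_integrable[OF O W(1)[OF j]]
            f(1,2,3) w(1)[OF j] w(2)[OF j] w(3)[OF j] \<phi>]) (use q in auto)
  qed (use \<gamma> True in auto)
qed

lemma norm_powr_le_components:
  fixes v :: "'a::euclidean_space"
  assumes "p \<ge> 0"
  shows "norm v powr p \<le> real DIM('a) powr p * (\<Sum>j\<in>Basis. \<bar>v \<bullet> j\<bar> powr p)"
proof -
  have "norm v powr p \<le> (\<Sum>j\<in>Basis. \<bar>v \<bullet> j\<bar>) powr p"
    using assms norm_le_l1[of v] by (intro powr_mono2) auto
  also have "\<dots> \<le> real DIM('a) powr p * (\<Sum>j\<in>Basis. \<bar>v \<bullet> j\<bar> powr p)"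
    using assms by (intro powr_sum_le) auto
  finally show ?thesis .
qed

text \<open>The difference quotient is compared with finitely many Borel functions on the product space,
  where Tonelli's theorem turns integrability into finiteness of the iterated integrals.\<close>

proposition Sobolev_of_components:
  fixes D :: "'a::euclidean_space \<Rightarrow> 'b::euclidean_space" and w :: "'b \<Rightarrow> 'a \<Rightarrow> real"
  assumes U: "U \<in> sets borel" "bounded U"
    and w: "\<And>j. j \<in> Basis \<Longrightarrow> w j \<in> borel_measurable borel" "\<And>j. j \<in> Basis \<Longrightarrow> AE x in lborel. x \<in> U \<longrightarrow> D x \<bullet> j = w j x"
      "\<And>j. j \<in> Basis \<Longrightarrow> integrable lborel (\<lambda>x. \<bar>w j x\<bar> powr 2)"
    and p: "1 \<le> p" "p \<le> 2" and \<sigma>: "0 \<le> \<sigma>" "\<sigma> < 1"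
    and gag: "\<And>j. j \<in> Basis \<Longrightarrow> (\<integral>\<^sup>+x. \<integral>\<^sup>+y. indicator U x * (indicator U y * ennreal (\<bar>w j x - w j y\<bar> powr p * norm (x - y) powr (- (real DIM('a) + \<sigma> * p)))) \<partial>lborel \<partial>lborel) < top"
  shows "D \<in> Sobolev \<sigma> p U"
proof -
  let ?d = "real DIM('a)"
  note [measurable] = U(1)
  have Lp: "D \<in> Lp_on p U"
    unfolding Lp_on_def
  proof (intro CollectI conjI)
    have one: "(\<lambda>x. D x \<bullet> j) \<in> borel_measurable (lebesgue_on U) \<and> integrable (lebesgue_on U) (\<lambda>x. \<bar>D x \<bullet> j\<bar> powr p)" if j: "j \<in> Basis" for j
    proof -
      note [measurable] = w(1)[OF j]
      have "(\<lambda>x. D x \<bullet> j) \<in> borel_measurable (lebesgue_on U)"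
      proof (rule lebesgue_on_transfer(1)[OF U(1), where f' = "\<lambda>x. indicator U x * w j x"])
        show "AE x in lborel. x \<in> U \<longrightarrow> D x \<bullet> j = indicator U x * w j x"
          using w(2)[OF j] by eventually_elim auto
      qed auto
      moreover have "integrable (lebesgue_on U) (\<lambda>x. \<bar>D x \<bullet> j\<bar> powr p) \<longleftrightarrow> integrable lborel (\<lambda>x. indicator U x * \<bar>w j x\<bar> powr p)"
      proof (rule lebesgue_on_transfer(2)[OF U(1)])
        show "AE x in lborel. x \<in> U \<longrightarrow> \<bar>D x \<bullet> j\<bar> powr p = indicator U x * \<bar>w j x\<bar> powr p"
          using w(2)[OF j] by eventually_elim auto
      qed auto
      moreover have "integrable lborel (\<lambda>x. indicator U x * \<bar>w j x\<bar> powr p)"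
        using p by (intro integrable_powr_mono[OF w(1)[OF j] U _ _ w(3)[OF j]]) auto
      ultimately show ?thesis by blast
    qed
    show Dm: "D \<in> borel_measurable (lebesgue_on U)"
      by (rule borel_measurable_euclidean_space[THEN iffD2]) (use one in blast)
    show "integrable (lebesgue_on U) (\<lambda>x. norm (D x) powr p)"
    proof (rule Bochner_Integration.integrable_bound)
      show "integrable (lebesgue_on U) (\<lambda>x. real DIM('b) powr p * (\<Sum>j\<in>Basis. \<bar>D x \<bullet> j\<bar> powr p))"
        using one by (intro integrable_mult_right Bochner_Integration.integrable_sum) blast
      show "(\<lambda>x. norm (D x) powr p) \<in> borel_measurable (lebesgue_on U)" using Dm by measurable
      show "AE x in lebesgue_on U. norm (norm (D x) powr p) \<le> norm (real DIM('b) powr p * (\<Sum>j\<in>Basis. \<bar>D x \<bullet> j\<bar> powr p))"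
      proof (rule AE_I2)
        fix x
        have "0 \<le> real DIM('b) powr p * (\<Sum>j\<in>Basis. \<bar>D x \<bullet> j\<bar> powr p)" by (intro mult_nonneg_nonneg sum_nonneg) auto
        then show "norm (norm (D x) powr p) \<le> norm (real DIM('b) powr p * (\<Sum>j\<in>Basis. \<bar>D x \<bullet> j\<bar> powr p))"
          using norm_powr_le_components[of p "D x"] p by simp
      qed
    qed
  qed
  define h where "h z = norm (D (fst z) - D (snd z)) / norm (fst z - snd z) powr (\<sigma> + ?d / p)" for z :: "'a \<times> 'a"
  have UU [measurable]: "U \<times> U \<in> sets borel" using U(1) by (simp add: borel_prod[symmetric])
  have one: "(\<lambda>z. D (fst z) \<bullet> j) \<in> borel_measurable (lebesgue_on (U \<times> U)) \<and> (\<lambda>z. D (snd z) \<bullet> j) \<in> borel_measurable (lebesgue_on (U \<times> U))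
    \<and> integrable (lebesgue_on (U \<times> U)) (\<lambda>z. \<bar>(D (fst z) - D (snd z)) \<bullet> j\<bar> powr p * norm (fst z - snd z) powr (- (\<sigma> * p + ?d)))"
    if j: "j \<in> Basis" for j
  proof (intro conjI)
    note [measurable] = w(1)[OF j]
    note ae = AE_lborel_pairI[OF w(2)[OF j] w(2)[OF j]]
    show "(\<lambda>z. D (fst z) \<bullet> j) \<in> borel_measurable (lebesgue_on (U \<times> U))"
    proof (rule lebesgue_on_transfer(1)[OF UU, where f' = "\<lambda>z. indicator U (fst z) * indicator U (snd z) * w j (fst z)"])
      show "(\<lambda>z. indicator U (fst z) * indicator U (snd z) * w j (fst z)) \<in> borel_measurable borel"
        unfolding borel_prod[symmetric] by measurable
      show "AE z in lborel. z \<in> U \<times> U \<longrightarrow> D (fst z) \<bullet> j = indicator U (fst z) * indicator U (snd z) * w j (fst z)"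
        using ae by eventually_elim auto
    qed (auto simp: indicator_def)
    show "(\<lambda>z. D (snd z) \<bullet> j) \<in> borel_measurable (lebesgue_on (U \<times> U))"
    proof (rule lebesgue_on_transfer(1)[OF UU, where f' = "\<lambda>z. indicator U (fst z) * indicator U (snd z) * w j (snd z)"])
      show "(\<lambda>z. indicator U (fst z) * indicator U (snd z) * w j (snd z)) \<in> borel_measurable borel"
        unfolding borel_prod[symmetric] by measurable
      show "AE z in lborel. z \<in> U \<times> U \<longrightarrow> D (snd z) \<bullet> j = indicator U (fst z) * indicator U (snd z) * w j (snd z)"
        using ae by eventually_elim auto
    qed (auto simp: indicator_def)
    define k where "k z = indicator U (fst z) * indicator U (snd z) * (\<bar>w j (fst z) - w j (snd z)\<bar> powr p * norm (fst z - snd z) powr (- (\<sigma> * p + ?d)))" for z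
    have km [measurable]: "k \<in> borel_measurable borel" unfolding k_def borel_prod[symmetric] by measurable
    have "integrable (lebesgue_on (U \<times> U)) (\<lambda>z. \<bar>(D (fst z) - D (snd z)) \<bullet> j\<bar> powr p * norm (fst z - snd z) powr (- (\<sigma> * p + ?d))) \<longleftrightarrow> integrable lborel k"
    proof (rule lebesgue_on_transfer(2)[OF UU km])
      show "AE z in lborel. z \<in> U \<times> U \<longrightarrow> \<bar>(D (fst z) - D (snd z)) \<bullet> j\<bar> powr p * norm (fst z - snd z) powr (- (\<sigma> * p + ?d)) = k z"
        using ae by eventually_elim (auto simp: k_def inner_diff_left)
    qed (auto simp: k_def indicator_def)
    moreover have "integrable lborel k"
    proof -
      have "(\<integral>\<^sup>+x. \<integral>\<^sup>+y. ennreal \<bar>k (x, y)\<bar> \<partial>lborel \<partial>lborel) = (\<integral>\<^sup>+x. \<integral>\<^sup>+y. indicator U x * (indicator U y * ennreal (\<bar>w j x - w j y\<bar> powr p * norm (x - y) powr (- (real DIM('a) + \<sigma> * p)))) \<partial>lborel \<partial>lborel)"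
      proof (intro nn_integral_cong)
        fix x y
        show "ennreal \<bar>k (x, y)\<bar> = indicator U x * (indicator U y * ennreal (\<bar>w j x - w j y\<bar> powr p * norm (x - y) powr (- (real DIM('a) + \<sigma> * p))))"
          by (cases "x \<in> U"; cases "y \<in> U") (simp_all add: k_def add.commute)
      qed
      then show ?thesis unfolding integrable_lborel_pair_iff[OF km] using gag[OF j] by simp
    qed
    ultimately show "integrable (lebesgue_on (U \<times> U)) (\<lambda>z. \<bar>(D (fst z) - D (snd z)) \<bullet> j\<bar> powr p * norm (fst z - snd z) powr (- (\<sigma> * p + ?d)))"
      by blast
  qed
  have Dfm: "(\<lambda>z. D (fst z)) \<in> borel_measurable (lebesgue_on (U \<times> U))" "(\<lambda>z. D (snd z)) \<in> borel_measurable (lebesgue_on (U \<times> U))"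
    by (rule borel_measurable_euclidean_space[THEN iffD2], use one in blast)+
  have nm: "(\<lambda>z. norm (fst z - snd z) powr e) \<in> borel_measurable (lebesgue_on (U \<times> U))" for e
    by (rule borel_measurable_lebesgue_on_borel) (unfold borel_prod[symmetric], measurable)
  note [measurable] = Dfm nm
  have hm: "h \<in> borel_measurable (lebesgue_on (U \<times> U))" unfolding h_def by measurable
  have "integrable (lebesgue_on (U \<times> U)) (\<lambda>z. norm (h z) powr p)"
  proof (rule Bochner_Integration.integrable_bound)
    show "integrable (lebesgue_on (U \<times> U)) (\<lambda>z. real DIM('b) powr p * (\<Sum>j\<in>Basis. \<bar>(D (fst z) - D (snd z)) \<bullet> j\<bar> powr p * norm (fst z - snd z) powr (- (\<sigma> * p + ?d))))"
      using one by (intro integrable_mult_right Bochner_Integration.integrable_sum) blast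
    show "(\<lambda>z. norm (h z) powr p) \<in> borel_measurable (lebesgue_on (U \<times> U))" using hm by measurable
    show "AE z in lebesgue_on (U \<times> U). norm (norm (h z) powr p) \<le> norm (real DIM('b) powr p * (\<Sum>j\<in>Basis. \<bar>(D (fst z) - D (snd z)) \<bullet> j\<bar> powr p * norm (fst z - snd z) powr (- (\<sigma> * p + ?d))))"
    proof (rule AE_I2)
      fix z :: "'a \<times> 'a"
      let ?n = "norm (fst z - snd z) powr (- (\<sigma> * p + ?d))" and ?v = "D (fst z) - D (snd z)"
      have "norm (h z) powr p = norm ?v powr p * ?n"
        unfolding h_def using p by (simp add: difference_quotient_powr)
      also have "\<dots> \<le> (real DIM('b) powr p * (\<Sum>j\<in>Basis. \<bar>?v \<bullet> j\<bar> powr p)) * ?n"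
        using p by (intro mult_right_mono norm_powr_le_components) auto
      also have "\<dots> = real DIM('b) powr p * (\<Sum>j\<in>Basis. \<bar>?v \<bullet> j\<bar> powr p * ?n)"
        by (simp only: sum_distrib_right mult.assoc)
      finally show "norm (norm (h z) powr p) \<le> norm (real DIM('b) powr p * (\<Sum>j\<in>Basis. \<bar>?v \<bullet> j\<bar> powr p * ?n))"
        by simp
    qed
  qed
  with hm have "h \<in> Lp_on p (U \<times> U)" by (simp add: Lp_on_def)
  moreover have "(\<lambda>(x, y). norm (D x - D y) / norm (x - y) powr (\<sigma> + ?d / p)) = h"
    by (auto simp: h_def fun_eq_iff)
  ultimately show ?thesis using Lp \<sigma> by (simp add: Sobolev_def)
qed

text \<open>A ball around a point of \<open>U\<close> that leaves \<open>\<Omega>\<close> meets the frontier, by connectedness.\<close>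

lemma compactly_inside_cball:
  assumes "compactly_inside U \<Omega>" "open \<Omega>"
  obtains e where "e > 0" "\<And>x. x \<in> U \<Longrightarrow> cball x e \<subseteq> \<Omega>"
proof -
  define s where "s = setdist U (frontier \<Omega>)"
  have s: "s > 0" and sub: "U \<subseteq> \<Omega>" using assms by (auto simp: compactly_inside_def s_def)
  have "cball x (s / 2) \<subseteq> \<Omega>" if x: "x \<in> U" for x
  proof (rule ccontr)
    assume "\<not> cball x (s / 2) \<subseteq> \<Omega>"
    then obtain z where z: "z \<in> cball x (s / 2)" "z \<notin> \<Omega>" by blast
    have "cball x (s / 2) \<inter> frontier \<Omega> \<noteq> {}"
    proof (rule connected_Int_frontier)
      show "cball x (s / 2) \<inter> \<Omega> \<noteq> {}" using x sub s centre_in_cball[of x "s / 2"] by fastforce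
      show "cball x (s / 2) - \<Omega> \<noteq> {}" using z by blast
    qed (simp add: convex_connected)
    then obtain y where y: "y \<in> cball x (s / 2)" "y \<in> frontier \<Omega>" by blast
    have "s \<le> dist x y" unfolding s_def using x y by (intro setdist_le_dist)
    then show False using y s by simp
  qed
  then show ?thesis using that[of "s / 2"] s by simp
qed

section \<open>Regularity of the gradient\<close>

theorem corollary5p5:
  fixes \<Omega> \<Omega>' :: "'a::euclidean_space set"
    and a g u :: "'a \<Rightarrow> real"
    and F Du :: "'a \<Rightarrow> 'a"
    and a_low q \<alpha> \<theta> :: real
  assumes "bounded \<Omega>" and "open \<Omega>"
    and "a \<in> Linf_on \<Omega>"
    and "a_low > 0" and "AE x in lebesgue_on \<Omega>. a x \<ge> a_low"
    and "q \<ge> 2" and "0 < \<alpha>" and "\<alpha> \<le> 1"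
    and "real DIM('a) / 2 < \<alpha> * q" and "\<alpha> * q \<le> real DIM('a)"
    and "g \<in> Lp_on q \<Omega>"
    and "AE (x, y) in lebesgue_on (\<Omega> \<times> \<Omega>). \<bar>a x - a y\<bar> \<le> g x * norm (x - y) powr \<alpha>"
    and "F \<in> Sobolev \<alpha> q \<Omega>"
    and "u \<in> Sobolev 1 2 \<Omega>"
    and "weak_solution \<Omega> a F u"
    and "weak_gradient \<Omega> u Du"
    and "compactly_inside \<Omega>' \<Omega>"
    and "\<theta> > 0" and "theta_smooth \<theta> \<Omega>'"
  shows "\<forall>\<beta> \<in> {0<..<\<alpha>} \<inter> {(3 * \<alpha> - real DIM('a)) / 2 .. \<alpha> * q - real DIM('a) / 2}.
           \<forall>\<beta>'. 0 \<le> \<beta>' \<and> \<beta>' < \<beta> \<longrightarrow>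
             Du \<in> Sobolev \<beta>' (2 * \<alpha> * q / (real DIM('a) + 2 * \<beta>)) \<Omega>'"
proof (intro ballI allI impI)
  fix \<beta> \<beta>'
  assume \<beta>: "\<beta> \<in> {0<..<\<alpha>} \<inter> {(3 * \<alpha> - real DIM('a)) / 2 .. \<alpha> * q - real DIM('a) / 2}"
    and \<beta>': "0 \<le> \<beta>' \<and> \<beta>' < \<beta>"
  let ?d = "real DIM('a)"
  define p where "p = 2 * \<alpha> * q / (?d + 2 * \<beta>)"
  define \<gamma> where "\<gamma> = (\<beta>' + \<beta>) / 2"
  have d0: "?d > 0" by simp
  have b: "0 < \<beta>" "\<beta> < \<alpha>" "\<beta> \<le> \<alpha> * q - ?d / 2" using \<beta> by auto
  have gam: "0 < \<gamma>" "\<beta>' < \<gamma>" "\<gamma> < \<beta>" using \<beta>' b by (auto simp: \<gamma>_def)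
  have dd: "?d + 2 * \<beta> > 0" using d0 b by linarith
  have p1: "1 \<le> p" unfolding p_def using b dd by (simp add: le_divide_eq)
  have p2: "p < 2" unfolding p_def using b dd assms(10) by (simp add: divide_less_eq)
  \<comment> \<open>Equivalent to $1/2 + \beta/(\alpha q) \le 1/p$, which is where $\alpha q \le d$ enters.\<close>
  have pe: "\<beta> / \<alpha> * (2 * p / (2 - p)) \<le> q"
  proof -
    have "p * (?d + 2 * \<beta>) = 2 * (\<alpha> * q)" unfolding p_def using dd by simp
    moreover have "p * (\<alpha> * q) \<le> p * ?d" using assms(10) p1 by (intro mult_left_mono) auto
    ultimately have "2 * \<beta> * p \<le> \<alpha> * q * (2 - p)" by (simp add: algebra_simps)
    then show ?thesis using p2 assms(7) by (simp add: field_simps)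
  qed
  have Ob: "\<Omega> \<in> sets borel" using assms(2) by simp
  note O = Ob assms(1)
  have U: "\<Omega>' \<in> sets borel" "bounded \<Omega>'" "\<Omega>' \<subseteq> \<Omega>"
    using assms(17,19) by (auto simp: compactly_inside_def theta_smooth_def)
  obtain e where e: "e > 0" "\<And>x. x \<in> \<Omega>' \<Longrightarrow> cball x e \<subseteq> \<Omega>"
    using compactly_inside_cball[OF assms(17,2)] by blast
  \<comment> \<open>The oscillation integrals have radius \<open>2 * R\<close>; their bound needs three times that distance to the
    boundary, and radius at most 1.\<close>
  define R where "R = min (e / 6) (1 / 2)"
  have R: "R > 0" "2 * R \<le> 1" "6 * R \<le> e" using e by (auto simp: R_def)
  have cb: "cball x r \<subseteq> \<Omega>" if "x \<in> \<Omega>'" "r \<le> 6 * R" for x r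
  proof -
    have "cball x r \<subseteq> cball x e" using that R by (intro subset_cball) auto
    then show ?thesis using e(2)[OF that(1)] by blast
  qed
  have cb2: "\<And>x. x \<in> \<Omega>' \<Longrightarrow> cball x (2 * R) \<subseteq> \<Omega>" using cb R(1) by simp
  note [measurable] = Ob U(1)
  obtain A where aL: "a \<in> borel_measurable (lebesgue_on \<Omega>)" and A: "AE x in lebesgue_on \<Omega>. norm (a x) \<le> A"
    using assms(3) by (auto simp: Linf_on_def)
  obtain a1 where a1: "a1 \<in> borel_measurable borel" "AE x in lborel. x \<in> \<Omega> \<longrightarrow> a x = a1 x"
    using lebesgue_on_borel_representative[OF Ob aL] by blast
  \<comment> \<open>The essential bound becomes a bound everywhere by clipping.\<close>
  define A0 where "A0 = max A 0"
  define a' where "a' x = max (- A0) (min A0 (a1 x))" for x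
  have a'm: "a' \<in> borel_measurable borel" unfolding a'_def using a1(1) by measurable
  have a'b: "\<bar>a' x\<bar> \<le> A0" for x by (auto simp: a'_def A0_def)
  have aa': "AE x in lborel. x \<in> \<Omega> \<longrightarrow> a x = a' x"
    using A[unfolded AE_lebesgue_on_iff[OF Ob]] a1(2) by eventually_elim (auto simp: a'_def A0_def)
  have low: "AE x in lborel. x \<in> \<Omega> \<longrightarrow> a_low \<le> a' x"
    using assms(5)[unfolded AE_lebesgue_on_iff[OF Ob]] aa' by eventually_elim auto
  obtain g' where g': "g' \<in> borel_measurable borel" "AE x in lborel. x \<in> \<Omega> \<longrightarrow> g x \<bullet> 1 = g' x" "integrable lborel (\<lambda>x. \<bar>g' x\<bar> powr q)"
    by (rule Lp_component_representative[OF O assms(11,6), of 1]) auto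
  have gq: "(\<integral>\<^sup>+x. ennreal (\<bar>g' x\<bar> powr q) \<partial>lborel) < top"
    using g'(3) by (simp add: integrable_iff_bounded)
  have hol: "AE x in lborel. AE y in lborel. x \<in> \<Omega> \<longrightarrow> y \<in> \<Omega> \<longrightarrow> \<bar>a' x - a' y\<bar> \<le> \<bar>g' x\<bar> * norm (x - y) powr \<alpha>"
  proof -
    have OO: "\<Omega> \<times> \<Omega> \<in> sets borel" using assms(2) by (intro borel_open open_Times)
    have "AE z in (lborel :: ('a \<times> 'a) measure). z \<in> \<Omega> \<times> \<Omega> \<longrightarrow> \<bar>a' (fst z) - a' (snd z)\<bar> \<le> \<bar>g' (fst z)\<bar> * norm (fst z - snd z) powr \<alpha>"
      using assms(12)[unfolded AE_lebesgue_on_iff[OF OO]] AE_lborel_pairI[OF aa' aa'] AE_lborel_pairI[OF g'(2) g'(2)]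
    proof eventually_elim
      case (elim z)
      show ?case
      proof
        assume z: "z \<in> \<Omega> \<times> \<Omega>"
        then have "\<bar>a' (fst z) - a' (snd z)\<bar> \<le> g' (fst z) * norm (fst z - snd z) powr \<alpha>"
          using elim by (auto simp: case_prod_beta)
        also have "\<dots> \<le> \<bar>g' (fst z)\<bar> * norm (fst z - snd z) powr \<alpha>" by (intro mult_right_mono) auto
        finally show "\<bar>a' (fst z) - a' (snd z)\<bar> \<le> \<bar>g' (fst z)\<bar> * norm (fst z - snd z) powr \<alpha>" .
      qed
    qed
    then have "AE z in lborel \<Otimes>\<^sub>M lborel. z \<in> \<Omega> \<times> \<Omega> \<longrightarrow> \<bar>a' (fst z) - a' (snd z)\<bar> \<le> \<bar>g' (fst z)\<bar> * norm (fst z - snd z) powr \<alpha>"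
      by (simp only: lborel_prod)
    from lborel_pair.AE_pair[OF this] show ?thesis by (simp only: mem_Times_iff fst_conv snd_conv imp_conjL)
  qed
  have uL: "u \<in> Lp_on 2 \<Omega>" and "\<forall>j\<in>Basis. \<exists>W\<in>Lp_on 2 \<Omega>. weak_partial \<Omega> j u W"
    using assms(14) by (auto simp: Sobolev_def)
  then obtain W where W: "\<And>j. j \<in> Basis \<Longrightarrow> W j \<in> Lp_on 2 \<Omega>" "\<And>j. j \<in> Basis \<Longrightarrow> weak_partial \<Omega> j u (W j)"
    by metis
  obtain u' where u': "u' \<in> borel_measurable borel" "\<And>x. x \<notin> \<Omega> \<Longrightarrow> u' x = 0" "AE x in lborel. x \<in> \<Omega> \<longrightarrow> u x \<bullet> 1 = u' x"
    by (rule Lp_component_representative[OF O uL order_refl, of 1]) auto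
  have "\<forall>j\<in>Basis. \<exists>w. w \<in> borel_measurable borel \<and> (\<forall>x. x \<notin> \<Omega> \<longrightarrow> w x = 0) \<and> (AE x in lborel. x \<in> \<Omega> \<longrightarrow> W j x \<bullet> 1 = w x)
     \<and> integrable lborel w \<and> (\<integral>\<^sup>+x. (ennreal \<bar>w x\<bar>)\<^sup>2 \<partial>lborel) < top \<and> integrable lborel (\<lambda>x. \<bar>w x\<bar> powr 2)"
  proof
    fix j :: 'a assume j: "j \<in> Basis"
    show "\<exists>w. w \<in> borel_measurable borel \<and> (\<forall>x. x \<notin> \<Omega> \<longrightarrow> w x = 0) \<and> (AE x in lborel. x \<in> \<Omega> \<longrightarrow> W j x \<bullet> 1 = w x)
       \<and> integrable lborel w \<and> (\<integral>\<^sup>+x. (ennreal \<bar>w x\<bar>)\<^sup>2 \<partial>lborel) < top \<and> integrable lborel (\<lambda>x. \<bar>w x\<bar> powr 2)"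
      by (rule Lp_component_representative[OF O W(1)[OF j] order_refl, of 1]) (simp, blast)
  qed
  from bchoice[OF this] obtain w where
    "\<forall>j\<in>Basis. w j \<in> borel_measurable borel \<and> (\<forall>x. x \<notin> \<Omega> \<longrightarrow> w j x = 0) \<and> (AE x in lborel. x \<in> \<Omega> \<longrightarrow> W j x \<bullet> 1 = w j x)
     \<and> integrable lborel (w j) \<and> (\<integral>\<^sup>+x. (ennreal \<bar>w j x\<bar>)\<^sup>2 \<partial>lborel) < top \<and> integrable lborel (\<lambda>x. \<bar>w j x\<bar> powr 2)"
    by blast
  then have w: "\<And>j. j \<in> Basis \<Longrightarrow> w j \<in> borel_measurable borel" "\<And>j x. j \<in> Basis \<Longrightarrow> x \<notin> \<Omega> \<Longrightarrow> w j x = 0"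
    "\<And>j. j \<in> Basis \<Longrightarrow> AE x in lborel. x \<in> \<Omega> \<longrightarrow> W j x \<bullet> 1 = w j x"
    "\<And>j. j \<in> Basis \<Longrightarrow> integrable lborel (w j)" "\<And>j. j \<in> Basis \<Longrightarrow> (\<integral>\<^sup>+x. (ennreal \<bar>w j x\<bar>)\<^sup>2 \<partial>lborel) < top"
    "\<And>j. j \<in> Basis \<Longrightarrow> integrable lborel (\<lambda>x. \<bar>w j x\<bar> powr 2)"
    by blast+
  have FL: "F \<in> Lp_on 2 \<Omega>" using assms(15) by (simp add: weak_solution_def)
  have "\<forall>j\<in>Basis. \<exists>f. f \<in> borel_measurable borel \<and> (\<forall>x. x \<notin> \<Omega> \<longrightarrow> f x = 0) \<and> (AE x in lborel. x \<in> \<Omega> \<longrightarrow> F x \<bullet> j = f x) \<and> integrable lborel f"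
  proof
    fix j :: 'a assume j: "j \<in> Basis"
    show "\<exists>f. f \<in> borel_measurable borel \<and> (\<forall>x. x \<notin> \<Omega> \<longrightarrow> f x = 0) \<and> (AE x in lborel. x \<in> \<Omega> \<longrightarrow> F x \<bullet> j = f x) \<and> integrable lborel f"
      by (rule Lp_component_representative[OF O FL order_refl j]) blast
  qed
  from bchoice[OF this] obtain f where
    "\<forall>j\<in>Basis. f j \<in> borel_measurable borel \<and> (\<forall>x. x \<notin> \<Omega> \<longrightarrow> f j x = 0) \<and> (AE x in lborel. x \<in> \<Omega> \<longrightarrow> F x \<bullet> j = f j x) \<and> integrable lborel (f j)"
    by blast
  then have f: "\<And>j. j \<in> Basis \<Longrightarrow> f j \<in> borel_measurable borel" "\<And>j x. j \<in> Basis \<Longrightarrow> x \<notin> \<Omega> \<Longrightarrow> f j x = 0"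
    "\<And>j. j \<in> Basis \<Longrightarrow> AE x in lborel. x \<in> \<Omega> \<longrightarrow> F x \<bullet> j = f j x" "\<And>j. j \<in> Basis \<Longrightarrow> integrable lborel (f j)"
    by blast+
  have weak: "(LINT y|lborel. u' y * pd j \<phi> y) = - (LINT y|lborel. w j y * \<phi> y)" if j: "j \<in> Basis" and \<phi>: "\<phi> \<in> test_functions \<Omega>" for j \<phi>
    by (rule weak_partial_component[OF Ob W(2)[OF j] j Lp_on_integrable[OF O uL] Lp_on_integrable[OF O W(1)[OF j]]
          u' w(1)[OF j] w(2)[OF j] w(3)[OF j] \<phi>]) auto
  \<comment> \<open>The weak gradient in the equation and \<open>Du\<close> are representatives of the same class.\<close>
  have grad_eq: "AE x in lborel. x \<in> \<Omega> \<longrightarrow> G x \<bullet> j = w j x" if G: "weak_gradient \<Omega> u G" and j: "j \<in> Basis" for G j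
  proof -
    have "weak_partial \<Omega> j u (\<lambda>x. G x \<bullet> j)" using G j by (simp add: weak_gradient_def)
    from weak_partial_unique[OF assms(2,1) this W(2)[OF j]] w(3)[OF j]
    show ?thesis by eventually_elim auto
  qed
  have eqn: "(\<Sum>j\<in>Basis. LINT y|lborel. a' y * w j y * pd j \<phi> y) = - (\<Sum>j\<in>Basis. LINT y|lborel. f j y * pd j \<phi> y)"
    if \<phi>: "\<phi> \<in> test_functions \<Omega>" for \<phi>
  proof -
    obtain G where G: "weak_gradient \<Omega> u G"
      and Geq: "(LINT x|lebesgue_on \<Omega>. a x * (G x \<bullet> grad \<phi> x)) = - (LINT x|lebesgue_on \<Omega>. F x \<bullet> grad \<phi> x)"
      using assms(15) \<phi> unfolding weak_solution_def by blast
    have "(LINT x|lebesgue_on \<Omega>. a x * (G x \<bullet> grad \<phi> x)) = (\<Sum>j\<in>Basis. LINT y|lborel. a' y * w j y * pd j \<phi> y)"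
      by (rule grad_integral[OF Ob \<phi> w(1,2) grad_eq[OF G] w(4) a'm a'b aa'])
    moreover have "(LINT x|lebesgue_on \<Omega>. 1 * (F x \<bullet> grad \<phi> x)) = (\<Sum>j\<in>Basis. LINT y|lborel. 1 * f j y * pd j \<phi> y)"
      by (rule grad_integral[OF Ob \<phi> f, where B = 1]) auto
    ultimately show ?thesis using Geq by simp
  qed
  have osc: "(\<integral>\<^sup>+x. indicator \<Omega>' x * (oscillation \<gamma> (2 * R) (f j) x)\<^sup>2 \<partial>lborel) < top" if j: "j \<in> Basis" for j
    by (rule oscillation_L2_of_Sobolev[OF O assms(13,7,8,6) j f(1)[OF j] f(2)[OF j] f(3)[OF j] f(4)[OF j] U(1,2)])
      (use cb R gam b in auto)
  let ?B = "holder_weight \<alpha> \<beta> \<gamma> (2 * R) f w g'"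
  have Bp: "(\<integral>\<^sup>+x. indicator \<Omega>' x * ennreal (?B x powr p) \<partial>lborel) < top"
    by (rule holder_weight_Lp[OF f(1) w(1,5) g'(1) gq U(1,2) _ gam(3) osc _ p2 _ pe])
      (use R p1 b assms(7) in auto)
  have Bm: "?B \<in> borel_measurable borel" by (rule holder_weight_measurable[OF f(1) w(1) g'(1)])
  have B0: "?B x \<ge> 0" for x unfolding holder_weight_def by (intro sum_nonneg) auto
  have "Du \<in> Sobolev \<beta>' p \<Omega>'"
  proof (rule Sobolev_of_components[OF U(1,2) w(1) _ w(6) p1])
    fix j :: 'a assume j: "j \<in> Basis"
    show "AE x in lborel. x \<in> \<Omega>' \<longrightarrow> Du x \<bullet> j = w j x"
      using grad_eq[OF assms(16) j] by eventually_elim (use U(3) in blast)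
    obtain S C where S: "AE x in lborel. x \<in> S" and C: "C \<ge> 0"
      "\<And>x y. x \<in> S \<Longrightarrow> x \<in> \<Omega>' \<Longrightarrow> y \<in> S \<Longrightarrow> y \<in> \<Omega>' \<Longrightarrow> norm (x - y) \<le> R \<Longrightarrow>
        \<bar>w j x - w j y\<bar> \<le> C * (?B x + ?B y + 1) * norm (x - y) powr \<gamma>"
    proof (rule weak_gradient_pointwise_holder[where U = \<Omega>' and R = R and i = j and \<Omega> = \<Omega> and F = f and w = w and g = g',
          OF O w(4,2,5) f(4) a'm a'b assms(4) low hol weak eqn U(1) cb2 R(1) gam(1,3) b(2) assms(8) osc j])
      fix S C
      assume "AE x in lborel. x \<in> S" "C \<ge> 0"
        "\<And>x y. x \<in> S \<Longrightarrow> x \<in> \<Omega>' \<Longrightarrow> y \<in> S \<Longrightarrow> y \<in> \<Omega>' \<Longrightarrow> norm (x - y) \<le> R \<Longrightarrow>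
          \<bar>w j x - w j y\<bar> \<le> C * (?B x + ?B y + 1) * norm (x - y) powr \<gamma>"
      then show thesis by (rule that)
    qed
    have "integrable lborel (\<lambda>x. indicator \<Omega>' x * \<bar>w j x\<bar> powr p)"
      using p1 p2 by (intro integrable_powr_mono[OF w(1)[OF j] U(1,2) _ _ w(6)[OF j]]) auto
    then have "(\<integral>\<^sup>+x. ennreal (norm (indicator \<Omega>' x * \<bar>w j x\<bar> powr p)) \<partial>lborel) < top"
      by (simp add: integrable_iff_bounded)
    also have "(\<integral>\<^sup>+x. ennreal (norm (indicator \<Omega>' x * \<bar>w j x\<bar> powr p)) \<partial>lborel) = (\<integral>\<^sup>+x. indicator \<Omega>' x * ennreal (\<bar>w j x\<bar> powr p) \<partial>lborel)"
      by (intro nn_integral_cong) (auto simp: indicator_def)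
    finally have wp: "(\<integral>\<^sup>+x. indicator \<Omega>' x * ennreal (\<bar>w j x\<bar> powr p) \<partial>lborel) < top" .
    show "(\<integral>\<^sup>+x. \<integral>\<^sup>+y. indicator \<Omega>' x * (indicator \<Omega>' y * ennreal (\<bar>w j x - w j y\<bar> powr p * norm (x - y) powr (- (?d + \<beta>' * p)))) \<partial>lborel \<partial>lborel) < top"
      by (rule gagliardo_of_pointwise_holder[OF w(1)[OF j] Bm B0 U(1,2) R(1) C(1) p1 _ gam(2) S C(2) Bp wp])
        (use \<beta>' in auto)
  qed (use p2 \<beta>' b assms(8) in auto)
  then show "Du \<in> Sobolev \<beta>' (2 * \<alpha> * q / (?d + 2 * \<beta>)) \<Omega>'" by (simp add: p_def)
qed

end
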